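(* For every integer $m\ge 0$ and every $\ell\in\mathbb{Z}$ there is a polynomial selfmap $\mathrm{SU}(3)\to\mathrm{SU}(3)$ of degree $4^m(2\ell+1)$.
   Context: A selfmap $\phi:\mathrm{SU}(3)\to\mathrm{SU}(3)$ is called polynomial if every entry of the target matrix $\phi(B)$ is a real polynomial (polynomial with real coefficients) in the complex entries $b_{ij}$ of the argument matrix $B=(b_{ij})\in\mathrm{SU}(3)$. *)

theory Defs
  imports "HOL-Analysis.Analysis" "HOL-Homology.Homology"
begin

definition conj_transpose :: "complex ^ 'n ^ 'm \<Rightarrow> complex ^ 'm ^ 'n" where
  "conj_transpose A = map_matrix cnj (transpose A)"

definition SU3 :: "(complex ^ 3 ^ 3) set" where
  "SU3 = {A. A ** conj_transpose A = mat 1 \<and> conj_transpose A ** A = mat 1 \<and> det A = 1}"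

text \<open>A polynomial in the nine variables \<open>b i j\<close> with real coefficients, written as a finite sum
  of monomials: \<open>E\<close> is a finite set of exponent matrices, \<open>c e\<close> the coefficient of the monomial
  with exponents \<open>e\<close>. The variables take complex values.\<close>

definition real_coeff_polynomial :: "(complex ^ 3 ^ 3 \<Rightarrow> complex) \<Rightarrow> bool" where
  "real_coeff_polynomial p \<longleftrightarrow>
     (\<exists>(E :: (3 \<Rightarrow> 3 \<Rightarrow> nat) set) (c :: (3 \<Rightarrow> 3 \<Rightarrow> nat) \<Rightarrow> real). finite E \<and>
        (\<forall>B. p B = (\<Sum>e\<in>E. complex_of_real (c e) * (\<Prod>i\<in>UNIV. \<Prod>j\<in>UNIV. (B $ i $ j) ^ e i j))))"

definition polynomial_selfmap_SU3 :: "(complex ^ 3 ^ 3 \<Rightarrow> complex ^ 3 ^ 3) \<Rightarrow> bool" where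
  "polynomial_selfmap_SU3 \<phi> \<longleftrightarrow>
     \<phi> \<in> SU3 \<rightarrow> SU3 \<and>
     (\<forall>i j. \<exists>p. real_coeff_polynomial p \<and> (\<forall>B\<in>SU3. \<phi> B $ i $ j = p B))"

text \<open>For a closed connected oriented \<open>n\<close>-manifold \<open>X\<close>, the group \<open>H\<^sub>n(X; \<int>)\<close> is infinite cyclic,
  and the degree of a continuous selfmap is the unique integer \<open>d\<close> such that the induced
  endomorphism is multiplication by \<open>d\<close>. The library writes homology groups multiplicatively, so
  this is the \<open>d\<close>-th power; compare \<open>Brouwer_degree2\<close>, which is the case of spheres.
  The predicate is only meaningful for such \<open>X\<close>.\<close>

definition has_mapping_degree :: "nat \<Rightarrow> 'a topology \<Rightarrow> ('a \<Rightarrow> 'a) \<Rightarrow> int \<Rightarrow> bool" where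
  "has_mapping_degree n X f d \<longleftrightarrow>
     continuous_map X X f \<and>
     (\<forall>x \<in> carrier (homology_group (int n) X).
        hom_induced (int n) X {} X {} f x = x [^]\<^bsub>homology_group (int n) X\<^esub> d)"

text \<open>\<open>SU(3)\<close> carries the subspace topology and is a closed connected orientable manifold of real
  dimension 8.\<close>

definition has_degree_SU3 :: "(complex ^ 3 ^ 3 \<Rightarrow> complex ^ 3 ^ 3) \<Rightarrow> int \<Rightarrow> bool" where
  "has_degree_SU3 \<phi> d \<longleftrightarrow> has_mapping_degree 8 (top_of_set SU3) \<phi> d"

end

theory Submission
  imports Defs
begin

text \<open>
  Let \<open>J\<close> be the rotation through a right angle in the first two coordinates, and for \<open>B\<close> in \<open>SU(3)\<close>
  put \<open>N B = B J B\<^sup>t J\<^sup>t\<close>, a polynomial in \<open>B\<close> that depends only on the last column of \<open>B\<close>, that is,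
  on a point of the five-sphere. The map \<open>B \<mapsto> N(B)\<^sup>l B\<close> has degree \<open>2 l + 1\<close>, the squaring map has
  degree \<open>4\<close>, and degrees multiply under composition.

  If \<open>M\<close> and \<open>M'\<close> depend only on the last column, they can be deformed so as to be trivial over
  complementary hemispheres of the five-sphere. Subdividing an 8-cycle accordingly gives
  \<open>[M M' B] + [B] = [M B] + [M' B]\<close>, so that the degree of \<open>B \<mapsto> N(B)\<^sup>l B\<close> is affine in \<open>l\<close>. It is \<open>1\<close> for
  \<open>l = 0\<close> and \<open>- 1\<close> for \<open>l = - 1\<close>, because \<open>N(B)\<^sup>-\<^sup>1 B\<close> is conjugate to the complex conjugate of \<open>B\<close>, and
  complex conjugation reverses the orientation by three Mayer--Vietoris steps.

  For the squaring map put \<open>M = N\<^sup>-\<^sup>1\<close>. The same method along the fibre \<open>SU(2)\<close> expresses the degrees of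
  \<open>M B B\<close>, \<open>B M B\<close> and \<open>M B M B\<close> through that of \<open>B B\<close>, the last one being \<open>deg (B B) - 8\<close>. On the other
  hand \<open>M B M B\<close> is conjugate to the complex conjugate of \<open>B B\<close>, whence \<open>- deg (B B) = deg (B B) - 8\<close>.
\<close>

section \<open>Cutting and pasting singular cycles\<close>

text \<open>The twist comes from the automorphism \<open>s(B) = J cnj(B) J^t\<close>. It fixes the
  stabilizer \<open>SU(2)\<close> of the last basis vector pointwise, since conjugation by
  \<open>J\<close> undoes complex conjugation there. Hence \<open>N(B) = B s(B)^-1\<close> does not
  change when \<open>B\<close> is multiplied on the right by \<open>SU(2)\<close>, so it depends on
  the last column alone; and in \<open>s(B)^-1 = J B^t J^t\<close> no conjugates are left, so it is
  a polynomial. The identity \<open>N(B)^-1 B = s(B)\<close> gives two computations of one degree: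
  the left side is accessible to cutting and pasting, the right side is multiplicative and reverses
  the orientation. The obstacle is that \<open>B\<close> and \<open>M(B)\<close> do not commute.
  Moving one past the other costs a commutator, whose degree has to be shown to vanish. Both this
  and the squaring map lead to an equation for twice a class. Dividing by 2 rests on the absence of
  2-torsion in degree 8, obtained by Mayer--Vietoris from the same decomposition of the five-sphere
  that serves complex conjugation. All identities are proved for an arbitrary 8-cycle, modulo
  boundaries.\<close>

lemma homologous_rel_intro_diff:
  "singular_relboundary p X S (a - b) \<Longrightarrow> homologous_rel p X S a b"
  by (simp add: homologous_rel_def)

text \<open>By subdivision a cycle is homologous to one whose simplices each lie in a member of the
  cover. The operator kills that cycle simplex by simplex, and it preserves the boundary by which
  the two cycles differ. In the applications \<open>T\<close> is an alternating sum of chain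
  maps.\<close>

lemma boundary_of_locally_vanishing_operator:
  fixes T :: "'a chain \<Rightarrow> 'b chain"
  assumes diff: "\<And>a b. T (a - b) = T a - T b"
    and bd: "\<And>a. singular_relboundary p X {} a \<Longrightarrow> singular_relboundary p Y {} (T a)"
    and op: "\<And>U. U \<in> \<C> \<Longrightarrow> openin X U" and cov: "topspace X \<subseteq> \<Union>\<C>"
    and van: "\<And>U s. U \<in> \<C> \<Longrightarrow> singular_simplex p (subtopology X U) s \<Longrightarrow> T (frag_of s) = 0"
    and c: "singular_relcycle p X {} c"
  shows "singular_relboundary p Y {} (T c)"
proof -
  obtain c' where c': "singular_relcycle p X {} c'" "homologous_rel p X {} c c'"
    "\<And>f. f \<in> Poly_Mapping.keys c' \<Longrightarrow> \<exists>V \<in> \<C>. f \<in> (standard_simplex p) \<rightarrow> V"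
    using small_homologous_rel_relcycle_exists [OF op cov c] by metis
  have T0: "T 0 = 0"
    using diff [of 0 0] by simp
  have "Poly_Mapping.keys c' \<subseteq> {s. \<exists>U\<in>\<C>. singular_simplex p (subtopology X U) s}"
  proof
    fix f assume f: "f \<in> Poly_Mapping.keys c'"
    then obtain V where V: "V \<in> \<C>" "f \<in> (standard_simplex p) \<rightarrow> V"
      using c' by blast
    have "singular_simplex p X f"
      using c'(1) f unfolding singular_cycle singular_chain_def by blast
    then show "f \<in> {s. \<exists>U\<in>\<C>. singular_simplex p (subtopology X U) s}"
      using V by (auto simp: singular_simplex_subtopology)
  qed
  then have "T c' = 0"
  proof (induction rule: frag_induction)
    case (one x)
    then show ?case using van by blast
  qed (auto simp: T0 diff)
  moreover have "singular_relboundary p Y {} (T (c - c'))"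
    using c'(2) bd by (simp add: homologous_rel_def)
  ultimately show ?thesis
    by (simp add: diff)
qed

lemma singular_relboundary_chain_map_abs:
  assumes "continuous_map X Y f" "singular_relboundary p X {} a"
  shows "singular_relboundary p Y {} (chain_map p f a)"
  using singular_relboundary_chain_map [OF assms(2,1)] by simp

lemma simplex_map_cong_subtopology:
  assumes "singular_simplex p (subtopology X U) s" "\<And>x. x \<in> topspace X \<Longrightarrow> x \<in> U \<Longrightarrow> f x = g x"
  shows "simplex_map p f s = simplex_map p g s"
  by (rule simplex_map_eq [OF assms(1)]) (use assms(2) in auto)

text \<open>Over each of the two sets the four maps agree in pairs of opposite sign, so
  \<open>F + K - G - H\<close> annihilates every small simplex. The pattern is a square:
  \<open>F\<close> has two letters active, \<open>K\<close> none, \<open>G\<close> and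
  \<open>H\<close> one each.\<close>

lemma cut_and_paste4:
  assumes cont: "continuous_map X Y F" "continuous_map X Y K"
      "continuous_map X Y G" "continuous_map X Y H"
    and op: "openin X A" "openin X B" and cov: "topspace X \<subseteq> A \<union> B"
    and A: "\<And>x. x \<in> topspace X \<Longrightarrow> x \<in> A \<Longrightarrow> F x = H x \<and> G x = K x"
    and B: "\<And>x. x \<in> topspace X \<Longrightarrow> x \<in> B \<Longrightarrow> F x = G x \<and> H x = K x"
    and c: "singular_relcycle p X {} c"
  shows "homologous_rel p Y {} (chain_map p F c + chain_map p K c) (chain_map p G c + chain_map p H c)"
proof -
  let ?T = "\<lambda>a. chain_map p F a + chain_map p K a - (chain_map p G a + chain_map p H a)"
  have "singular_relboundary p Y {} (?T c)"
  proof (rule boundary_of_locally_vanishing_operator [where \<C> = "{A,B}" and T = ?T, OF _ _ _ _ _ c])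
    fix a :: "'a chain" assume "singular_relboundary p X {} a"
    then show "singular_relboundary p Y {} (?T a)"
      by (intro singular_relboundary_diff singular_relboundary_add singular_relboundary_chain_map_abs [OF cont(1)]
        singular_relboundary_chain_map_abs [OF cont(2)] singular_relboundary_chain_map_abs [OF cont(3)]
        singular_relboundary_chain_map_abs [OF cont(4)])
  next
    fix U s assume U: "U \<in> {A,B}" and s: "singular_simplex p (subtopology X U) s"
    consider "U = A" | "U = B" using U by blast
    then show "?T (frag_of s) = 0"
    proof cases
      case 1
      then have "simplex_map p F s = simplex_map p H s" "simplex_map p G s = simplex_map p K s"
        using simplex_map_cong_subtopology [OF s] A by metis+
      then show ?thesis by simp
    next
      case 2
      then have "simplex_map p F s = simplex_map p G s" "simplex_map p H s = simplex_map p K s"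
        using simplex_map_cong_subtopology [OF s] B by metis+
      then show ?thesis by simp
    qed
  qed (use op cov in \<open>auto simp: chain_map_diff\<close>)
  then show ?thesis by (rule homologous_rel_intro_diff)
qed

text \<open>The indices are the vertices of a cube, read in binary, and the maps on the left are
  those with an even number of digits 1. Each set identifies the ends of the four edges in one
  direction, and an edge joins vertices of opposite sign, so the alternating sum vanishes on small
  simplices.\<close>

lemma cut_and_paste8:
  assumes cont: "\<And>i. i < (8::nat) \<Longrightarrow> continuous_map X Y (F i)"
    and op: "openin X A" "openin X B" "openin X C" and cov: "topspace X \<subseteq> A \<union> B \<union> C"
    and A: "\<And>x. x \<in> topspace X \<Longrightarrow> x \<in> A \<Longrightarrow> F 0 x = F 4 x \<and> F 1 x = F 5 x \<and> F 2 x = F 6 x \<and> F 3 x = F 7 x"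
    and B: "\<And>x. x \<in> topspace X \<Longrightarrow> x \<in> B \<Longrightarrow> F 0 x = F 1 x \<and> F 2 x = F 3 x \<and> F 4 x = F 5 x \<and> F 6 x = F 7 x"
    and C: "\<And>x. x \<in> topspace X \<Longrightarrow> x \<in> C \<Longrightarrow> F 0 x = F 2 x \<and> F 1 x = F 3 x \<and> F 4 x = F 6 x \<and> F 5 x = F 7 x"
    and c: "singular_relcycle p X {} c"
  shows "homologous_rel p Y {}
     (chain_map p (F 0) c + chain_map p (F 3) c + chain_map p (F 5) c + chain_map p (F 6) c)
     (chain_map p (F 1) c + chain_map p (F 2) c + chain_map p (F 4) c + chain_map p (F 7) c)"
proof -
  let ?T = "\<lambda>c. chain_map p (F 0) c + chain_map p (F 3) c + chain_map p (F 5) c + chain_map p (F 6) c - 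
     (chain_map p (F 1) c + chain_map p (F 2) c + chain_map p (F 4) c + chain_map p (F 7) c)"
  have c8: "continuous_map X Y (F 0)" "continuous_map X Y (F 1)" "continuous_map X Y (F 2)"
    "continuous_map X Y (F 3)" "continuous_map X Y (F 4)" "continuous_map X Y (F 5)"
    "continuous_map X Y (F 6)" "continuous_map X Y (F 7)"
    by (rule cont, simp)+
  have "singular_relboundary p Y {} (?T c)"
  proof (rule boundary_of_locally_vanishing_operator [where \<C> = "{A,B,C}" and T = ?T, OF _ _ _ _ _ c])
    fix a :: "'a chain" assume "singular_relboundary p X {} a"
    then show "singular_relboundary p Y {} (?T a)"
      by (intro singular_relboundary_diff singular_relboundary_add singular_relboundary_chain_map_abs [of X Y] c8)
  next
    fix U s assume U: "U \<in> {A,B,C}" and s: "singular_simplex p (subtopology X U) s"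
    note eq = simplex_map_cong_subtopology [OF s]
    consider "U = A" | "U = B" | "U = C" using U by blast
    then show "?T (frag_of s) = 0"
    proof cases
      case 1
      then have "simplex_map p (F 0) s = simplex_map p (F 4) s" "simplex_map p (F 1) s = simplex_map p (F 5) s"
        "simplex_map p (F 2) s = simplex_map p (F 6) s" "simplex_map p (F 3) s = simplex_map p (F 7) s"
        using eq A by metis+
      then show ?thesis by (simp only: chain_map_of) simp
    next
      case 2
      then have "simplex_map p (F 0) s = simplex_map p (F 1) s" "simplex_map p (F 2) s = simplex_map p (F 3) s"
        "simplex_map p (F 4) s = simplex_map p (F 5) s" "simplex_map p (F 6) s = simplex_map p (F 7) s"
        using eq B by metis+
      then show ?thesis by (simp only: chain_map_of) simp
    next
      case 3
      then have "simplex_map p (F 0) s = simplex_map p (F 2) s" "simplex_map p (F 1) s = simplex_map p (F 3) s"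
        "simplex_map p (F 4) s = simplex_map p (F 6) s" "simplex_map p (F 5) s = simplex_map p (F 7) s"
        using eq C by metis+
      then show ?thesis by (simp only: chain_map_of) simp
    qed
  qed (use op cov in \<open>auto simp: chain_map_diff\<close>)
  then show ?thesis by (rule homologous_rel_intro_diff)
qed

section \<open>Vanishing and 2-torsion of homology in a single degree\<close>

definition acyclic_in :: "nat \<Rightarrow> 'a topology \<Rightarrow> bool" where
  "acyclic_in p X \<longleftrightarrow> (\<forall>c. singular_relcycle p X {} c \<longrightarrow> singular_relboundary p X {} c)"

definition no_2_torsion_in :: "nat \<Rightarrow> 'a topology \<Rightarrow> bool" where
  "no_2_torsion_in p X \<longleftrightarrow> (\<forall>c. singular_relcycle p X {} c \<longrightarrow>
     singular_relboundary p X {} (c + c) \<longrightarrow> singular_relboundary p X {} c)"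

lemma chain_map_cong_boundary:
  assumes "homotopic_with (\<lambda>h. True) X Y f g" "singular_relcycle p X {} c"
  shows "homologous_rel p Y {} (chain_map p f c) (chain_map p g c)"
proof (rule homotopic_imp_homologous_rel_chain_maps [OF _ assms(2)])
  show "homotopic_with (\<lambda>h. h \<in> {} \<rightarrow> {}) X Y f g"
    by (rule homotopic_with_mono [OF assms(1)]) auto
qed

lemma factor_through_acyclic:
  assumes "acyclic_in p Y" "continuous_map X Y f" "continuous_map Y Z g" "singular_relcycle p X {} c"
  shows "singular_relboundary p Z {} (chain_map p (g \<circ> f) c)"
proof -
  have "singular_relboundary p Y {} (chain_map p f c)"
    using assms singular_relcycle_chain_map [OF assms(4,2)] unfolding acyclic_in_def by simp
  then show ?thesis
    using singular_relboundary_chain_map_abs [OF assms(3)] by (simp add: chain_map_compose)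
qed

lemma relboundary_iff_homologous:
  "homologous_rel p X S a b \<Longrightarrow> singular_relboundary p X S a \<longleftrightarrow> singular_relboundary p X S b"
  using singular_relboundary_add [of p X S "a - b" b] singular_relboundary_diff [of p X S a "a - b"]
  by (auto simp: homologous_rel_def)

lemma chain_map_homotopic_id:
  assumes "homotopic_with (\<lambda>h. True) X X f id" "singular_relcycle p X {} c"
  shows "homologous_rel p X {} (chain_map p f c) c"
  using chain_map_cong_boundary [OF assms] assms(2) chain_map_ident [of p X c] unfolding singular_cycle by simp

text \<open>A cycle is homologous to its image under \<open>g \<circ> f\<close>, and this image
  bounds because it passes through \<open>Y\<close>.\<close>

lemma acyclic_in_dominated:
  assumes "acyclic_in p Y" "continuous_map X Y f" "continuous_map Y X g"
    "homotopic_with (\<lambda>h. True) X X (g \<circ> f) id"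
  shows "acyclic_in p X"
  unfolding acyclic_in_def
  using factor_through_acyclic [OF assms(1-3)] chain_map_homotopic_id [OF assms(4)] relboundary_iff_homologous
  by blast

lemma no_2_torsion_in_dominated:
  assumes "no_2_torsion_in p Y" "continuous_map X Y f" "continuous_map Y X g"
    "homotopic_with (\<lambda>h. True) X X (g \<circ> f) id"
  shows "no_2_torsion_in p X"
  unfolding no_2_torsion_in_def
proof (intro allI impI)
  fix c assume c: "singular_relcycle p X {} c" and cc: "singular_relboundary p X {} (c + c)"
  have "singular_relboundary p Y {} (chain_map p f c + chain_map p f c)"
    using singular_relboundary_chain_map_abs [OF assms(2) cc] by (simp add: chain_map_add)
  then have "singular_relboundary p Y {} (chain_map p f c)"
    using assms(1) singular_relcycle_chain_map [OF c assms(2)] unfolding no_2_torsion_in_def by simp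
  then have "singular_relboundary p X {} (chain_map p (g \<circ> f) c)"
    using singular_relboundary_chain_map_abs [OF assms(3)] by (simp add: chain_map_compose)
  then show "singular_relboundary p X {} c"
    using chain_map_homotopic_id [OF assms(4) c] relboundary_iff_homologous by blast
qed

lemma acyclic_in_iff_trivial: "acyclic_in p X \<longleftrightarrow> trivial_group (homology_group (int p) X)"
proof -
  let ?H = "homology_group (int p) X"
  have H: "carrier ?H = homologous_rel_set p X {} ` singular_relcycle_set p X {}"
    "\<one>\<^bsub>?H\<^esub> = singular_relboundary_set p X {}"
    by (simp_all add: carrier_relative_homology_group)
  have "\<one>\<^bsub>?H\<^esub> \<in> carrier ?H"
    by (rule monoid.one_closed [OF group.is_monoid [OF group_relative_homology_group]])
  then have "trivial_group ?H \<longleftrightarrow> (\<forall>x\<in>carrier ?H. x = \<one>\<^bsub>?H\<^esub>)"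
    unfolding trivial_group_def by auto
  also have "\<dots> \<longleftrightarrow> acyclic_in p X"
    unfolding H acyclic_in_def by (simp add: homologous_rel_set_eq_relboundary)
  finally show ?thesis by simp
qed

lemma acyclic_in_nsphere:
  assumes "p \<noteq> n" "p \<noteq> 0"
  shows "acyclic_in p (nsphere n)"
  using trivial_reduced_homology_group_nsphere [of "int p" n] assms
  by (simp add: acyclic_in_iff_trivial un_reduced_homology_group)

text \<open>The group operation on classes is defined as the set of all sums of representatives; for
  the inclusion that is not immediate, an element \<open>t\<close> is split as
  \<open>a + (t - a)\<close>.\<close>

lemma relcycle_add_set:
  assumes "singular_relcycle p X {} a" "singular_relcycle p X {} b"
  shows "homologous_rel_set p X {} a \<otimes>\<^bsub>homology_group (int p) X\<^esub> homologous_rel_set p X {} b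
    = homologous_rel_set p X {} (a + b)"
proof -
  have "r + s \<in> homologous_rel_set p X {} (a+b)"
    if "r \<in> homologous_rel_set p X {} a" "s \<in> homologous_rel_set p X {} b" for r s
    using that homologous_rel_add by fastforce
  moreover have "\<exists>r\<in>homologous_rel_set p X {} a. \<exists>s \<in> homologous_rel_set p X {} b. t = r + s"
    if "t \<in> homologous_rel_set p X {} (a + b)" for t
  proof (rule bexI [where x=a], rule bexI [where x = "t - a"])
    have "singular_relboundary p X {} (a + b - t)"
      using that by (simp add: homologous_rel_def)
    then show "t - a \<in> homologous_rel_set p X {} b"
      by (simp add: homologous_rel_def algebra_simps)
  qed auto
  ultimately show ?thesis
    unfolding mult_relative_homology_group by blast
qed

text \<open>Doubling is injective on an infinite cyclic group. Dimension 0 is excluded because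
  ordinary and reduced homology differ in degree 0.\<close>

lemma no_2_torsion_in_nsphere:
  assumes "n \<noteq> 0"
  shows "no_2_torsion_in n (nsphere n)"
  unfolding no_2_torsion_in_def
proof (intro allI impI)
  let ?H = "homology_group (int n) (nsphere n)"
  fix c assume c: "singular_relcycle n (nsphere n) {} c"
    and cc: "singular_relboundary n (nsphere n) {} (c + c)"
  let ?x = "homologous_rel_set n (nsphere n) {} c"
  have "?H \<cong> integer_group"
    using reduced_homology_group_nsphere(1) [of n] assms by (simp add: un_reduced_homology_group)
  then obtain h where h: "h \<in> iso ?H integer_group"
    unfolding is_iso_def by blast
  have x: "?x \<in> carrier ?H"
    using c by (auto simp: carrier_relative_homology_group)
  have one: "?x \<otimes>\<^bsub>?H\<^esub> ?x = \<one>\<^bsub>?H\<^esub>"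
    using cc by (simp add: relcycle_add_set [OF c c] homologous_rel_set_eq_relboundary)
  have hom: "h \<in> hom ?H integer_group" and inj: "inj_on h (carrier ?H)"
    using h by (auto simp: iso_def bij_betw_def)
  have "h \<one>\<^bsub>?H\<^esub> = 0"
    using hom_one [OF hom] by simp
  moreover have "h (?x \<otimes>\<^bsub>?H\<^esub> ?x) = h ?x + h ?x"
    using hom_mult [OF hom x x] by simp
  ultimately have "h ?x = h \<one>\<^bsub>?H\<^esub>"
    using one by simp
  then have "?x = \<one>\<^bsub>?H\<^esub>"
    using inj x by (metis group.is_monoid group_relative_homology_group inj_onD monoid.one_closed)
  then show "singular_relboundary n (nsphere n) {} c"
    by (simp add: homologous_rel_set_eq_relboundary)
qed

section \<open>Powers of homology classes and the mapping degree\<close>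

lemma homologous_rel_cmul_pow_nat:
  assumes "singular_relcycle p X {} c"
  shows "homologous_rel_set p X {} c [^]\<^bsub>homology_group (int p) X\<^esub> (n::nat)
     = homologous_rel_set p X {} (frag_cmul (int n) c)"
proof (induction n)
  case 0
  then show ?case
    by (simp add: homologous_rel_set_eq_relboundary [of p X "{}" 0, simplified] homologous_rel_set_eq_relboundary)
next
  case (Suc n)
  have "frag_cmul (int n) c + c = frag_cmul (int (Suc n)) c"
    using frag_cmul_distrib [of "int n" 1 c] by (simp add: add.commute)
  then show ?case
    using relcycle_add_set [OF singular_relcycle_cmul [OF assms, of "int n"] assms] Suc
    by (simp only: nat_pow_Suc)
qed

lemma homologous_rel_cmul_pow:
  assumes c: "singular_relcycle p X {} c"
  shows "homologous_rel_set p X {} c [^]\<^bsub>homology_group (int p) X\<^esub> (n::int)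
     = homologous_rel_set p X {} (frag_cmul n c)"
proof (cases "n \<ge> 0")
  case True
  then have "int (nat n) = n" "\<not> n < 0" by auto
  then show ?thesis
    using homologous_rel_cmul_pow_nat [OF c, of "nat n"] by (simp only: int_pow_def2 if_False)
next
  case False
  let ?H = "homology_group (int p) X"
  interpret group ?H by (rule group_relative_homology_group)
  let ?x = "\<lambda>d. homologous_rel_set p X {} d"
  have cyc: "singular_relcycle p X {} (frag_cmul k c)" for k
    by (rule singular_relcycle_cmul [OF c])
  have mem: "?x (frag_cmul k c) \<in> carrier ?H" for k
    unfolding carrier_relative_homology_group using cyc by blast
  have k: "int (nat (-n)) = - n" and n: "n < 0" using False by auto
  have "?x c [^]\<^bsub>?H\<^esub> n = inv\<^bsub>?H\<^esub> (?x c [^]\<^bsub>?H\<^esub> nat (-n))"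
    by (simp only: int_pow_def2 n if_True)
  also have "\<dots> = inv\<^bsub>?H\<^esub> (?x (frag_cmul (-n) c))"
    by (simp only: homologous_rel_cmul_pow_nat [OF c] k)
  also have "\<dots> = ?x (frag_cmul n c)"
  proof (rule inv_equality [OF _ mem mem])
    have "frag_cmul n c + frag_cmul (-n) c = 0"
      using frag_cmul_distrib [of n "-n" c] by simp
    then show "?x (frag_cmul n c) \<otimes>\<^bsub>?H\<^esub> ?x (frag_cmul (-n) c) = \<one>\<^bsub>?H\<^esub>"
      by (simp only: relcycle_add_set [OF cyc cyc] one_relative_homology_group homologous_rel_set_eq_relboundary)
        simp
  qed
  finally show ?thesis .
qed

text \<open>A power of a class is represented by an integer multiple of a cycle, so degrees can be
  computed with chains alone.\<close>

lemma has_mapping_degree_chain: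
  assumes f: "continuous_map X X f"
    and "\<And>c. singular_relcycle p X {} c \<Longrightarrow> homologous_rel p X {} (chain_map p f c) (frag_cmul d c)"
  shows "has_mapping_degree p X f d"
  unfolding has_mapping_degree_def
proof (intro conjI ballI f)
  fix x assume "x \<in> carrier (homology_group (int p) X)"
  then obtain c where c: "singular_relcycle p X {} c" and x: "x = homologous_rel_set p X {} c"
    by (auto simp: carrier_relative_homology_group)
  show "hom_induced (int p) X {} X {} f x = x [^]\<^bsub>homology_group (int p) X\<^esub> d"
    unfolding x homologous_rel_cmul_pow [OF c]
    using assms(2) [OF c] by (simp add: hom_induced_chain_map [OF f _ c] homologous_rel_set_eq)
qed

section \<open>Mayer--Vietoris arguments\<close>

lemma singular_chain_split:
  assumes "singular_chain p X c"
    "\<And>f. f \<in> Poly_Mapping.keys c \<Longrightarrow> \<exists>V \<in> {A,B}. f \<in> (standard_simplex p) \<rightarrow> V"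
  obtains a b where "singular_chain p (subtopology X A) a" "singular_chain p (subtopology X B) b" "c = a + b"
proof -
  have "Poly_Mapping.keys c \<subseteq> singular_simplex_set p (subtopology X A) \<union> singular_simplex_set p (subtopology X B)"
    using assms by (fastforce simp: singular_chain_def singular_simplex_subtopology)
  then show ?thesis
    using frag_split [of c "singular_simplex_set p (subtopology X A)" "singular_simplex_set p (subtopology X B)"]
      that unfolding singular_chain_def by metis
qed

lemma singular_chain_Int:
  assumes "singular_chain p (subtopology X A) c" "singular_chain p (subtopology X B) c"
  shows "singular_chain p (subtopology X (A \<inter> B)) c"
  using assms by (auto simp: singular_chain_subtopology)

lemma boundary_subtopology_imp:
  assumes "singular_relboundary p (subtopology X A) {} c"
  shows "singular_relboundary p X {} c"
  using assms by (auto simp: singular_boundary singular_chain_subtopology)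

lemma frag_cmul_uminus: "frag_cmul k (- y) = - frag_cmul k y"
  using frag_cmul_distrib2 [of k y "- y"] by (simp add: add_eq_0_iff)

lemma frag_cmul_diff_right: "frag_cmul k (a - b) = frag_cmul k a - frag_cmul k b"
  using frag_cmul_distrib2 [of k a "- b"] by (simp add: frag_cmul_uminus)

text \<open>Split a subdivided cycle as \<open>a + b\<close> and let \<open>y\<close> be the
  boundary of \<open>a\<close>, which lives in the intersection. As \<kappa> interchanges the two
  sets, \<open>\<kappa> b\<close> lies in \<open>A\<close> and has boundary
  \<open>- \<kappa> y\<close>, not \<open>\<kappa> y\<close>: this is the origin of the sign. With a
  chain \<open>e\<close> realising \<open>\<kappa> y ~ \<epsilon> y\<close>, the chains
  \<open>?u\<close> and \<open>?v\<close> are closed in \<open>A\<close> and in \<open>B\<close>,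
  hence bound, and their sum is \<open>\<kappa> c + \<epsilon> c\<close> for the subdivided
  cycle.\<close>

lemma Mayer_Vietoris_sign:
  assumes op: "openin X A" "openin X B" and cov: "topspace X \<subseteq> A \<union> B"
    and k: "continuous_map X X \<kappa>" and kA: "\<kappa> ` A \<subseteq> B" and kB: "\<kappa> ` B \<subseteq> A"
    and acA: "acyclic_in (Suc p) (subtopology X A)" and acB: "acyclic_in (Suc p) (subtopology X B)"
    and eps: "\<And>y. singular_relcycle p (subtopology X (A \<inter> B)) {} y \<Longrightarrow>
       homologous_rel p (subtopology X (A \<inter> B)) {} (chain_map p \<kappa> y) (frag_cmul \<epsilon> y)"
    and c: "singular_relcycle (Suc p) X {} c"
  shows "homologous_rel (Suc p) X {} (chain_map (Suc p) \<kappa> c) (frag_cmul (- \<epsilon>) c)"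
proof -
  obtain c' where c': "singular_relcycle (Suc p) X {} c'" "homologous_rel (Suc p) X {} c c'"
    "\<And>f. f \<in> Poly_Mapping.keys c' \<Longrightarrow> \<exists>V \<in> {A,B}. f \<in> (standard_simplex (Suc p)) \<rightarrow> V"
    using small_homologous_rel_relcycle_exists [OF _ _ c, of "{A,B}"] op cov by auto
  then obtain a b where a: "singular_chain (Suc p) (subtopology X A) a"
    and b: "singular_chain (Suc p) (subtopology X B) b" and ab: "c' = a + b"
    using singular_chain_split [of "Suc p" X c' A B] unfolding singular_cycle by metis
  have aX: "singular_chain (Suc p) X a" and bX: "singular_chain (Suc p) X b"
    using a b by (auto simp: singular_chain_subtopology)
  define y where "y = chain_boundary (Suc p) a"
  have yb: "chain_boundary (Suc p) b = - y"
    using c'(1) unfolding singular_cycle ab y_def chain_boundary_add by (simp add: add_eq_0_iff2)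
  have yA: "singular_chain p (subtopology X A) y"
    using singular_chain_boundary_alt [OF a] by (simp add: y_def)
  have "singular_chain p (subtopology X B) (- y)"
    using singular_chain_boundary_alt [OF b] by (simp add: yb)
  then have yAB: "singular_chain p (subtopology X (A \<inter> B)) y"
    using yA by (intro singular_chain_Int) (simp_all add: singular_chain_minus)
  have "chain_boundary p y = 0"
    unfolding y_def using chain_boundary_boundary_alt [OF a] by simp
  then have y: "singular_relcycle p (subtopology X (A \<inter> B)) {} y"
    using yAB by (simp add: singular_cycle)
  obtain e where e: "singular_chain (Suc p) (subtopology X (A \<inter> B)) e"
    and de: "chain_boundary (Suc p) e = chain_map p \<kappa> y - frag_cmul \<epsilon> y"
    using eps [OF y] unfolding homologous_rel_def singular_boundary by blast
  have eA: "singular_chain (Suc p) (subtopology X A) e" and eB: "singular_chain (Suc p) (subtopology X B) e"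
    using e by (auto simp: singular_chain_subtopology)
  have kAB: "continuous_map (subtopology X A) (subtopology X B) \<kappa>"
    and kBA: "continuous_map (subtopology X B) (subtopology X A) \<kappa>"
    using k kA kB by (auto simp: continuous_map_in_subtopology continuous_map_from_subtopology)
  have ka: "singular_chain (Suc p) (subtopology X B) (chain_map (Suc p) \<kappa> a)"
    and kb: "singular_chain (Suc p) (subtopology X A) (chain_map (Suc p) \<kappa> b)"
    using singular_chain_chain_map [OF a kAB] singular_chain_chain_map [OF b kBA] by auto
  have dka: "chain_boundary (Suc p) (chain_map (Suc p) \<kappa> a) = chain_map p \<kappa> y"
    and dkb: "chain_boundary (Suc p) (chain_map (Suc p) \<kappa> b) = - chain_map p \<kappa> y"
    using chain_boundary_chain_map [OF aX] chain_boundary_chain_map [OF bX]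
    by (simp_all add: yb chain_map_minus flip: y_def)
  let ?u = "chain_map (Suc p) \<kappa> b + frag_cmul \<epsilon> a + e"
  let ?v = "chain_map (Suc p) \<kappa> a + frag_cmul \<epsilon> b - e"
  have "singular_relcycle (Suc p) (subtopology X A) {} ?u"
    unfolding singular_cycle
    by (intro conjI singular_chain_add singular_chain_cmul kb a eA)
       (simp add: chain_boundary_add chain_boundary_cmul dkb de flip: y_def)
  then have u: "singular_relboundary (Suc p) X {} ?u"
    using acA boundary_subtopology_imp unfolding acyclic_in_def by blast
  have "singular_relcycle (Suc p) (subtopology X B) {} ?v"
    unfolding singular_cycle
    by (intro conjI singular_chain_add singular_chain_diff singular_chain_cmul ka b eB)
       (simp add: chain_boundary_add chain_boundary_diff chain_boundary_cmul dka de yb frag_cmul_uminus)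
  then have v: "singular_relboundary (Suc p) X {} ?v"
    using acB boundary_subtopology_imp unfolding acyclic_in_def by blast
  have cc': "singular_relboundary (Suc p) X {} (c - c')"
    using c'(2) by (simp add: homologous_rel_def)
  have "singular_relboundary (Suc p) X {}
     (chain_map (Suc p) \<kappa> (c - c') + frag_cmul \<epsilon> (c - c') + (?u + ?v))"
    by (intro singular_relboundary_add singular_relboundary_chain_map_abs [OF k]
        singular_relboundary_cmul cc' u v)
  moreover have "chain_map (Suc p) \<kappa> (c - c') + frag_cmul \<epsilon> (c - c') + (?u + ?v)
     = chain_map (Suc p) \<kappa> c - frag_cmul (- \<epsilon>) c"
    by (simp add: ab chain_map_diff chain_map_add frag_cmul_distrib2 frag_cmul_diff_right algebra_simps flip: minus_frag_cmul)
  ultimately show ?thesis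
    by (simp add: homologous_rel_def)
qed

text \<open>The cycle and the chain that bounds its double are subdivided equally often, so that the
  boundary relation between them survives; each of the two is then split along the cover.\<close>

lemma Mayer_Vietoris_double_boundary:
  assumes op: "openin X A" "openin X B" and cov: "topspace X \<subseteq> A \<union> B"
    and c: "singular_relcycle p X {} c" and cc: "singular_relboundary p X {} (c + c)"
  obtains a b u v where "singular_chain p (subtopology X A) a" "singular_chain p (subtopology X B) b"
    "singular_chain (Suc p) (subtopology X A) u" "singular_chain (Suc p) (subtopology X B) v"
    "singular_relcycle p X {} (a + b)" "homologous_rel p X {} c (a + b)"
    "chain_boundary (Suc p) (u + v) = (a + b) + (a + b)"
proof -
  obtain w where w: "singular_chain (Suc p) X w" and dw: "chain_boundary (Suc p) w = c + c"
    using cc unfolding singular_boundary by blast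
  have cX: "singular_chain p X c" using c by (simp add: singular_cycle)
  have *: "openin X U" if "U \<in> {A,B}" for U using op that by blast
  have **: "topspace X \<subseteq> \<Union>{A,B}" using cov by auto
  obtain n1 where n1: "\<And>m f. \<lbrakk>n1 \<le> m; f \<in> Poly_Mapping.keys ((singular_subdivision p ^^ m) c)\<rbrakk>
                      \<Longrightarrow> \<exists>V \<in> {A,B}. f \<in> (standard_simplex p) \<rightarrow> V"
    using sufficient_iterated_singular_subdivision_exists [OF * ** cX] by blast
  obtain n2 where n2: "\<And>m f. \<lbrakk>n2 \<le> m; f \<in> Poly_Mapping.keys ((singular_subdivision (Suc p) ^^ m) w)\<rbrakk>
                      \<Longrightarrow> \<exists>V \<in> {A,B}. f \<in> (standard_simplex (Suc p)) \<rightarrow> V"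
    using sufficient_iterated_singular_subdivision_exists [OF * ** w] by blast
  define m where "m = max n1 n2"
  have sd: "singular_chain q X ((singular_subdivision q ^^ k) z)" if "singular_chain q X z" for q k and z :: "'a chain"
    by (induction k) (auto simp: that singular_chain_singular_subdivision)
  have "chain_boundary (Suc p) ((singular_subdivision (Suc p) ^^ k) w) =
     (singular_subdivision p ^^ k) (c + c)" for k
    by (induction k) (simp_all add: dw chain_boundary_singular_subdivision [OF sd [OF w]])
  moreover have "(singular_subdivision p ^^ k) (c + c) = (singular_subdivision p ^^ k) c + (singular_subdivision p ^^ k) c" for k
    by (induction k) (simp_all add: singular_subdivision_add)
  ultimately have dsd: "chain_boundary (Suc p) ((singular_subdivision (Suc p) ^^ m) w)
     = (singular_subdivision p ^^ m) c + (singular_subdivision p ^^ m) c" by simp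
  have hom: "homologous_rel p X {} c ((singular_subdivision p ^^ k) c) \<and>
     singular_relcycle p X {} ((singular_subdivision p ^^ k) c)" for k
  proof (induction k)
    case (Suc k)
    then have h: "homologous_rel p X {} ((singular_subdivision p ^^ k) c) ((singular_subdivision p ^^ Suc k) c)"
      using homologous_rel_singular_subdivision homologous_rel_sym by fastforce
    then show ?case
      using Suc homologous_rel_trans homologous_rel_singular_relcycle by blast
  qed (use c in simp)
  obtain a b where ab: "singular_chain p (subtopology X A) a" "singular_chain p (subtopology X B) b"
    "(singular_subdivision p ^^ m) c = a + b"
    using singular_chain_split [OF sd [OF cX, of m], of A B] n1 [of m] m_def by auto
  obtain u v where uv: "singular_chain (Suc p) (subtopology X A) u" "singular_chain (Suc p) (subtopology X B) v"
    "(singular_subdivision (Suc p) ^^ m) w = u + v"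
    using singular_chain_split [OF sd [OF w, of m], of A B] n2 [of m] m_def by auto
  show thesis
    using that [OF ab(1,2) uv(1,2)] hom [of m] dsd unfolding ab(3) uv(3) by blast
qed

text \<open>Acyclicity of the two sets makes the connecting homomorphism into the homology of the
  intersection injective, and 2-torsion would be carried along. On chains: twice the boundary
  \<open>y\<close> of \<open>a\<close> bounds in the intersection, so \<open>y\<close> itself bounds
  a chain \<open>f\<close> there, and \<open>a - f\<close> and \<open>b + f\<close> are cycles in
  acyclic sets.\<close>

lemma no_2_torsion_in_Mayer_Vietoris:
  assumes op: "openin X A" "openin X B" and cov: "topspace X \<subseteq> A \<union> B"
    and acA: "acyclic_in (Suc p) (subtopology X A)" and acB: "acyclic_in (Suc p) (subtopology X B)"
    and AB: "no_2_torsion_in p (subtopology X (A \<inter> B))"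
  shows "no_2_torsion_in (Suc p) X"
  unfolding no_2_torsion_in_def
proof (intro allI impI)
  fix c assume c: "singular_relcycle (Suc p) X {} c" and cc: "singular_relboundary (Suc p) X {} (c + c)"
  obtain a b u v where a: "singular_chain (Suc p) (subtopology X A) a"
    and b: "singular_chain (Suc p) (subtopology X B) b"
    and u: "singular_chain (Suc (Suc p)) (subtopology X A) u"
    and v: "singular_chain (Suc (Suc p)) (subtopology X B) v"
    and cyc: "singular_relcycle (Suc p) X {} (a + b)" and hom: "homologous_rel (Suc p) X {} c (a + b)"
    and d: "chain_boundary (Suc (Suc p)) (u + v) = (a + b) + (a + b)"
    using Mayer_Vietoris_double_boundary [OF op cov c cc] by metis
  \<comment> \<open>Computed from \<open>a\<close> and \<open>u\<close> this chain lies in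
    \<open>A\<close>; by the relation for \<open>u + v\<close> it is also given by \<open>b\<close>
    and \<open>v\<close>, hence lies in \<open>B\<close>. Its boundary is
    \<open>y + y\<close>.\<close>
  define e where "e = a + a - chain_boundary (Suc (Suc p)) u"
  have e2: "e = chain_boundary (Suc (Suc p)) v - (b + b)"
    using d unfolding e_def chain_boundary_add by (simp add: algebra_simps)
  have "singular_chain (Suc p) (subtopology X A) e"
    unfolding e_def using a singular_chain_boundary_alt [OF u]
    by (intro singular_chain_diff singular_chain_add) auto
  moreover have "singular_chain (Suc p) (subtopology X B) e"
    unfolding e2 using b singular_chain_boundary_alt [OF v]
    by (intro singular_chain_diff singular_chain_add) auto
  ultimately have e: "singular_chain (Suc p) (subtopology X (A \<inter> B)) e"
    by (rule singular_chain_Int)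
  define y where "y = chain_boundary (Suc p) a"
  have yb: "chain_boundary (Suc p) b = - y"
    using cyc unfolding singular_cycle y_def chain_boundary_add by (simp add: add_eq_0_iff2)
  have yA: "singular_chain p (subtopology X A) y"
    using singular_chain_boundary_alt [OF a] by (simp add: y_def)
  have "singular_chain p (subtopology X B) (- y)"
    using singular_chain_boundary_alt [OF b] by (simp add: yb)
  then have yAB: "singular_chain p (subtopology X (A \<inter> B)) y"
    using yA by (intro singular_chain_Int) (simp_all add: singular_chain_minus)
  have "chain_boundary p y = 0"
    unfolding y_def using chain_boundary_boundary_alt [OF a] by simp
  then have y: "singular_relcycle p (subtopology X (A \<inter> B)) {} y"
    using yAB by (simp add: singular_cycle)
  have "chain_boundary (Suc p) e = y + y"
    using chain_boundary_boundary_alt [OF u]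
    by (simp add: e_def chain_boundary_diff chain_boundary_add y_def)
  then have "singular_relboundary p (subtopology X (A \<inter> B)) {} (y + y)"
    unfolding singular_boundary using e by blast
  then obtain f where f: "singular_chain (Suc p) (subtopology X (A \<inter> B)) f"
    and df: "chain_boundary (Suc p) f = y"
    using AB y unfolding no_2_torsion_in_def singular_boundary by blast
  have fA: "singular_chain (Suc p) (subtopology X A) f" and fB: "singular_chain (Suc p) (subtopology X B) f"
    using f by (auto simp: singular_chain_subtopology)
  have "singular_relcycle (Suc p) (subtopology X A) {} (a - f)"
    unfolding singular_cycle using a fA
    by (auto intro: singular_chain_diff simp: chain_boundary_diff df simp flip: y_def)
  then have 1: "singular_relboundary (Suc p) X {} (a - f)"
    using acA boundary_subtopology_imp unfolding acyclic_in_def by blast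
  have "singular_relcycle (Suc p) (subtopology X B) {} (b + f)"
    unfolding singular_cycle using b fB
    by (auto intro: singular_chain_add simp: chain_boundary_add df yb)
  then have 2: "singular_relboundary (Suc p) X {} (b + f)"
    using acB boundary_subtopology_imp unfolding acyclic_in_def by blast
  have "singular_relboundary (Suc p) X {} (a + b)"
    using singular_relboundary_add [OF 1 2] by (simp add: algebra_simps)
  then show "singular_relboundary (Suc p) X {} c"
    using hom relboundary_iff_homologous by blast
qed

text \<open>A chain supported in both sets is zero, so the relation for \<open>u + v\<close> and the
  cycle condition separate into one statement for each set. This starts the inductions by
  Mayer--Vietoris.\<close>

lemma no_2_torsion_in_disjoint_union:
  assumes op: "openin X A" "openin X B" and cov: "topspace X \<subseteq> A \<union> B" and dis: "A \<inter> B = {}"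
    and A: "no_2_torsion_in p (subtopology X A)" and B: "no_2_torsion_in p (subtopology X B)"
  shows "no_2_torsion_in p X"
  unfolding no_2_torsion_in_def
proof (intro allI impI)
  fix c assume c: "singular_relcycle p X {} c" and cc: "singular_relboundary p X {} (c + c)"
  obtain a b u v where a: "singular_chain p (subtopology X A) a"
    and b: "singular_chain p (subtopology X B) b"
    and u: "singular_chain (Suc p) (subtopology X A) u"
    and v: "singular_chain (Suc p) (subtopology X B) v"
    and cyc: "singular_relcycle p X {} (a + b)" and hom: "homologous_rel p X {} c (a + b)"
    and d: "chain_boundary (Suc p) (u + v) = (a + b) + (a + b)"
    using Mayer_Vietoris_double_boundary [OF op cov c cc] by metis
  have zero: "z = 0" if "singular_chain q (subtopology X A) z" "singular_chain q (subtopology X B) z" for q z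
    using singular_chain_Int [OF that] by (simp add: dis singular_chain_empty)
  have "a + a - chain_boundary (Suc p) u = chain_boundary (Suc p) v - (b + b)"
    using d unfolding chain_boundary_add by (simp add: algebra_simps)
  moreover have "singular_chain p (subtopology X A) (a + a - chain_boundary (Suc p) u)"
    using a singular_chain_boundary_alt [OF u] by (intro singular_chain_diff singular_chain_add) auto
  moreover have "singular_chain p (subtopology X B) (chain_boundary (Suc p) v - (b + b))"
    using b singular_chain_boundary_alt [OF v] by (intro singular_chain_diff singular_chain_add) auto
  ultimately have "a + a - chain_boundary (Suc p) u = 0" "chain_boundary (Suc p) v - (b + b) = 0"
    using zero by metis+
  then have 1: "singular_relboundary p (subtopology X A) {} (a + a)"
    and 2: "singular_relboundary p (subtopology X B) {} (b + b)"
    unfolding singular_boundary using u v by (metis eq_iff_diff_eq_0)+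
  have ya: "chain_boundary p a + chain_boundary p b = 0"
    using cyc unfolding singular_cycle chain_boundary_add by simp
  have "singular_chain (p - Suc 0) (subtopology X A) (chain_boundary p a)"
    "singular_chain (p - Suc 0) (subtopology X B) (chain_boundary p b)"
    using singular_chain_boundary [OF a] singular_chain_boundary [OF b] by auto
  moreover have "chain_boundary p a = - chain_boundary p b"
    using ya by (simp add: add_eq_0_iff2)
  ultimately have "chain_boundary p a = 0" "chain_boundary p b = 0"
    using zero by (metis singular_chain_minus neg_equal_0_iff_equal)+
  then have "singular_relcycle p (subtopology X A) {} a" "singular_relcycle p (subtopology X B) {} b"
    using a b by (simp_all add: singular_cycle)
  then have "singular_relboundary p X {} a" "singular_relboundary p X {} b"
    using A B 1 2 boundary_subtopology_imp unfolding no_2_torsion_in_def by blast+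
  then have "singular_relboundary p X {} (a + b)"
    by (rule singular_relboundary_add)
  then show "singular_relboundary p X {} c"
    using hom relboundary_iff_homologous by blast
qed

section \<open>The group SU(3)\<close>

abbreviation cnj_matrix :: "complex^'n^'m \<Rightarrow> complex^'n^'m" where
  "cnj_matrix \<equiv> map_matrix cnj"

lemma cnj_matrix_nth [simp]: "cnj_matrix A $ i $ j = cnj (A $ i $ j)"
  by (simp add: map_matrix_def)

lemma conj_transpose_nth [simp]: "conj_transpose A $ i $ j = cnj (A $ j $ i)"
  by (simp add: conj_transpose_def transpose_def)

lemma matrix_mult_nth: "(A ** B) $ i $ j = (\<Sum>k\<in>UNIV. A $ i $ k * B $ k $ j)"
  by (simp add: matrix_matrix_mult_def)

lemma mat_1_nth: "(mat 1 :: complex^'n^'n) $ i $ j = (if i = j then 1 else 0)"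
  by (simp add: mat_def)

lemma conj_transpose_mult: "conj_transpose (A ** B) = conj_transpose B ** conj_transpose A"
  by (simp add: vec_eq_iff matrix_mult_nth mult.commute)

lemma cnj_matrix_mult: "cnj_matrix (A ** B) = cnj_matrix A ** cnj_matrix B"
  by (simp add: vec_eq_iff matrix_mult_nth)

lemma conj_transpose_conj_transpose [simp]: "conj_transpose (conj_transpose A) = A"
  by (simp add: vec_eq_iff)

lemma cnj_matrix_cnj_matrix [simp]: "cnj_matrix (cnj_matrix A) = A"
  by (simp add: vec_eq_iff)

lemma conj_transpose_mat_1 [simp]: "conj_transpose (mat 1) = mat 1"
  by (simp add: vec_eq_iff mat_1_nth)

lemma cnj_matrix_mat_1 [simp]: "cnj_matrix (mat 1) = mat 1"
  by (simp add: vec_eq_iff mat_1_nth)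

lemma conj_transpose_cnj_matrix: "conj_transpose (cnj_matrix A) = transpose A"
  by (simp add: vec_eq_iff transpose_def)

lemma det_cnj_matrix: "det (cnj_matrix A) = cnj (det (A::complex^3^3))"
  by (simp add: det_3)

lemma det_conj_transpose: "det (conj_transpose A) = cnj (det (A::complex^3^3))"
  by (simp add: conj_transpose_def det_cnj_matrix)

lemma SU3_iff: "A \<in> SU3 \<longleftrightarrow> A ** conj_transpose A = mat 1 \<and> det A = 1"
  unfolding SU3_def using matrix_left_right_inverse by blast

lemma SU3_D:
  assumes "A \<in> SU3"
  shows "A ** conj_transpose A = mat 1" "conj_transpose A ** A = mat 1" "det A = 1"
  using assms by (auto simp: SU3_def)

lemma SU3_mat_1 [simp]: "mat 1 \<in> SU3"
  by (simp add: SU3_def)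

lemma unitary_mult:
  assumes "A ** conj_transpose A = mat 1" "B ** conj_transpose B = mat 1"
  shows "(A ** B) ** conj_transpose (A ** B) = (mat 1 :: complex^'n^'n)"
  using assms by (metis conj_transpose_mult matrix_mul_assoc matrix_mul_rid)

lemma SU3_mult [intro]: "A \<in> SU3 \<Longrightarrow> B \<in> SU3 \<Longrightarrow> A ** B \<in> SU3"
  by (simp add: SU3_iff unitary_mult det_mul)

lemma SU3_conj_transpose [intro]: "A \<in> SU3 \<Longrightarrow> conj_transpose A \<in> SU3"
  by (simp add: SU3_def det_conj_transpose)

lemma SU3_cnj_matrix [intro]: "A \<in> SU3 \<Longrightarrow> cnj_matrix A \<in> SU3"
  by (metis (no_types, lifting) SU3_iff cnj_matrix_mult cnj_matrix_mat_1 complex_cnj_one det_cnj_matrix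
      cnj_matrix_cnj_matrix conj_transpose_cnj_matrix conj_transpose_def)

lemma SU3_transpose [intro]: "A \<in> SU3 \<Longrightarrow> transpose A \<in> SU3"
  using SU3_cnj_matrix SU3_conj_transpose conj_transpose_cnj_matrix by metis

lemma SU3_cancel:
  assumes "A \<in> SU3"
  shows "conj_transpose A ** (A ** B) = B" "A ** (conj_transpose A ** B) = B"
    "(B ** A) ** conj_transpose A = B" "(B ** conj_transpose A) ** A = B"
  using SU3_D [OF assms] by (metis matrix_mul_assoc matrix_mul_lid matrix_mul_rid)+

lemmas expand3 = vec_eq_iff forall_3 matrix_mult_nth sum_3 mat_1_nth

text \<open>The inverse of a matrix of determinant 1 is its adjugate, and the inverse of a unitary
  matrix is its conjugate transpose. Complex conjugates of entries thereby become polynomials in the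
  entries with real coefficients.\<close>

lemma SU3_cofactors:
  assumes "B \<in> SU3"
  shows "cnj (B$1$1) = B$2$2 * B$3$3 - B$2$3 * B$3$2"
    "cnj (B$1$2) = B$2$3 * B$3$1 - B$2$1 * B$3$3"
    "cnj (B$1$3) = B$2$1 * B$3$2 - B$2$2 * B$3$1"
    "cnj (B$2$1) = B$1$3 * B$3$2 - B$1$2 * B$3$3"
    "cnj (B$2$2) = B$1$1 * B$3$3 - B$1$3 * B$3$1"
    "cnj (B$2$3) = B$1$2 * B$3$1 - B$1$1 * B$3$2"
    "cnj (B$3$1) = B$1$2 * B$2$3 - B$1$3 * B$2$2"
    "cnj (B$3$2) = B$1$3 * B$2$1 - B$1$1 * B$2$3"
    "cnj (B$3$3) = B$1$1 * B$2$2 - B$1$2 * B$2$1"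
proof -
  \<comment> \<open>The adjugate of \<open>B\<close>, with the sign of each cofactor absorbed in the
    order of its terms.\<close>
  define C :: "complex^3^3" where "C = (\<chi> j i. if j = 1 then (if i = 1 then B$2$2 * B$3$3 - B$2$3 * B$3$2 else if i = 2 then B$1$3 * B$3$2 - B$1$2 * B$3$3 else B$1$2 * B$2$3 - B$1$3 * B$2$2)
    else if j = 2 then (if i = 1 then B$2$3 * B$3$1 - B$2$1 * B$3$3 else if i = 2 then B$1$1 * B$3$3 - B$1$3 * B$3$1 else B$1$3 * B$2$1 - B$1$1 * B$2$3)
    else (if i = 1 then B$2$1 * B$3$2 - B$2$2 * B$3$1 else if i = 2 then B$1$2 * B$3$1 - B$1$1 * B$3$2 else B$1$1 * B$2$2 - B$1$2 * B$2$1))"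
  have C: "C$1$1 = B$2$2 * B$3$3 - B$2$3 * B$3$2"
    "C$2$1 = B$2$3 * B$3$1 - B$2$1 * B$3$3"
    "C$3$1 = B$2$1 * B$3$2 - B$2$2 * B$3$1"
    "C$1$2 = B$1$3 * B$3$2 - B$1$2 * B$3$3"
    "C$2$2 = B$1$1 * B$3$3 - B$1$3 * B$3$1"
    "C$3$2 = B$1$2 * B$3$1 - B$1$1 * B$3$2"
    "C$1$3 = B$1$2 * B$2$3 - B$1$3 * B$2$2"
    "C$2$3 = B$1$3 * B$2$1 - B$1$1 * B$2$3"
    "C$3$3 = B$1$1 * B$2$2 - B$1$2 * B$2$1"
    by (simp_all add: C_def)
  have d: "det B = 1" using assms by (simp add: SU3_D)
  have "C ** B = mat 1"
    unfolding expand3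
    by (intro conjI; simp add: C algebra_simps; (use d in \<open>simp add: det_3 algebra_simps\<close>)?)
  then have "C = conj_transpose B"
    using SU3_cancel(3) [OF assms, of C] by simp
  then have *: "cnj (B $ i $ j) = C $ j $ i" for i j
    by simp
  show "cnj (B$1$1) = B$2$2 * B$3$3 - B$2$3 * B$3$2"
    "cnj (B$1$2) = B$2$3 * B$3$1 - B$2$1 * B$3$3"
    "cnj (B$1$3) = B$2$1 * B$3$2 - B$2$2 * B$3$1"
    "cnj (B$2$1) = B$1$3 * B$3$2 - B$1$2 * B$3$3"
    "cnj (B$2$2) = B$1$1 * B$3$3 - B$1$3 * B$3$1"
    "cnj (B$2$3) = B$1$2 * B$3$1 - B$1$1 * B$3$2"
    "cnj (B$3$1) = B$1$2 * B$2$3 - B$1$3 * B$2$2"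
    "cnj (B$3$2) = B$1$3 * B$2$1 - B$1$1 * B$2$3"
    "cnj (B$3$3) = B$1$1 * B$2$2 - B$1$2 * B$2$1"
    unfolding * C by (rule refl)+
qed

section \<open>Hermitian products and complex reflections\<close>

definition herm :: "complex^'n \<Rightarrow> complex^'n \<Rightarrow> complex" where
  "herm a b = (\<Sum>i\<in>UNIV. cnj (a $ i) * b $ i)"

lemma herm_add_left: "herm (a + b) c = herm a c + herm b c"
  by (simp add: herm_def sum.distrib algebra_simps)

lemma herm_add_right: "herm a (b + c) = herm a b + herm a c"
  by (simp add: herm_def sum.distrib algebra_simps)

lemma herm_minus_right: "herm a (- b) = - herm a b"
  by (simp add: herm_def sum_negf)

lemma cnj_herm: "cnj (herm a b) = herm b a"
  by (simp add: herm_def mult.commute)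

lemma herm_self: "herm a a = of_real ((norm a)\<^sup>2)"
proof -
  have "cnj z * z = of_real ((norm z)\<^sup>2)" for z
    by (metis complex_norm_square mult.commute of_real_power)
  then show ?thesis
    by (simp add: herm_def norm_vec_def L2_set_def sum_nonneg)
qed

lemma herm_self_eq_1: "herm a a = 1 \<longleftrightarrow> norm a = 1"
proof -
  have "herm a a = 1 \<longleftrightarrow> (norm a)\<^sup>2 = 1"
    unfolding herm_self by (metis of_real_1 of_real_eq_iff)
  then show ?thesis
    by (metis norm_ge_zero one_power2 power2_eq_imp_eq zero_le_one)
qed

lemma herm_column: "herm (column i A) (column j A) = (conj_transpose A ** A) $ i $ j"
  by (simp add: herm_def column_def matrix_mult_nth)

lemma SU3_norm_column: "A \<in> SU3 \<Longrightarrow> norm (column i A) = 1"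
  by (simp add: herm_column SU3_D mat_1_nth flip: herm_self_eq_1)

text \<open>The identity minus \<open>k\<close> times the rank one matrix of \<open>y\<close>: it
  fixes the orthogonal complement of \<open>y\<close> and multiplies \<open>y\<close> by
  \<open>1 - k * herm y y\<close>.\<close>

definition creflection :: "complex \<Rightarrow> complex^'n \<Rightarrow> complex^'n^'n" where
  "creflection k y = (\<chi> i j. (if i = j then 1 else 0) - k * y $ i * cnj (y $ j))"

lemma conj_transpose_creflection: "conj_transpose (creflection k y) = creflection (cnj k) y"
  by (simp add: vec_eq_iff creflection_def mult_ac)

lemma creflection_mult: "creflection k y ** creflection l y = creflection (k + l - k * l * herm y y) (y::complex^3)"
  unfolding expand3 creflection_def herm_def vec_lambda_beta
  by (simp add: algebra_simps)

lemma creflection_0 [simp]: "creflection 0 y = mat 1"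
  by (simp add: creflection_def mat_def)

lemma creflection_vector: "creflection k y *v x = x - (k * herm y x) *s (y::complex^3)"
  unfolding vec_eq_iff forall_3 matrix_vector_mult_def sum_3 creflection_def herm_def vec_lambda_beta
  by (simp add: algebra_simps)

text \<open>The hypothesis says that the factor \<open>1 - k * herm y y\<close> on \<open>y\<close>
  has modulus 1 (for nonzero \<open>y\<close>); it makes the coefficient in
  \<open>creflection_mult\<close> vanish.\<close>

lemma unitary_creflection:
  fixes y :: "complex^3"
  assumes "k + cnj k = k * cnj k * herm y y"
  shows "creflection k y ** conj_transpose (creflection k y) = mat 1"
  using assms by (simp add: conj_transpose_creflection creflection_mult)

text \<open>The first reflection maps \<open>a\<close> to \<open>- b\<close>, the second one \<open>- b\<close> to \<open>b\<close>. Unlike a single reflection their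
  product depends continuously on \<open>a\<close> and \<open>b\<close> at \<open>a = b\<close>; only \<open>a = - b\<close> is excluded.\<close>

definition carry :: "complex^3 \<Rightarrow> complex^3 \<Rightarrow> complex^3^3" where
  "carry a b = creflection 2 b ** creflection (1 / (1 + herm b a)) (a + b)"

text \<open>The squared norm of \<open>a + b\<close> expands to 0. Consequently the denominator in
  \<open>carry\<close> vanishes only at antipodal vectors.\<close>

lemma herm_eq_minus_1:
  assumes "norm a = 1" "norm b = 1" "1 + herm b a = 0"
  shows "b = - (a :: complex^3)"
proof -
  have ba: "herm b a = -1" using assms by (simp add: add_eq_0_iff)
  then have ab: "herm a b = -1" using cnj_herm [of b a] by simp
  have "herm (a + b) (a + b) = 0"
    using assms(1,2) ab ba by (simp add: herm_add_left herm_add_right flip: herm_self_eq_1)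
  then have "norm (a + b) = 0"
    unfolding herm_self by simp
  then show ?thesis by (simp add: add_eq_0_iff)
qed

text \<open>With \<open>d = 1 + herm b a\<close> the squared norm of \<open>a + b\<close> is
  \<open>d + cnj d\<close>, which is exactly what unitarity demands of the coefficient
  \<open>1 / d\<close>.\<close>

lemma unitary_carry:
  assumes "norm a = 1" "norm b = 1" "b \<noteq> - a"
  shows "carry a b ** conj_transpose (carry a b) = mat 1"
proof -
  define d where "d = 1 + herm b a"
  have "d \<noteq> 0" using herm_eq_minus_1 assms d_def by metis
  have cd: "cnj d = 1 + herm a b" by (simp add: d_def cnj_herm)
  have aa: "herm a a = 1" and bb: "herm b b = 1" using assms by (simp_all add: herm_self_eq_1)
  show ?thesis
    unfolding carry_def
  proof (rule unitary_mult; rule unitary_creflection)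
    show "2 + cnj 2 = 2 * cnj 2 * herm b b" using bb by simp
    have "herm (a + b) (a + b) = d + cnj d"
      unfolding cd by (simp add: herm_add_left herm_add_right aa bb d_def)
    then show "1 / (1 + herm b a) + cnj (1 / (1 + herm b a)) =
       1 / (1 + herm b a) * cnj (1 / (1 + herm b a)) * herm (a + b) (a + b)"
      using \<open>d \<noteq> 0\<close> unfolding d_def [symmetric] by (simp add: field_simps)
  qed
qed

lemma carry_vector:
  assumes "norm a = 1" "norm b = 1" "b \<noteq> - a"
  shows "carry a b *v a = b"
proof -
  have "1 + herm b a \<noteq> 0" using herm_eq_minus_1 assms by metis
  moreover have "herm a a = 1" and bb: "herm b b = 1" using assms by (simp_all add: herm_self_eq_1)
  ultimately have "creflection (1 / (1 + herm b a)) (a + b) *v a = - b"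
    by (simp add: creflection_vector herm_add_left)
  then have "carry a b *v a = creflection 2 b *v (- b)"
    by (simp add: carry_def flip: matrix_vector_mul_assoc)
  also have "\<dots> = b"
    by (simp add: creflection_vector herm_minus_right bb vec_eq_iff)
  finally show ?thesis .
qed

text \<open>At \<open>a = b\<close> both factors are the ordinary reflection in \<open>a\<close>,
  whose square is the identity.\<close>

lemma carry_self:
  assumes "norm a = 1"
  shows "carry a a = mat 1"
proof -
  have aa: "herm a a = 1" using assms by (simp add: herm_self_eq_1)
  have "creflection (1/2) (a + a) = creflection 2 a"
    by (simp add: creflection_def vec_eq_iff)
  then show ?thesis
    unfolding carry_def aa by (simp add: creflection_mult aa)
qed

definition scale2 :: "complex \<Rightarrow> complex^3^3" where
  "scale2 z = (\<chi> i j. if i = j then if i = 2 then z else 1 else 0)"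

lemma det_scale2: "det (scale2 z) = z"
  by (simp add: scale2_def det_3)

lemma unitary_scale2: "norm z = 1 \<Longrightarrow> scale2 z ** conj_transpose (scale2 z) = mat 1"
  unfolding expand3 scale2_def conj_transpose_nth vec_lambda_beta
  by (simp flip: complex_norm_square)

lemma unitary_norm_det:
  fixes A :: "complex^3^3"
  assumes "A ** conj_transpose A = mat 1"
  shows "norm (det A) = 1"
proof -
  have "det A * cnj (det A) = 1"
    using arg_cong [OF assms, of det] by (simp add: det_mul det_conj_transpose)
  then have "(norm (det A))\<^sup>2 = 1"
    by (metis complex_norm_square of_real_1 of_real_eq_iff of_real_power)
  then show ?thesis
    by (metis norm_ge_zero one_power2 power2_eq_imp_eq zero_le_one)
qed

text \<open>Rescaling the second column restores determinant 1, so \<open>c\<close> is meant to be \<open>1\<close> or \<open>3\<close>.\<close>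

definition transport :: "3 \<Rightarrow> complex^3^3 \<Rightarrow> complex^3 \<Rightarrow> complex^3^3" where
  "transport c B b = carry (column c B) b ** B ** scale2 (1 / det (carry (column c B) b))"

lemma column_mult: "column j (A ** B) = A *v column j B"
  by (simp add: vec_eq_iff column_def matrix_vector_mult_def matrix_matrix_mult_def)

lemma column_mult_scale2: "c \<noteq> 2 \<Longrightarrow> column c (A ** scale2 z) = column c A"
  by (simp add: vec_eq_iff column_def matrix_mult_nth scale2_def if_distrib [where f = "\<lambda>x. _ * x"] cong: if_cong)

lemma transport_SU3:
  assumes "B \<in> SU3" "norm b = 1" "b \<noteq> - column c B"
  shows "transport c B b \<in> SU3"
proof -
  let ?U = "carry (column c B) b"
  have U: "?U ** conj_transpose ?U = mat 1"
    by (rule unitary_carry [OF SU3_norm_column [OF assms(1)] assms(2,3)])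
  have n: "norm (det ?U) = 1" by (rule unitary_norm_det [OF U])
  then have "norm (1 / det ?U) = 1" by (simp add: norm_divide)
  then have "transport c B b ** conj_transpose (transport c B b) = mat 1"
    unfolding transport_def by (intro unitary_mult U SU3_D(1) assms unitary_scale2)
  moreover have "det (transport c B b) = 1"
    using n SU3_D(3) [OF assms(1)] by (auto simp: transport_def det_mul det_scale2)
  ultimately show ?thesis by (simp add: SU3_iff)
qed

lemma column_transport:
  assumes "B \<in> SU3" "norm b = 1" "b \<noteq> - column c B" "c \<noteq> 2"
  shows "column c (transport c B b) = b"
  using carry_vector [OF SU3_norm_column [OF assms(1)] assms(2,3)]
  unfolding transport_def by (subst column_mult_scale2 [OF assms(4)], subst column_mult)

lemma scale2_1 [simp]: "scale2 1 = mat 1"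
  by (simp add: scale2_def mat_def vec_eq_iff)

lemma transport_self: "B \<in> SU3 \<Longrightarrow> transport c B (column c B) = B"
  by (simp add: transport_def carry_self SU3_norm_column)

section \<open>Continuity of the matrix constructions\<close>

lemma continuous_on_matrix_mult [continuous_intros]:
  fixes f :: "'a::topological_space \<Rightarrow> complex^'n^'m"
  assumes "continuous_on S f" "continuous_on S g"
  shows "continuous_on S (\<lambda>x. f x ** g x)"
  unfolding matrix_matrix_mult_def by (intro continuous_intros assms)

lemma continuous_on_cnj_matrix [continuous_intros]:
  assumes "continuous_on S f"
  shows "continuous_on S (\<lambda>x. cnj_matrix (f x))"
  unfolding map_matrix_def by (intro continuous_intros assms)

lemma continuous_on_matrix_transpose [continuous_intros]:
  fixes f :: "'a::topological_space \<Rightarrow> complex^'n^'m"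
  assumes "continuous_on S f"
  shows "continuous_on S (\<lambda>x. transpose (f x))"
  unfolding transpose_def by (intro continuous_intros assms)

lemma continuous_on_conj_transpose [continuous_intros]:
  assumes "continuous_on S f"
  shows "continuous_on S (\<lambda>x. conj_transpose (f x))"
  unfolding conj_transpose_def by (intro continuous_intros assms)

lemma continuous_on_matrix_column [continuous_intros]:
  fixes f :: "'a::topological_space \<Rightarrow> complex^'n^'m"
  assumes "continuous_on S f"
  shows "continuous_on S (\<lambda>x. column c (f x))"
  unfolding column_def by (intro continuous_intros assms)

lemma continuous_on_det3 [continuous_intros]:
  fixes f :: "'a::topological_space \<Rightarrow> complex^3^3"
  assumes "continuous_on S f"
  shows "continuous_on S (\<lambda>x. det (f x))"
  unfolding det_3 by (intro continuous_intros assms)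

lemma continuous_on_herm [continuous_intros]:
  assumes "continuous_on S f" "continuous_on S g"
  shows "continuous_on S (\<lambda>x. herm (f x) (g x))"
  unfolding herm_def by (intro continuous_intros assms)

lemma continuous_on_creflection [continuous_intros]:
  assumes "continuous_on S f" "continuous_on S g"
  shows "continuous_on S (\<lambda>x. creflection (f x) (g x))"
  unfolding creflection_def by (intro continuous_intros assms)

lemma continuous_on_scale2 [continuous_intros]:
  assumes "continuous_on S f"
  shows "continuous_on S (\<lambda>x. scale2 (f x))"
proof -
  have "scale2 z = (\<chi> i j. of_bool (i = j \<and> i \<noteq> 2) + of_bool (i = j \<and> i = 2) * z)" for z
    by (simp add: scale2_def vec_eq_iff)
  then show ?thesis
    by (simp only:) (intro continuous_intros assms)
qed

lemma continuous_on_transport: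
  assumes "continuous_on S f" "continuous_on S g"
    and "\<And>x. x \<in> S \<Longrightarrow> f x \<in> SU3" "\<And>x. x \<in> S \<Longrightarrow> norm (g x) = 1" "\<And>x. x \<in> S \<Longrightarrow> g x \<noteq> - column c (f x)"
  shows "continuous_on S (\<lambda>x. transport c (f x) (g x))"
  unfolding transport_def
proof (intro continuous_intros assms)
  have "continuous_on S (\<lambda>x. carry (column c (f x)) (g x))"
    unfolding carry_def
    by (intro continuous_intros assms) (use assms herm_eq_minus_1 SU3_norm_column in metis)
  then show "continuous_on S (\<lambda>x. carry (column c (f x)) (g x))" .
  show "continuous_on S (\<lambda>x. carry (column c (f x)) (g x))" by fact
  show "\<forall>x\<in>S. det (carry (column c (f x)) (g x)) \<noteq> 0"
    using unitary_norm_det [OF unitary_carry] SU3_norm_column assms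
    by (metis norm_zero zero_neq_one)
qed

section \<open>The eighth homology group of SU(3) has no 2-torsion\<close>

text \<open>The index tests in a matrix given by cases do not depend on the point, so the branches
  can be treated separately.\<close>

lemma continuous_on_if_const:
  assumes "P \<Longrightarrow> continuous_on S f" "\<not> P \<Longrightarrow> continuous_on S g"
  shows "continuous_on S (\<lambda>x. if P then f x else g x)"
  using assms by (cases P) simp_all

lemma homotopic_with_top_of_setI:
  assumes "continuous_on ({0..1} \<times> S) h" "\<And>t x. t \<in> {0..1::real} \<Longrightarrow> x \<in> S \<Longrightarrow> h (t, x) \<in> T"
    "\<And>x. x \<in> S \<Longrightarrow> h (0, x) = f x" "\<And>x. x \<in> S \<Longrightarrow> h (1, x) = g x"
  shows "homotopic_with (\<lambda>h. True) (top_of_set S) (top_of_set T) f g"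
  using assms by (subst homotopic_with) (auto intro!: exI [of _ h])

text \<open>The straight segment from \<open>v\<close> to \<open>w\<close>, projected radially to
  the unit sphere. Towards an antipodal \<open>w\<close> it makes sense only up to time
  \<open>1/2\<close>, and this is how the hypotheses on \<open>t\<close> below are phrased.\<close>

definition segment_point :: "real \<Rightarrow> complex^3 \<Rightarrow> complex^3 \<Rightarrow> complex^3" where
  "segment_point t v w = sgn ((1 - t) *\<^sub>R v + t *\<^sub>R w)"

text \<open>If the combination vanishes, comparing norms gives \<open>t = 1/2\<close>, and then
  \<open>v = - w\<close>.\<close>

lemma segment_point_nonzero:
  assumes "norm v = 1" "norm w = 1" "v = - w \<Longrightarrow> t < 1/2" "0 \<le> t" "t \<le> 1"
  shows "(1 - t) *\<^sub>R v + t *\<^sub>R w \<noteq> (0 :: 'a::real_normed_vector)"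
proof
  assume 0: "(1 - t) *\<^sub>R v + t *\<^sub>R w = 0"
  then have eq: "(1 - t) *\<^sub>R v = - (t *\<^sub>R w)"
    by (simp add: add_eq_0_iff2)
  then have "norm ((1 - t) *\<^sub>R v) = norm (t *\<^sub>R w)" by simp
  then have t: "t = 1/2" using assms by simp
  have "(1/2) *\<^sub>R v = (1/2) *\<^sub>R (- w)"
    using eq unfolding t by simp
  then have "v = - w"
    by (simp only: scaleR_cancel_left) simp
  with assms(3) t show False by simp
qed

lemma norm_segment_point:
  assumes "norm v = 1" "norm w = 1" "v = - w \<Longrightarrow> t < 1/2" "0 \<le> t" "t \<le> 1"
  shows "norm (segment_point t v w) = 1"
  using segment_point_nonzero [OF assms] by (simp add: segment_point_def norm_sgn)

text \<open>Reaching \<open>- v\<close> would make \<open>w\<close> a negative multiple of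
  \<open>v\<close>, so \<open>w = - v\<close>, and comparison of norms puts \<open>t\<close> beyond
  \<open>1/2\<close>. Thus \<open>transport\<close> to a point of the segment is always
  defined.\<close>

lemma segment_point_neq_uminus:
  assumes "norm v = 1" "norm w = 1" "v = - w \<Longrightarrow> t < 1/2" "0 \<le> t" "t \<le> 1"
  shows "segment_point t v w \<noteq> - v"
proof
  let ?u = "(1 - t) *\<^sub>R v + t *\<^sub>R w"
  define n where "n = norm ?u"
  have n: "n > 0" using segment_point_nonzero [OF assms] by (simp add: n_def)
  assume "segment_point t v w = - v"
  then have "n *\<^sub>R segment_point t v w = - (n *\<^sub>R v)" by simp
  then have "?u = - (n *\<^sub>R v)"
    using n by (simp add: segment_point_def sgn_div_norm n_def [symmetric])
  then have eq: "t *\<^sub>R w = - ((n + (1 - t)) *\<^sub>R v)"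
    by (simp add: algebra_simps)
  then have "norm (t *\<^sub>R w) = norm ((n + (1 - t)) *\<^sub>R v)" by simp
  then have "t = n + (1 - t)" using assms n by simp
  moreover have t: "t > 1/2" using calculation n assms by linarith
  ultimately have "w = - v" using eq by (metis less_irrefl order_less_trans scaleR_cancel_left scaleR_minus_right half_gt_zero zero_less_one)
  then show False using assms(3) t by simp
qed

lemma segment_point_0: "norm v = 1 \<Longrightarrow> segment_point 0 v w = v"
  by (simp add: segment_point_def sgn_div_norm)

lemma segment_point_1: "norm w = 1 \<Longrightarrow> segment_point 1 v w = w"
  by (simp add: segment_point_def sgn_div_norm)

lemma continuous_on_segment_point:
  assumes "continuous_on S f" "continuous_on S g" "continuous_on S h"
    "\<And>x. x \<in> S \<Longrightarrow> norm (g x) = 1" "\<And>x. x \<in> S \<Longrightarrow> norm (h x) = 1"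
    "\<And>x. x \<in> S \<Longrightarrow> g x = - h x \<Longrightarrow> f x < 1/2" "\<And>x. x \<in> S \<Longrightarrow> 0 \<le> f x" "\<And>x. x \<in> S \<Longrightarrow> f x \<le> 1"
  shows "continuous_on S (\<lambda>x. segment_point (f x) (g x) (h x))"
  unfolding segment_point_def
  by (intro continuous_intros assms ballI segment_point_nonzero; assumption)

lemma continuous_on_transport_segment:
  assumes "continuous_on S f" "continuous_on S B" "continuous_on S h"
    "\<And>x. x \<in> S \<Longrightarrow> B x \<in> SU3" "\<And>x. x \<in> S \<Longrightarrow> norm (h x) = 1"
    "\<And>x. x \<in> S \<Longrightarrow> column c (B x) = - h x \<Longrightarrow> f x < 1/2" "\<And>x. x \<in> S \<Longrightarrow> 0 \<le> f x" "\<And>x. x \<in> S \<Longrightarrow> f x \<le> 1"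
  shows "continuous_on S (\<lambda>x. transport c (B x) (segment_point (f x) (column c (B x)) (h x)))"
  by (intro continuous_on_transport continuous_on_segment_point continuous_intros
      norm_segment_point segment_point_neq_uminus assms SU3_norm_column; assumption)

lemma transport_segment_SU3:
  assumes "B \<in> SU3" "norm w = 1" "column c B = - w \<Longrightarrow> t < 1/2" "0 \<le> t" "t \<le> 1"
  shows "transport c B (segment_point t (column c B) w) \<in> SU3"
  by (intro transport_SU3 norm_segment_point segment_point_neq_uminus assms SU3_norm_column; assumption)

lemma column_transport_segment:
  assumes "B \<in> SU3" "norm w = 1" "column c B = - w \<Longrightarrow> t < 1/2" "0 \<le> t" "t \<le> 1" "c \<noteq> 2"
  shows "column c (transport c B (segment_point t (column c B) w)) = segment_point t (column c B) w"
  by (intro column_transport norm_segment_point segment_point_neq_uminus assms SU3_norm_column; assumption)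

section \<open>Fibres over the five-sphere are three-spheres\<close>

lemma nsphere_eq_top_of_set: "nsphere n = top_of_set {x. (\<Sum>i\<le>n. (x i)\<^sup>2) = 1 \<and> (\<forall>i>n. x i = 0)}"
  by (simp add: nsphere euclidean_product_topology)

text \<open>The identification of the three-sphere with \<open>SU(2)\<close>: the first column
  consists of two complex numbers \<open>z\<close>, \<open>w\<close> with squared moduli adding up
  to 1, the second one of \<open>- cnj w\<close>, \<open>cnj z\<close>. The argument is a sequence
  because points of \<open>nsphere\<close> are sequences.\<close>

definition SU2_embed :: "(nat \<Rightarrow> real) \<Rightarrow> complex^3^3" where
  "SU2_embed x = (\<chi> i j. if i = 3 \<or> j = 3 then (if i = j then 1 else 0)
     else if j = 1 then (if i = 1 then Complex (x 0) (x 1) else Complex (x 2) (x 3))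
     else (if i = 1 then - cnj (Complex (x 2) (x 3)) else cnj (Complex (x 0) (x 1))))"

lemma SU2_embed_SU3:
  assumes "(\<Sum>i\<le>3. (x i)\<^sup>2) = 1"
  shows "SU2_embed x \<in> SU3"
proof -
  have "(x 0)\<^sup>2 + (x 1)\<^sup>2 + (x 2)\<^sup>2 + (x 3)\<^sup>2 = 1"
    using assms by (simp add: eval_nat_numeral algebra_simps)
  then have "Complex (x 0) (x 1) * cnj (Complex (x 0) (x 1)) + Complex (x 2) (x 3) * cnj (Complex (x 2) (x 3)) = 1"
    by (simp add: complex_eq_iff power2_eq_square algebra_simps)
  then show ?thesis
    unfolding SU3_iff det_3 expand3 conj_transpose_nth SU2_embed_def vec_lambda_beta
    by (simp add: algebra_simps)
qed

lemma column_3_SU2_embed: "column 3 (SU2_embed x) = axis 3 1"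
  by (simp add: vec_eq_iff column_def SU2_embed_def axis_def)

text \<open>The cofactor formulas determine the second column and the last row from the first
  column.\<close>

lemma SU3_fixing_axis_3:
  assumes "u \<in> SU3" "column 3 u = axis 3 1"
  shows "u = SU2_embed (\<lambda>i. if i = 0 then Re (u$1$1) else if i = 1 then Im (u$1$1)
     else if i = 2 then Re (u$2$1) else if i = 3 then Im (u$2$1) else 0)"
proof -
  have c: "u$1$3 = 0" "u$2$3 = 0" "u$3$3 = 1"
    using assms(2) by (auto simp: vec_eq_iff forall_3 column_def axis_def)
  have "cnj (u$1$1) = u$2$2" "cnj (u$2$1) = - u$1$2" "cnj (u$3$1) = 0" "cnj (u$3$2) = 0"
    using SU3_cofactors [OF assms(1)] c by simp_all
  then have "u$2$2 = cnj (u$1$1)" "u$1$2 = - cnj (u$2$1)" "u$3$1 = 0" "u$3$2 = 0"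
    by simp_all
  then show ?thesis
    unfolding vec_eq_iff forall_3 SU2_embed_def vec_lambda_beta using c by simp
qed

lemma SU3_fixing_axis_3_norm:
  assumes "u \<in> SU3" "column 3 u = axis 3 1"
  shows "(Re (u$1$1))\<^sup>2 + (Im (u$1$1))\<^sup>2 + (Re (u$2$1))\<^sup>2 + (Im (u$2$1))\<^sup>2 = 1"
proof -
  have "u$1$3 = 0" "u$2$3 = 0"
    using assms(2) by (auto simp: vec_eq_iff forall_3 column_def axis_def)
  then have u31: "u$3$1 = 0"
    using SU3_cofactors(7) [OF assms(1)] by simp
  have "herm (column 1 u) (column 1 u) = 1"
    by (simp add: SU3_norm_column [OF assms(1)] herm_self_eq_1)
  then have "cnj (u$1$1) * u$1$1 + cnj (u$2$1) * u$2$1 = 1"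
    by (simp add: herm_def sum_3 column_def u31)
  then show ?thesis
    by (simp add: complex_eq_iff power2_eq_square)
qed

lemma continuous_on_SU2_embed: "continuous_on S SU2_embed"
proof -
  have eq: "SU2_embed = (\<lambda>x. \<chi> i j. if i = 3 \<or> j = 3 then (if i = j then 1 else 0)
     else if j = 1 then (if i = 1 then of_real (x 0) + \<i> * of_real (x 1) else of_real (x 2) + \<i> * of_real (x 3))
     else (if i = 1 then - cnj (of_real (x 2) + \<i> * of_real (x 3)) else cnj (of_real (x 0) + \<i> * of_real (x 1))))"
    by (simp add: fun_eq_iff SU2_embed_def vec_eq_iff complex_eq_iff)
  have co: "continuous_on S (\<lambda>x::nat\<Rightarrow>real. x i)" for i
    by (rule continuous_on_subset [OF continuous_on_product_coordinates subset_UNIV])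
  show ?thesis
    unfolding eq by (intro continuous_on_vec_lambda continuous_on_if_const continuous_intros co)
qed

text \<open>Transporting the last column along the segment to \<open>w\<close> deforms
  \<open>V\<close> into the fibre over \<open>w\<close>, which is the coset of \<open>M\<close>
  modulo \<open>SU(2)\<close>. The hypotheses \<open>path\<close> and \<open>one\<close> keep the
  deformation and the fibre inside \<open>V\<close>.\<close>

lemma dominated_by_nsphere_3:
  assumes V: "V \<subseteq> SU3" and w: "norm w = 1" and M: "M \<in> SU3" "column 3 M = w"
    and ne: "\<And>B. B \<in> V \<Longrightarrow> column 3 B \<noteq> - w"
    and path: "\<And>B C t. B \<in> V \<Longrightarrow> 0 \<le> t \<Longrightarrow> t \<le> 1 \<Longrightarrow> C \<in> SU3
       \<Longrightarrow> column 3 C = segment_point t (column 3 B) w \<Longrightarrow> C \<in> V"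
    and one: "\<And>C. C \<in> SU3 \<Longrightarrow> column 3 C = w \<Longrightarrow> C \<in> V"
  obtains f g where "continuous_map (top_of_set V) (nsphere 3) f" "continuous_map (nsphere 3) (top_of_set V) g"
    "homotopic_with (\<lambda>h. True) (top_of_set V) (top_of_set V) (g \<circ> f) id"
proof -
  \<comment> \<open>Left multiplication by the inverse of \<open>M\<close> moves \<open>w\<close> to
    the last basis vector, so \<open>u B\<close> lies in \<open>SU(2)\<close>; \<open>f\<close>
    reads off the coordinates of its first column.\<close>
  define u where "u = (\<lambda>B. conj_transpose M ** transport 3 B w)"
  define f where "f = (\<lambda>B (i::nat). if i = 0 then Re (u B$1$1) else if i = 1 then Im (u B$1$1)
     else if i = 2 then Re (u B$2$1) else if i = 3 then Im (u B$2$1) else (0::real))"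
  define g where "g = (\<lambda>x. M ** SU2_embed x)"
  have ne': "w \<noteq> - column 3 B" if "B \<in> V" for B using ne [OF that] by (metis minus_minus)
  have uSU: "u B \<in> SU3" if "B \<in> V" for B
    unfolding u_def using that V w ne' M by (intro SU3_mult SU3_conj_transpose transport_SU3) auto
  have axis: "conj_transpose M *v w = axis 3 1"
  proof -
    have "conj_transpose M *v w = column 3 (conj_transpose M ** M)"
      by (simp add: column_mult M)
    also have "\<dots> = axis 3 1"
      by (simp add: SU3_D [OF M(1)] vec_eq_iff column_def axis_def mat_1_nth)
    finally show ?thesis .
  qed
  have u3: "column 3 (u B) = axis 3 1" if "B \<in> V" for B
    using that V w ne' axis by (simp add: u_def column_mult column_transport subset_iff)
  have Mu: "M ** u B = transport 3 B w" for B
    unfolding u_def using SU3_cancel(2) [OF M(1)] .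
  have gf: "g (f B) = transport 3 B w" if "B \<in> V" for B
  proof -
    have "u B = SU2_embed (f B)"
      unfolding f_def by (rule SU3_fixing_axis_3 [OF uSU [OF that] u3 [OF that]])
    then show ?thesis using Mu by (metis g_def)
  qed
  have contu: "continuous_on V u"
    unfolding u_def using V w ne'
    by (intro continuous_intros continuous_on_transport) auto
  have "continuous_on V f"
  proof (rule continuous_on_coordinatewise_then_product)
    show "continuous_on V (\<lambda>x. f x i)" for i
      unfolding f_def by (intro continuous_on_if_const continuous_intros contu)
  qed
  moreover have "(\<Sum>i\<le>3. (f B i)\<^sup>2) = 1 \<and> (\<forall>i>3. f B i = 0)" if "B \<in> V" for B
    using SU3_fixing_axis_3_norm [OF uSU [OF that] u3 [OF that]]
    by (simp add: f_def eval_nat_numeral algebra_simps)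
  ultimately have "continuous_map (top_of_set V) (nsphere 3) f"
    by (auto simp: nsphere_eq_top_of_set)
  moreover have "continuous_map (nsphere 3) (top_of_set V) g"
  proof -
    have "g x \<in> V" if "(\<Sum>i\<le>3. (x i)\<^sup>2) = 1" for x
    proof (rule one)
      show "g x \<in> SU3" unfolding g_def using that M SU2_embed_SU3 by blast
      have "M *v axis 3 1 = w"
        using M(2) by (simp add: vec_eq_iff matrix_vector_mult_def sum_3 axis_def column_def)
      then show "column 3 (g x) = w"
        by (simp add: g_def column_mult column_3_SU2_embed)
    qed
    moreover have "continuous_on S g" for S
      unfolding g_def by (intro continuous_intros continuous_on_SU2_embed)
    ultimately show ?thesis by (auto simp: nsphere_eq_top_of_set)
  qed
  moreover have "homotopic_with (\<lambda>h. True) (top_of_set V) (top_of_set V) id (g \<circ> f)"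
  proof (rule homotopic_with_top_of_setI)
    let ?h = "\<lambda>z. transport 3 (snd z) (segment_point (fst z) (column 3 (snd z)) w)"
    show "continuous_on ({0..1} \<times> V) ?h"
      using V w ne by (intro continuous_on_transport_segment continuous_intros) auto
    show "?h (t, B) \<in> V" if "t \<in> {0..1}" "B \<in> V" for t B
      using that V w ne path [OF that(2)] transport_segment_SU3 [of B w 3 t] column_transport_segment [of B w 3 t]
      by (auto simp: subset_iff)
    show "?h (0, B) = id B" if "B \<in> V" for B
      using that V by (simp add: segment_point_0 SU3_norm_column transport_self subset_iff)
    show "?h (1, B) = (g \<circ> f) B" if "B \<in> V" for B
      using that V by (simp add: segment_point_1 w gf)
  qed
  ultimately show thesis
    using that homotopic_with_sym by blast
qed

text \<open>Transport of the identity matrix reaches every unit vector except the antipode of the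
  last basis vector, for which a diagonal matrix is given.\<close>

lemma SU3_transitive:
  assumes "norm w = 1"
  obtains M where "M \<in> SU3" "column 3 M = w"
proof (cases "w = - axis 3 1")
  case True
  let ?M = "(\<chi> i j. if i = j then if i = 1 then 1 else - 1 else 0) :: complex^3^3"
  have "?M \<in> SU3"
    unfolding SU3_iff det_3 expand3 conj_transpose_nth vec_lambda_beta by simp
  moreover have "column 3 ?M = w"
    using True by (simp add: vec_eq_iff forall_3 column_def axis_def)
  ultimately show ?thesis by (rule that)
next
  case False
  have e: "column 3 (mat 1 :: complex^3^3) = axis 3 1"
    by (simp add: vec_eq_iff column_def axis_def mat_1_nth)
  show ?thesis
    using that [of "transport 3 (mat 1) w"] False assms
    by (simp add: transport_SU3 column_transport e)
qed

text \<open>The imaginary parts come first because complex conjugation interchanges the two half spaces of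
  exactly these three coordinates.\<close>

definition real_coord :: "nat \<Rightarrow> complex^3 \<Rightarrow> real" where
  "real_coord k v = (if k = 0 then Im (v$3) else if k = 1 then Im (v$2) else if k = 2 then Im (v$1)
     else if k = 3 then Re (v$3) else if k = 4 then Re (v$2) else Re (v$1))"

definition of_coords :: "(nat \<Rightarrow> real) \<Rightarrow> complex^3" where
  "of_coords f = (\<chi> i. if i = 1 then Complex (f 5) (f 2) else if i = 2 then Complex (f 4) (f 1) else Complex (f 3) (f 0))"

lemma real_coord_add: "real_coord k (v + w) = real_coord k v + real_coord k w"
  and real_coord_scaleR: "real_coord k (r *\<^sub>R v) = r * real_coord k v"
  and real_coord_uminus: "real_coord k (- v) = - real_coord k v"
  by (simp_all add: real_coord_def)

lemma real_coord_sgn: "real_coord k (sgn v) = real_coord k v / norm v"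
  by (simp add: sgn_div_norm real_coord_scaleR divide_inverse)

lemma less_6_cases: "(\<forall>k<6::nat. P k) \<longleftrightarrow> P 0 \<and> P 1 \<and> P 2 \<and> P 3 \<and> P 4 \<and> P 5"
  by (simp add: eval_nat_numeral less_Suc_eq all_conj_distrib imp_conjL)

lemma real_coord_of_coords: "k < 6 \<Longrightarrow> real_coord k (of_coords f) = f k"
proof -
  have "\<forall>k<6. real_coord k (of_coords f) = f k"
    unfolding less_6_cases by (simp add: real_coord_def of_coords_def)
  then show "k < 6 \<Longrightarrow> ?thesis" by simp
qed

lemma norm_real_coord: "(norm v)\<^sup>2 = (\<Sum>k\<le>5. (real_coord k v)\<^sup>2)"
proof -
  have "{..5::nat} = {0,1,2,3,4,5}" by auto
  then show ?thesis
    by (simp add: norm_vec_def L2_set_def sum_nonneg sum_3 cmod_power2 real_coord_def)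
qed

lemma real_coord_eqI: "(\<And>k. k < 6 \<Longrightarrow> real_coord k v = real_coord k w) \<Longrightarrow> v = w"
proof -
  assume "\<And>k. k < 6 \<Longrightarrow> real_coord k v = real_coord k w"
  then have "\<forall>k<6. real_coord k v = real_coord k w" by simp
  then show "v = w"
    unfolding less_6_cases by (simp add: real_coord_def vec_eq_iff forall_3 complex_eq_iff)
qed

lemma continuous_on_real_coord [continuous_intros]:
  assumes "continuous_on S f"
  shows "continuous_on S (\<lambda>x. real_coord k (f x))"
  unfolding real_coord_def by (intro continuous_on_if_const continuous_intros assms)

text \<open>An open neighbourhood of the matrices whose last column lies in the subsphere where the
  coordinates below \<open>k\<close> vanish. Working with neighbourhoods of subspheres keeps all the
  covers open.\<close>

definition coord_slice :: "nat \<Rightarrow> (complex^3^3) set" where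
  "coord_slice k = {B\<in>SU3. \<exists>j\<in>{k..<6}. real_coord j (column 3 B) \<noteq> 0}"

definition coord_half :: "nat \<Rightarrow> real \<Rightarrow> (complex^3^3) set" where
  "coord_half k s = {B\<in>SU3. s * real_coord k (column 3 B) > 0 \<or> (\<exists>j\<in>{Suc k..<6}. real_coord j (column 3 B) \<noteq> 0)}"

lemma coord_slice_eq_union: "k < 6 \<Longrightarrow> coord_slice k = coord_half k 1 \<union> coord_half k (-1)"
proof -
  assume "k < 6"
  then have "{k..<6} = insert k {Suc k..<6}" by auto
  then show ?thesis by (auto simp: coord_slice_def coord_half_def)
qed

lemma coord_half_Int: "coord_half k 1 \<inter> coord_half k (-1) = coord_slice (Suc k)"
  by (auto simp: coord_slice_def coord_half_def)

lemma coord_half_openin: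
  assumes "k < 6" "s = 1 \<or> s = -1"
  shows "openin (top_of_set (coord_slice k)) (coord_half k s)"
proof -
  let ?T = "{B. s * real_coord k (column 3 B) > 0 \<or> (\<exists>j\<in>{Suc k..<6}. real_coord j (column 3 B) \<noteq> 0)} :: (complex^3^3) set"
  have "open ?T"
    unfolding Bex_def
    by (intro open_Collect_disj open_Collect_ex open_Collect_conj open_Collect_const open_Collect_less open_Collect_neq continuous_intros)
  moreover have "coord_half k s = coord_slice k \<inter> ?T"
    using coord_slice_eq_union [OF assms(1)] assms(2) by (auto simp: coord_half_def)
  ultimately show ?thesis
    by (auto simp: openin_open)
qed

lemma coord_slice_0: "coord_slice 0 = SU3"
proof -
  have "\<exists>j\<in>{0..<6}. real_coord j (column 3 B) \<noteq> 0" if "B \<in> SU3" for B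
  proof (rule ccontr)
    assume "\<not> ?thesis"
    then have "column 3 B = 0"
      by (intro real_coord_eqI) (simp add: real_coord_def)
    then show False using SU3_norm_column [OF that, of 3] by simp
  qed
  then show ?thesis by (auto simp: coord_slice_def)
qed

text \<open>The last column is contracted to the pole \<open>w\<close>, the unit vector with
  \<open>s\<close> in coordinate \<open>k\<close>. The antipode of \<open>w\<close> is outside the
  half. Along the way coordinate \<open>k\<close> keeps its sign if it was that of \<open>s\<close>,
  and the later coordinates are only rescaled.\<close>

lemma coord_half_dominated:
  assumes k: "k < 6" and s: "s = 1 \<or> s = -1"
  obtains f g where "continuous_map (top_of_set (coord_half k s)) (nsphere 3) f"
    "continuous_map (nsphere 3) (top_of_set (coord_half k s)) g"
    "homotopic_with (\<lambda>h. True) (top_of_set (coord_half k s)) (top_of_set (coord_half k s)) (g \<circ> f) id"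
proof -
  define w where "w = of_coords (\<lambda>j. if j = k then s else 0)"
  have cw: "real_coord j w = (if j = k then s else 0)" if "j < 6" for j
    using that by (simp add: w_def real_coord_of_coords)
  have ss: "s * s = 1" using s by auto
  have "(norm w)\<^sup>2 = 1"
  proof -
    have "(\<Sum>j\<le>5. (real_coord j w)\<^sup>2) = (\<Sum>j\<le>5. if j = k then 1 else 0)"
      using cw ss by (intro sum.cong) (auto simp: power2_eq_square)
    also have "\<dots> = 1" using k by simp
    finally show ?thesis by (simp add: norm_real_coord)
  qed
  then have w: "norm w = 1" by (metis norm_ge_zero one_power2 power2_eq_imp_eq zero_le_one)
  obtain M where M: "M \<in> SU3" "column 3 M = w" using SU3_transitive [OF w] .
  have V: "coord_half k s \<subseteq> SU3" by (auto simp: coord_half_def)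
  have ne: "column 3 B \<noteq> - w" if "B \<in> coord_half k s" for B
  proof
    assume B: "column 3 B = - w"
    have "s * real_coord k (column 3 B) = -1" using B cw [OF k] ss by (simp add: real_coord_uminus)
    moreover have "real_coord j (column 3 B) = 0" if "j\<in>{Suc k..<6}" for j
      using that B cw by (simp add: real_coord_uminus)
    ultimately show False using that by (auto simp: coord_half_def)
  qed
  have one: "C \<in> coord_half k s" if "C \<in> SU3" "column 3 C = w" for C
    using that cw [OF k] ss by (simp add: coord_half_def)
  have path: "C \<in> coord_half k s" if B: "B \<in> coord_half k s" and t: "0 \<le> t" "t \<le> 1" and C: "C \<in> SU3"
       and Cc: "column 3 C = segment_point t (column 3 B) w" for B C t
  \<comment> \<open>At the final time the later coordinates have shrunk to 0, so membership must
    come from the pole itself.\<close>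
  proof (cases "t = 1")
    case True
    then show ?thesis using one C Cc w by (simp add: segment_point_1)
  next
    case False
    define v where "v = column 3 B"
    have v: "norm v = 1" using B V by (auto simp: v_def SU3_norm_column)
    define n where "n = norm ((1 - t) *\<^sub>R v + t *\<^sub>R w)"
    have n: "n > 0"
      using segment_point_nonzero [OF v w, of t] t ne [OF B] by (simp add: n_def v_def)
    have co: "real_coord j (column 3 C) = ((1 - t) * real_coord j v + t * real_coord j w) / n" for j
      unfolding Cc segment_point_def real_coord_sgn real_coord_add real_coord_scaleR n_def v_def ..
    consider "s * real_coord k v > 0" | j where "j\<in>{Suc k..<6}" "real_coord j v \<noteq> 0"
      using B by (auto simp: coord_half_def v_def)
    then show ?thesis
    proof cases
      case 1
      have "s * real_coord k (column 3 C) = ((1 - t) * (s * real_coord k v) + t) / n"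
        unfolding co cw [OF k] using ss by (simp add: algebra_simps)
      moreover have "(1 - t) * (s * real_coord k v) + t > 0"
      proof (rule add_pos_nonneg)
        show "(1 - t) * (s * real_coord k v) > 0"
          by (rule mult_pos_pos) (use 1 t False in auto)
      qed (rule t)
      ultimately show ?thesis using n C by (simp add: coord_half_def)
    next
      case 2
      then have "real_coord j (column 3 C) \<noteq> 0"
        unfolding co using cw n False by simp
      then show ?thesis using 2 C by (auto simp: coord_half_def)
    qed
  qed
  show thesis
    by (rule dominated_by_nsphere_3 [OF V w M ne path one that])
qed

lemma acyclic_coord_half:
  assumes "k < 6" "s = 1 \<or> s = -1" "p > 3"
  shows "acyclic_in p (top_of_set (coord_half k s))"
proof -
  have "acyclic_in p (nsphere 3)" using assms(3) by (intro acyclic_in_nsphere) auto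
  moreover obtain f g where "continuous_map (top_of_set (coord_half k s)) (nsphere 3) f"
    "continuous_map (nsphere 3) (top_of_set (coord_half k s)) g"
    "homotopic_with (\<lambda>h. True) (top_of_set (coord_half k s)) (top_of_set (coord_half k s)) (g \<circ> f) id"
    by (rule coord_half_dominated [OF assms(1,2)])
  ultimately show ?thesis
    by (rule acyclic_in_dominated)
qed

lemma no_2_torsion_coord_half:
  assumes "k < 6" "s = 1 \<or> s = -1"
  shows "no_2_torsion_in 3 (top_of_set (coord_half k s))"
proof -
  have "no_2_torsion_in 3 (nsphere 3)" by (intro no_2_torsion_in_nsphere) simp
  moreover obtain f g where "continuous_map (top_of_set (coord_half k s)) (nsphere 3) f"
    "continuous_map (nsphere 3) (top_of_set (coord_half k s)) g"
    "homotopic_with (\<lambda>h. True) (top_of_set (coord_half k s)) (top_of_set (coord_half k s)) (g \<circ> f) id"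
    by (rule coord_half_dominated [OF assms])
  ultimately show ?thesis
    by (rule no_2_torsion_in_dominated)
qed

lemma subtopology_coord_slice:
  assumes "A \<subseteq> coord_slice k"
  shows "subtopology (top_of_set (coord_slice k)) A = top_of_set A"
  by (simp only: subtopology_subtopology inf.absorb2 [OF assms])

lemma coord_half_subset: "k < 6 \<Longrightarrow> s = 1 \<or> s = -1 \<Longrightarrow> coord_half k s \<subseteq> coord_slice k"
  using coord_slice_eq_union by auto

lemma coord_slice_antimono: "coord_slice (Suc k) \<subseteq> coord_slice k"
  by (auto simp: coord_slice_def)

text \<open>Descending induction: for \<open>k = 5\<close> the two halves are disjoint and dominated
  by three-spheres, which accounts for degree 3. Each Mayer--Vietoris step adds one coordinate and
  raises the degree by one; the halves are acyclic in all degrees above 3.\<close>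

lemma no_2_torsion_coord_slice:
  assumes "k \<le> 5"
  shows "no_2_torsion_in (8 - k) (top_of_set (coord_slice k))"
  using assms
proof (induction k rule: inc_induct)
  case base
  \<comment> \<open>No coordinates are left beyond index 5, so the two halves of the last slice do
    not meet.\<close>
  have "coord_slice 6 = {}" by (simp add: coord_slice_def)
  then have dis: "coord_half 5 1 \<inter> coord_half 5 (-1) = {}"
    using coord_half_Int [of 5] by simp
  have sub: "subtopology (top_of_set (coord_slice 5)) (coord_half 5 s) = top_of_set (coord_half 5 s)"
    if "s = 1 \<or> s = -1" for s
    by (intro subtopology_coord_slice coord_half_subset that) simp
  have "no_2_torsion_in 3 (top_of_set (coord_slice 5))"
  proof (rule no_2_torsion_in_disjoint_union [OF _ _ _ dis])
    show "topspace (top_of_set (coord_slice 5)) \<subseteq> coord_half 5 1 \<union> coord_half 5 (-1)"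
      by (simp only: topspace_euclidean_subtopology coord_slice_eq_union)
    show "no_2_torsion_in 3 (subtopology (top_of_set (coord_slice 5)) (coord_half 5 1))"
      "no_2_torsion_in 3 (subtopology (top_of_set (coord_slice 5)) (coord_half 5 (-1)))"
      by (subst sub; (rule no_2_torsion_coord_half)?; simp)+
  qed (rule coord_half_openin; simp)+
  then show ?case by simp
next
  case (step k)
  then have k: "k < 6" by simp
  have ss: "(1::real) = 1 \<or> (1::real) = -1" "(-1::real) = 1 \<or> (-1::real) = -1" by simp_all
  have "no_2_torsion_in (Suc (7 - k)) (top_of_set (coord_slice k))"
  proof (rule no_2_torsion_in_Mayer_Vietoris)
    show "openin (top_of_set (coord_slice k)) (coord_half k 1)"
      by (rule coord_half_openin [OF k ss(1)])
    show "openin (top_of_set (coord_slice k)) (coord_half k (-1))"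
      by (rule coord_half_openin [OF k ss(2)])
    show "topspace (top_of_set (coord_slice k)) \<subseteq> coord_half k 1 \<union> coord_half k (-1)"
      by (simp only: topspace_euclidean_subtopology coord_slice_eq_union [OF k])
    show "acyclic_in (Suc (7 - k)) (subtopology (top_of_set (coord_slice k)) (coord_half k 1))"
      unfolding subtopology_coord_slice [OF coord_half_subset [OF k ss(1)]]
      by (rule acyclic_coord_half [OF k ss(1)]) (use step in simp)
    show "acyclic_in (Suc (7 - k)) (subtopology (top_of_set (coord_slice k)) (coord_half k (-1)))"
      unfolding subtopology_coord_slice [OF coord_half_subset [OF k ss(2)]]
      by (rule acyclic_coord_half [OF k ss(2)]) (use step in simp)
    have "8 - Suc k = 7 - k" by simp
    then show "no_2_torsion_in (7 - k) (subtopology (top_of_set (coord_slice k)) (coord_half k 1 \<inter> coord_half k (-1)))"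
      using step unfolding coord_half_Int subtopology_coord_slice [OF coord_slice_antimono] by simp
  qed
  moreover have "Suc (7 - k) = 8 - k" using step by simp
  ultimately show ?case by simp
qed

lemma no_2_torsion_SU3: "no_2_torsion_in 8 (top_of_set SU3)"
  using no_2_torsion_coord_slice [of 0] by (simp add: coord_slice_0)

section \<open>Complex conjugation reverses the orientation\<close>

definition rot12 :: "real \<Rightarrow> complex^3^3" where
  "rot12 t = (\<chi> i j. if i = 3 \<or> j = 3 then (if i = j then 1 else 0)
     else if i = j then of_real (cos t) else if i = 1 then - of_real (sin t) else of_real (sin t))"

lemma cos_sin_of_real: "of_real (cos t) * of_real (cos t) + of_real (sin t) * of_real (sin t) = (1::complex)"
  by (metis (no_types) of_real_1 of_real_add of_real_mult sin_cos_squared_add3)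

lemma rot12_SU3: "rot12 t \<in> SU3"
  unfolding SU3_iff det_3 expand3 conj_transpose_nth rot12_def vec_lambda_beta
  using cos_sin_of_real [of t] by (simp add: algebra_simps)

lemma continuous_on_rot12 [continuous_intros]:
  fixes f :: "'a::t2_space \<Rightarrow> real"
  assumes "continuous_on S f"
  shows "continuous_on S (\<lambda>x. rot12 (f x))"
  unfolding rot12_def
  by (intro continuous_on_vec_lambda continuous_on_if_const continuous_on_cos continuous_on_sin continuous_intros assms)

lemma rot12_0 [simp]: "rot12 0 = mat 1"
  unfolding expand3 rot12_def vec_lambda_beta by simp

text \<open>The matrix of the cross product with \<open>v\<close> on the left.\<close>

definition skew_matrix :: "complex^3 \<Rightarrow> complex^3^3" where
  "skew_matrix v = (\<chi> i j. if i = j then 0 else if i = 1 \<and> j = 2 then - v$3 else if i = 1 then v$2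
     else if i = 2 \<and> j = 1 then v$3 else if i = 2 then - v$1
     else if j = 1 then - v$2 else v$1)"

text \<open>Rodrigues' formula for the rotation through the angle \<open>t\<close> about
  \<open>v\<close>, meant for a real unit vector \<open>v\<close>.\<close>

definition rot_about :: "real \<Rightarrow> complex^3 \<Rightarrow> complex^3^3" where
  "rot_about t v = (\<chi> i j. (if i = j then of_real (cos t) else 0)
     + (1 - of_real (cos t)) * (v$i * v$j) + of_real (sin t) * skew_matrix v $ i $ j)"

lemma continuous_on_skew_matrix [continuous_intros]:
  assumes "continuous_on S f"
  shows "continuous_on S (\<lambda>x. skew_matrix (f x))"
  unfolding skew_matrix_def
  by (intro continuous_on_vec_lambda continuous_on_if_const continuous_on_cos continuous_on_sin continuous_intros assms)

lemma continuous_on_rot_about [continuous_intros]: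
  fixes f :: "'a::t2_space \<Rightarrow> real"
  assumes "continuous_on S f" "continuous_on S g"
  shows "continuous_on S (\<lambda>x. rot_about (f x) (g x))"
  unfolding rot_about_def
  by (intro continuous_on_vec_lambda continuous_on_if_const continuous_on_cos continuous_on_sin continuous_intros assms)

lemma rot_about_0 [simp]: "rot_about 0 v = mat 1"
  unfolding expand3 rot_about_def vec_lambda_beta by simp

lemma rot_about_SU3:
  assumes "norm v = 1" "\<And>i. cnj (v $ i) = v $ i"
  shows "rot_about t v \<in> SU3"
proof -
  define a b c where "a = v$1" "b = v$2" "c = v$3"
  define k s :: complex where "k = of_real (cos t)" "s = of_real (sin t)"
  have ks: "k * k + s * s = 1" unfolding k_s_def by (rule cos_sin_of_real)
  have "herm v v = 1" using assms by (simp add: herm_self_eq_1)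
  then have abc: "a * a + b * b + c * c = 1"
    by (simp add: herm_def sum_3 assms a_b_c_def)
  have cj: "cnj a = a" "cnj b = b" "cnj c = c" "cnj k = k" "cnj s = s"
    by (simp_all add: assms a_b_c_def k_s_def)
  have e: "rot_about t v $ 1 $ 1 = k + (1 - k) * (a * a)" "rot_about t v $ 1 $ 2 = (1 - k) * (a * b) - s * c"
    "rot_about t v $ 1 $ 3 = (1 - k) * (a * c) + s * b" "rot_about t v $ 2 $ 1 = (1 - k) * (a * b) + s * c"
    "rot_about t v $ 2 $ 2 = k + (1 - k) * (b * b)" "rot_about t v $ 2 $ 3 = (1 - k) * (b * c) - s * a"
    "rot_about t v $ 3 $ 1 = (1 - k) * (a * c) - s * b" "rot_about t v $ 3 $ 2 = (1 - k) * (b * c) + s * a"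
    "rot_about t v $ 3 $ 3 = k + (1 - k) * (c * c)"
    by (simp_all add: rot_about_def skew_matrix_def a_b_c_def k_s_def mult.commute)
  \<comment> \<open>These equations, and their versions for nested products, eliminate the squares
    of \<open>s\<close> and \<open>c\<close>, which reduces orthogonality and the determinant to
    polynomial normalisation.\<close>
  have ss: "s * s = 1 - k * k" and cc: "c * c = 1 - a * a - b * b"
    using ks abc by (simp_all add: algebra_simps)
  then have ss': "s * (s * x) = (1 - k * k) * x" and cc': "c * (c * x) = (1 - a * a - b * b) * x" for x
    by (simp_all only: mult.assoc [symmetric])
  have "rot_about t v ** conj_transpose (rot_about t v) = mat 1"
    unfolding expand3 conj_transpose_nth e complex_cnj_add complex_cnj_diff complex_cnj_mult complex_cnj_one cj
    by (intro conjI; simp add: algebra_simps ss cc ss' cc')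
  moreover have "det (rot_about t v) = 1"
    unfolding det_3 e by (simp add: algebra_simps ss cc ss' cc')
  ultimately show ?thesis by (simp add: SU3_iff)
qed

text \<open>Let \<open>x\<close> be the real last column. The first two columns are orthogonal to
  \<open>x\<close>, so the rotation acts on them as the cross product with \<open>x\<close>. By the
  cofactor formulas this sends the first column to the conjugate of the second, and the second to
  minus the conjugate of the first. The factor on the right restores order and sign.\<close>

lemma rot_about_conjugates:
  assumes "B \<in> SU3" "\<And>i. cnj (column 3 B $ i) = column 3 B $ i"
  shows "rot_about (pi/2) (column 3 B) ** B ** transpose (rot12 (pi/2)) = cnj_matrix B"
proof -
  have r: "cnj (B$1$3) = B$1$3" "cnj (B$2$3) = B$2$3" "cnj (B$3$3) = B$3$3"
    using assms(2) by (simp_all add: column_def)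
  have "herm (column 3 B) (column j B) = (if j = 3 then 1 else 0)" for j
    using SU3_D(2) [OF assms(1)] by (simp add: herm_column mat_1_nth)
  from this [of 1] this [of 2] this [of 3] have o:
    "B$1$3 * B$1$1 + B$2$3 * B$2$1 + B$3$3 * B$3$1 = 0"
    "B$1$3 * B$1$2 + B$2$3 * B$2$2 + B$3$3 * B$3$2 = 0"
    "B$1$3 * B$1$3 + B$2$3 * B$2$3 + B$3$3 * B$3$3 = 1"
    by (simp_all add: herm_def sum_3 column_def r)
  let ?R = "rot_about (pi/2) (column 3 B)"
  have RB: "(?R ** B) $ 1 $ j = B$1$3 * (B$1$3 * B$1$j + B$2$3 * B$2$j + B$3$3 * B$3$j) + (B$2$3 * B$3$j - B$3$3 * B$2$j)"
    "(?R ** B) $ 2 $ j = B$2$3 * (B$1$3 * B$1$j + B$2$3 * B$2$j + B$3$3 * B$3$j) + (B$3$3 * B$1$j - B$1$3 * B$3$j)"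
    "(?R ** B) $ 3 $ j = B$3$3 * (B$1$3 * B$1$j + B$2$3 * B$2$j + B$3$3 * B$3$j) + (B$1$3 * B$2$j - B$2$3 * B$1$j)" for j
    by (simp_all add: matrix_mult_nth sum_3 rot_about_def skew_matrix_def column_def algebra_simps)
  have T: "(A ** transpose (rot12 (pi/2))) $ i $ 1 = - A $ i $ 2" "(A ** transpose (rot12 (pi/2))) $ i $ 2 = A $ i $ 1"
    "(A ** transpose (rot12 (pi/2))) $ i $ 3 = A $ i $ 3" for A i
    by (simp_all add: matrix_mult_nth sum_3 rot12_def transpose_def)
  show ?thesis
    unfolding vec_eq_iff forall_3 T RB o cnj_matrix_nth r SU3_cofactors [OF assms(1)]
    by (simp add: algebra_simps)
qed

text \<open>Deform the last column of \<open>B\<close> to its normalised real part \<open>x\<close>; there the conjugate of \<open>B\<close> is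
  obtained from \<open>B\<close> by rotating both sides through a right angle, on the left about the axis \<open>x\<close>.\<close>

lemma cnj_matrix_homotopic_id_coord_slice_3:
  "homotopic_with (\<lambda>h. True) (top_of_set (coord_slice 3)) (top_of_set (coord_slice 3)) cnj_matrix id"
proof -
  let ?X = "top_of_set (coord_slice 3)"
  define x where "x B = (\<chi> i. complex_of_real (Re (column 3 B $ i)))" for B :: "complex^3^3"
  define r where "r B = transport 3 B (sgn (x B))" for B
  define Rl where "Rl = {B\<in>SU3. \<forall>i. cnj (column 3 B $ i) = column 3 B $ i}"
  have slice: "B \<in> coord_slice 3 \<longleftrightarrow> B \<in> SU3 \<and> x B \<noteq> 0" for B
  proof -
    have "{3..<6} = {3,4,5::nat}" by auto
    then show ?thesis
      by (auto simp: coord_slice_def real_coord_def x_def vec_eq_iff forall_3)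
  qed
  have contx: "continuous_on S x" for S
    unfolding x_def by (intro continuous_intros)
  have nx: "norm (sgn (x B)) = 1" if "B \<in> coord_slice 3" for B
    using that slice by (simp add: norm_sgn)
  have sgnx: "sgn (x B) $ i = of_real (Re (column 3 B $ i) / norm (x B))" for B i
  proof -
    have xi: "x B $ i = of_real (Re (column 3 B $ i))" by (simp add: x_def)
    show ?thesis
      unfolding sgn_div_norm vector_scaleR_component xi
      by (simp add: scaleR_conv_of_real divide_inverse mult.commute)
  qed
  \<comment> \<open>Otherwise the real part of the column would be a negative multiple of itself,
    hence zero, which the slice excludes.\<close>
  have ne: "column 3 B \<noteq> - sgn (x B)" if "B \<in> coord_slice 3" for B
  proof
    assume eq: "column 3 B = - sgn (x B)"
    have n: "norm (x B) > 0" using that slice by simp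
    have "Re (column 3 B $ i) = 0" for i
    proof -
      have "Re (column 3 B $ i) = - (Re (column 3 B $ i) / norm (x B))"
        using arg_cong [OF eq, of "\<lambda>v. Re (v $ i)"] sgnx [of B i] by simp
      then have "Re (column 3 B $ i) * (1 + norm (x B)) = 0"
        using n by (simp add: field_simps)
      then show ?thesis using n by auto
    qed
    then have "x B = 0" by (simp add: x_def vec_eq_iff)
    then show False using that slice by blast
  qed
  have inSU: "coord_slice 3 \<subseteq> SU3" by (auto simp: coord_slice_def)
  have Rl_slice: "Rl \<subseteq> coord_slice 3"
  proof
    fix B assume B: "B \<in> Rl"
    then have "x B = column 3 B"
      by (simp add: Rl_def x_def vec_eq_iff complex_eq_iff)
    then have "norm (x B) = 1" using B by (simp add: Rl_def SU3_norm_column)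
    then have "x B \<noteq> 0" by auto
    then show "B \<in> coord_slice 3" using B slice by (simp add: Rl_def)
  qed
  have rR: "r B \<in> Rl" if "B \<in> coord_slice 3" for B
  proof -
    have ne': "sgn (x B) \<noteq> - column 3 B" using ne [OF that] by (metis minus_minus)
    have "r B \<in> SU3"
      unfolding r_def using that inSU nx ne' by (intro transport_SU3) auto
    moreover have "column 3 (r B) = sgn (x B)"
      unfolding r_def using that inSU nx ne' by (intro column_transport) auto
    ultimately show ?thesis by (simp add: Rl_def sgnx)
  qed
  have h1: "homotopic_with (\<lambda>h. True) ?X ?X id r"
  proof (rule homotopic_with_top_of_setI)
    let ?h = "\<lambda>z. transport 3 (snd z) (segment_point (fst z) (column 3 (snd z)) (sgn (x (snd z))))"
    have "continuous_on ({0..1} \<times> coord_slice 3) (\<lambda>z. x (snd z))"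
      by (rule continuous_on_compose2 [OF contx continuous_on_snd [OF continuous_on_id] subset_UNIV])
    then show "continuous_on ({0..1} \<times> coord_slice 3) ?h"
      using slice nx ne inSU
      by (intro continuous_on_transport_segment continuous_intros) auto
    show "?h (t, B) \<in> coord_slice 3" if t: "t \<in> {0..1}" and B: "B \<in> coord_slice 3" for t B
    proof -
      let ?C = "?h (t, B)"
      let ?y = "(1 - t) *\<^sub>R column 3 B + t *\<^sub>R sgn (x B)"
      have C: "?C \<in> SU3"
        using t B inSU nx ne by (auto intro: transport_segment_SU3)
      have cC: "column 3 ?C = segment_point t (column 3 B) (sgn (x B))"
        using t B inSU nx ne by (auto intro: column_transport_segment)
      have n: "norm (x B) > 0" and BS: "B \<in> SU3" using B slice by auto
      have ny: "norm ?y > 0"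
        using segment_point_nonzero [OF SU3_norm_column [OF BS] nx [OF B], of 3 t] ne [OF B] t by simp
      \<comment> \<open>Along the path the real part of the last column is the initial one times
        this positive factor, so it never vanishes and the path stays in the slice.\<close>
      define m where "m = ((1 - t) + t / norm (x B)) / norm ?y"
      have "(1 - t) + t / norm (x B) > 0"
      proof (cases "t = 1")
        case False
        then show ?thesis using t n by (intro add_pos_nonneg) auto
      qed (use n in simp)
      then have m: "m > 0" unfolding m_def using ny by simp
      have Cy: "column 3 ?C = inverse (norm ?y) *\<^sub>R ?y"
        by (rule trans [OF cC]) (simp only: segment_point_def sgn_div_norm)
      have "Re (column 3 ?C $ i) = m * Re (column 3 B $ i)" for i
      proof -
        have "Re (?y $ i) = ((1 - t) + t / norm (x B)) * Re (column 3 B $ i)"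
          by (simp add: sgnx algebra_simps)
        then show ?thesis
          unfolding m_def by (subst Cy) (auto simp add: divide_inverse algebra_simps)
      qed
      then have "x ?C = m *\<^sub>R x B"
        by (simp add: x_def vec_eq_iff complex_eq_iff)
      then show ?thesis using C m B slice by simp
    qed
    show "?h (0, B) = id B" if "B \<in> coord_slice 3" for B
      using that inSU by (auto simp: segment_point_0 SU3_norm_column transport_self subset_iff)
    show "?h (1, B) = r B" if "B \<in> coord_slice 3" for B
      using that nx by (simp add: segment_point_1 r_def)
  qed
  have contc: "continuous_map ?X ?X cnj_matrix"
  proof -
    have "x (cnj_matrix B) = x B" for B by (simp add: x_def column_def)
    then show ?thesis
      using slice by (auto intro!: continuous_intros SU3_cnj_matrix)
  qed
  have h2: "homotopic_with (\<lambda>h. True) ?X ?X (cnj_matrix \<circ> id) (cnj_matrix \<circ> r)"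
    by (rule homotopic_with_compose_continuous_map_left [OF h1 contc]) simp
  have h3: "homotopic_with (\<lambda>h. True) (top_of_set Rl) ?X id cnj_matrix"
  proof (rule homotopic_with_top_of_setI)
    let ?h = "\<lambda>z. rot_about (fst z * (pi/2)) (column 3 (snd z)) ** snd z ** transpose (rot12 (fst z * (pi/2)))"
    show "continuous_on ({0..1} \<times> Rl) ?h"
      by (intro continuous_intros)
    show "?h (t, B) \<in> coord_slice 3" if "t \<in> {0..1}" "B \<in> Rl" for t B
    proof -
      let ?v = "column 3 B" and ?s = "t * (pi/2)"
      have B: "B \<in> SU3" "\<And>i. cnj (?v $ i) = ?v $ i" using that by (auto simp: Rl_def)
      have SU: "?h (t, B) \<in> SU3"
        using rot_about_SU3 [OF SU3_norm_column [OF B(1)] B(2)] B(1) rot12_SU3 by auto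
      \<comment> \<open>The factor on the right leaves the last column alone, and the factor on the
        left is a rotation about that very column. The last column is therefore constant, and in
        particular real, during the homotopy.\<close>
      have T: "column 3 (A ** transpose (rot12 ?s)) = column 3 A" for A
        by (simp add: vec_eq_iff column_def matrix_mult_nth sum_3 rot12_def transpose_def)
      have "herm ?v ?v = 1" using SU3_norm_column [OF B(1)] by (simp add: herm_self_eq_1)
      then have vv: "?v$1 * ?v$1 + ?v$2 * ?v$2 + ?v$3 * ?v$3 = 1"
        by (simp add: herm_def sum_3 B(2))
      define k s where "k = complex_of_real (cos ?s)" "s = complex_of_real (sin ?s)"
      have rv: "(rot_about ?s ?v *v ?v) $ i = k * ?v $ i + (1 - k) * (?v $ i * (?v$1 * ?v$1 + ?v$2 * ?v$2 + ?v$3 * ?v$3))" for i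
        using exhaust_3 [of i]
        by (auto simp: matrix_vector_mult_def sum_3 rot_about_def skew_matrix_def algebra_simps k_s_def)
      have "rot_about ?s ?v *v ?v = ?v"
        unfolding vec_eq_iff rv vv by (simp add: algebra_simps)
      then have "column 3 (?h (t, B)) = ?v"
        unfolding fst_conv snd_conv by (subst T, subst column_mult)
      then have "?h (t, B) \<in> Rl" using SU B by (simp add: Rl_def)
      then show ?thesis using Rl_slice by blast
    qed
    show "?h (0, B) = id B" if "B \<in> Rl" for B by simp
    show "?h (1, B) = cnj_matrix B" if "B \<in> Rl" for B
      using rot_about_conjugates [of B] that by (simp add: Rl_def)
  qed
  have "continuous_map ?X (top_of_set Rl) r"
  proof -
    have "continuous_map ?X ?X r"
      using h1 homotopic_with_imp_continuous_maps by blast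
    then show ?thesis using rR by auto
  qed
  then have h4: "homotopic_with (\<lambda>h. True) ?X ?X (id \<circ> r) (cnj_matrix \<circ> r)"
    by (intro homotopic_with_compose_continuous_map_right [OF h3]) simp_all
  \<comment> \<open>Conjugation is deformed to its composite with \<open>r\<close>, then to
    \<open>r\<close> by the rotations, and finally to the identity.\<close>
  show ?thesis
    using homotopic_with_trans [OF homotopic_with_trans [OF h2 homotopic_with_symD [OF h4, unfolded id_comp]] homotopic_with_symD [OF h1]]
    by (simp only: comp_id)
qed

lemma real_coord_cnj:
  "real_coord k (column 3 (cnj_matrix B)) = (if k < 3 then - 1 else 1) * real_coord k (column 3 B)"
  by (simp add: real_coord_def column_def)

lemma cnj_matrix_coord_half:
  assumes "k < 3" "B \<in> coord_half k s"
  shows "cnj_matrix B \<in> coord_half k (- s)"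
proof -
  have "real_coord j (column 3 (cnj_matrix B)) \<noteq> 0 \<longleftrightarrow> real_coord j (column 3 B) \<noteq> 0" for j
    by (simp add: real_coord_cnj)
  then show ?thesis
    using assms by (auto simp: coord_half_def real_coord_cnj)
qed

lemma cnj_matrix_coord_slice: "B \<in> coord_slice k \<Longrightarrow> cnj_matrix B \<in> coord_slice k"
  by (auto simp: coord_slice_def real_coord_cnj)

text \<open>On slice 3 conjugation is homotopic to the identity. Coordinates 2, 1, 0 are imaginary
  parts, so conjugation interchanges the two halves in each of the three further steps and every
  step contributes a sign.\<close>

lemma cnj_matrix_chain_coord_slice:
  assumes "k \<le> 3" "singular_relcycle (8 - k) (top_of_set (coord_slice k)) {} c"
  shows "homologous_rel (8 - k) (top_of_set (coord_slice k)) {} (chain_map (8 - k) cnj_matrix c)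
     (frag_cmul ((-1) ^ (3 - k)) c)"
  using assms
proof (induction k arbitrary: c rule: inc_induct)
  case base
  then show ?case
    using chain_map_homotopic_id [OF cnj_matrix_homotopic_id_coord_slice_3 base] by simp
next
  case (step k)
  then have k: "k < 3" "k < 6" by simp_all
  have ss: "(1::real) = 1 \<or> (1::real) = -1" "(-1::real) = 1 \<or> (-1::real) = -1" by simp_all
  have n: "8 - k = Suc (7 - k)" "8 - Suc k = 7 - k" using k by auto
  have e: "(-1::int) ^ (3 - k) = - ((-1) ^ (3 - Suc k))"
  proof -
    have "3 - k = Suc (3 - Suc k)" using k by simp
    then show ?thesis by (simp only: power_Suc mult_minus_left mult_1_left)
  qed
  show ?case
    unfolding n e
  proof (rule Mayer_Vietoris_sign)
    show "openin (top_of_set (coord_slice k)) (coord_half k 1)"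
      by (rule coord_half_openin [OF k(2) ss(1)])
    show "openin (top_of_set (coord_slice k)) (coord_half k (-1))"
      by (rule coord_half_openin [OF k(2) ss(2)])
    show "topspace (top_of_set (coord_slice k)) \<subseteq> coord_half k 1 \<union> coord_half k (-1)"
      by (simp only: topspace_euclidean_subtopology coord_slice_eq_union [OF k(2)])
    show "acyclic_in (Suc (7 - k)) (subtopology (top_of_set (coord_slice k)) (coord_half k 1))"
      unfolding subtopology_coord_slice [OF coord_half_subset [OF k(2) ss(1)]]
      by (rule acyclic_coord_half [OF k(2) ss(1)]) (use k in simp)
    show "acyclic_in (Suc (7 - k)) (subtopology (top_of_set (coord_slice k)) (coord_half k (-1)))"
      unfolding subtopology_coord_slice [OF coord_half_subset [OF k(2) ss(2)]]
      by (rule acyclic_coord_half [OF k(2) ss(2)]) (use k in simp)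
    show "cnj_matrix ` coord_half k 1 \<subseteq> coord_half k (- 1)"
      using cnj_matrix_coord_half [OF k(1), of _ 1] by blast
    show "cnj_matrix ` coord_half k (- 1) \<subseteq> coord_half k 1"
      using cnj_matrix_coord_half [OF k(1), of _ "-1"] by auto
    show "continuous_map (top_of_set (coord_slice k)) (top_of_set (coord_slice k)) cnj_matrix"
      using cnj_matrix_coord_slice by (auto intro!: continuous_intros)
    show "singular_relcycle (Suc (7 - k)) (top_of_set (coord_slice k)) {} c"
      using step.prems unfolding n .
    show "homologous_rel (7 - k) (subtopology (top_of_set (coord_slice k)) (coord_half k 1 \<inter> coord_half k (- 1))) {}
        (chain_map (7 - k) cnj_matrix y) (frag_cmul ((- 1) ^ (3 - Suc k)) y)"
      if "singular_relcycle (7 - k) (subtopology (top_of_set (coord_slice k)) (coord_half k 1 \<inter> coord_half k (- 1))) {} y" for y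
      using that step.IH [of y] unfolding coord_half_Int subtopology_coord_slice [OF coord_slice_antimono] n by blast
  qed
qed

lemma cnj_matrix_chain_SU3:
  assumes "singular_relcycle 8 (top_of_set SU3) {} c"
  shows "homologous_rel 8 (top_of_set SU3) {} (chain_map 8 cnj_matrix c) (- c)"
  using cnj_matrix_chain_coord_slice [of 0 c] assms by (simp add: coord_slice_0)

section \<open>Deforming words in SU(3)\<close>

abbreviation SU3_top :: "(complex^3^3) topology" where "SU3_top \<equiv> top_of_set SU3"

lemma homotopic_SU3_unfold:
  assumes "homotopic_with (\<lambda>h. True) SU3_top SU3_top f g"
  obtains h where "continuous_on ({0..1} \<times> SU3) h" "\<And>t B. t \<in> {0..1::real} \<Longrightarrow> B \<in> SU3 \<Longrightarrow> h (t, B) \<in> SU3"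
    "\<And>B. h (0, B) = f B" "\<And>B. h (1, B) = g B"
proof -
  obtain h where "continuous_map (prod_topology (top_of_set {0..1::real}) SU3_top) SU3_top h"
    and "\<And>B. h (0, B) = f B" "\<And>B. h (1, B) = g B"
    using assms by (auto simp: homotopic_with_def)
  then show ?thesis
    by (intro that [of h]) auto
qed

text \<open>With the letters as separate arguments, each of them can be deformed or replaced by the
  identity matrix while the others stay.\<close>

definition continuous_word :: "(complex^3^3 \<Rightarrow> complex^3^3 \<Rightarrow> complex^3^3 \<Rightarrow> complex^3^3) \<Rightarrow> bool" where
  "continuous_word \<Phi> \<longleftrightarrow> continuous_on (SU3 \<times> SU3 \<times> SU3) (\<lambda>(a, b, c). \<Phi> a b c) \<and>
     (\<forall>a\<in>SU3. \<forall>b\<in>SU3. \<forall>c\<in>SU3. \<Phi> a b c \<in> SU3)"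

lemma continuous_on_word:
  assumes "continuous_word \<Phi>" "continuous_on S f" "continuous_on S g" "continuous_on S h"
    "f ` S \<subseteq> SU3" "g ` S \<subseteq> SU3" "h ` S \<subseteq> SU3"
  shows "continuous_on S (\<lambda>x. \<Phi> (f x) (g x) (h x))"
proof -
  have "continuous_on S ((\<lambda>(a, b, c). \<Phi> a b c) \<circ> (\<lambda>x. (f x, g x, h x)))"
  proof (rule continuous_on_compose)
    show "continuous_on S (\<lambda>x. (f x, g x, h x))"
      by (intro continuous_intros assms)
    show "continuous_on ((\<lambda>x. (f x, g x, h x)) ` S) (\<lambda>(a, b, c). \<Phi> a b c)"
      by (rule continuous_on_subset [of "SU3 \<times> SU3 \<times> SU3"]) (use assms in \<open>auto simp: continuous_word_def\<close>)
  qed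
  then show ?thesis by (simp add: o_def)
qed

lemma homotopic_word:
  assumes \<Phi>: "continuous_word \<Phi>"
    and "homotopic_with (\<lambda>h. True) SU3_top SU3_top f f'" "homotopic_with (\<lambda>h. True) SU3_top SU3_top g g'"
      "homotopic_with (\<lambda>h. True) SU3_top SU3_top h h'"
  shows "homotopic_with (\<lambda>h. True) SU3_top SU3_top (\<lambda>B. \<Phi> (f B) (g B) (h B)) (\<lambda>B. \<Phi> (f' B) (g' B) (h' B))"
proof -
  obtain F where F: "continuous_on ({0..1} \<times> SU3) F" "\<And>t B. t \<in> {0..1::real} \<Longrightarrow> B \<in> SU3 \<Longrightarrow> F (t, B) \<in> SU3"
    "\<And>B. F (0, B) = f B" "\<And>B. F (1, B) = f' B"
    using homotopic_SU3_unfold [OF assms(2)] by metis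
  obtain G where G: "continuous_on ({0..1} \<times> SU3) G" "\<And>t B. t \<in> {0..1::real} \<Longrightarrow> B \<in> SU3 \<Longrightarrow> G (t, B) \<in> SU3"
    "\<And>B. G (0, B) = g B" "\<And>B. G (1, B) = g' B"
    using homotopic_SU3_unfold [OF assms(3)] by metis
  obtain H where H: "continuous_on ({0..1} \<times> SU3) H" "\<And>t B. t \<in> {0..1::real} \<Longrightarrow> B \<in> SU3 \<Longrightarrow> H (t, B) \<in> SU3"
    "\<And>B. H (0, B) = h B" "\<And>B. H (1, B) = h' B"
    using homotopic_SU3_unfold [OF assms(4)] by metis
  show ?thesis
  proof (rule homotopic_with_top_of_setI)
    show "continuous_on ({0..1} \<times> SU3) (\<lambda>z. \<Phi> (F z) (G z) (H z))"
      by (rule continuous_on_word [OF \<Phi> F(1) G(1) H(1)]) (use F G H in auto)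
  qed (use F G H \<Phi> in \<open>auto simp: continuous_word_def\<close>)
qed

lemma homotopic_refl_SU3:
  assumes "continuous_on SU3 f" "\<And>B. B \<in> SU3 \<Longrightarrow> f B \<in> SU3"
  shows "homotopic_with (\<lambda>h. True) SU3_top SU3_top f f"
  using assms by auto

section \<open>Deformations of the identity that normalise a column\<close>

definition ramp :: "real \<Rightarrow> real" where "ramp x = max 0 (min 1 (2 + 2 * x))"

lemma ramp: "0 \<le> ramp x" "ramp x \<le> 1" "x \<ge> -1/2 \<Longrightarrow> ramp x = 1" "ramp (-1) = 0"
  by (auto simp: ramp_def)

lemma continuous_on_ramp [continuous_intros]: "continuous_on S f \<Longrightarrow> continuous_on S (\<lambda>x. ramp (f x))"
  unfolding ramp_def by (intro continuous_intros)

text \<open>The transport to a moving target deforms the identity into a map that sends column \<open>c\<close> to the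
  basis vector \<open>c\<close> on more than half of the group; the ramp keeps away from the antipode, where the
  segment between the two columns degenerates.\<close>

definition push :: "3 \<Rightarrow> complex^3^3 \<Rightarrow> complex^3^3" where
  "push c B = transport c B (segment_point (ramp (Re (B$c$c))) (column c B) (axis c 1))"

lemma norm_axis_complex: "norm (axis c 1 :: complex^3) = 1"
  by simp

text \<open>The ramp is 0 at the antipode, so the segment is not followed at all there. The factor
  \<open>r\<close> is the time of the homotopy from the identity to \<open>push\<close>.\<close>

lemma ramp_at_antipode:
  assumes "column c B = - axis c 1" "0 \<le> r" "r \<le> 1"
  shows "r * ramp (Re (B$c$c)) < 1/2"
proof -
  have "B$c$c = -1"
    using arg_cong [OF assms(1), of "\<lambda>v. v $ c"] by (simp add: column_def axis_def)
  then show ?thesis by (simp add: ramp)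
qed

lemma push_homotopic_id:
  "homotopic_with (\<lambda>h. True) SU3_top SU3_top (push c) id"
proof -
  have "homotopic_with (\<lambda>h. True) SU3_top SU3_top id (push c)"
  proof (rule homotopic_with_top_of_setI)
    let ?h = "\<lambda>z. transport c (snd z) (segment_point (fst z * ramp (Re (snd z$c$c))) (column c (snd z)) (axis c 1))"
    have le: "r * ramp x \<le> 1" if "r \<le> 1" "0 \<le> r" for r x
      using that ramp mult_le_one by blast
    show "continuous_on ({0..1} \<times> SU3) ?h"
      by (intro continuous_on_transport_segment continuous_intros) (auto simp: ramp le intro: ramp_at_antipode simp del: less_divide_eq_numeral1)
    show "?h (t, B) \<in> SU3" if "t \<in> {0..1}" "B \<in> SU3" for t B
      unfolding fst_conv snd_conv
      by (rule transport_segment_SU3) (use that in \<open>auto simp: ramp le intro: ramp_at_antipode simp del: less_divide_eq_numeral1\<close>)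
    show "?h (0, B) = id B" if "B \<in> SU3" for B
      using that by (simp add: segment_point_0 SU3_norm_column transport_self)
    show "?h (1, B) = push c B" for B
      by (simp add: push_def)
  qed
  then show ?thesis by (rule homotopic_with_symD)
qed

lemma push_SU3: "B \<in> SU3 \<Longrightarrow> push c B \<in> SU3"
  using homotopic_with_imp_continuous_maps [OF push_homotopic_id [of c]] by auto

lemma continuous_on_push: "continuous_on SU3 (push c)"
  using homotopic_with_imp_continuous_maps [OF push_homotopic_id [of c]] by auto

lemma column_push:
  assumes "B \<in> SU3" "Re (B$c$c) \<ge> -1/2" "c \<noteq> 2"
  shows "column c (push c B) = axis c 1"
proof -
  have r: "ramp (Re (B$c$c)) = 1" using assms by (simp add: ramp)
  have ne: "column c B \<noteq> - axis c 1"
    using ramp_at_antipode [of c B 1] r by auto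
  show ?thesis
    unfolding push_def r
    by (subst column_transport_segment) (use assms ne in \<open>auto simp: segment_point_1\<close>)
qed

text \<open>For \<open>c\<close> other than 2 this is a rotation through \<pi> that reverses the
  entry \<open>B$c$c\<close>; the second sign keeps the determinant equal to 1.\<close>

definition half_turn :: "3 \<Rightarrow> complex^3^3" where
  "half_turn c = (\<chi> i j. if i = j then if i = c \<or> i = 2 then -1 else 1 else 0)"

lemma half_turn_homotopic_id:
  assumes "c \<noteq> 2"
  shows "homotopic_with (\<lambda>h. True) SU3_top SU3_top (\<lambda>B. half_turn c ** B) id"
proof -
  \<comment> \<open>For \<open>c = 3\<close> a cyclic permutation, which moves the plane of
    \<open>rot12\<close> from the first two coordinates to the last two.\<close>
  define P :: "complex^3^3" where "P = (if c = 3 then (\<chi> i j. if i = j + 1 then 1 else 0) else mat 1)"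
  have P: "P \<in> SU3"
  proof (cases "c = 3")
    case True
    then show ?thesis
      unfolding SU3_iff P_def det_3 expand3 conj_transpose_nth by simp
  qed (simp add: P_def)
  have "P ** rot12 pi ** conj_transpose P = half_turn c"
    using assms exhaust_3 [of c]
    by (auto simp: expand3 P_def rot12_def half_turn_def)
  moreover have "P ** rot12 0 ** conj_transpose P = mat 1"
    using P by (simp add: SU3_D)
  ultimately have "homotopic_with (\<lambda>h. True) SU3_top SU3_top id (\<lambda>B. half_turn c ** B)"
    by (intro homotopic_with_top_of_setI [where h = "\<lambda>z. (P ** rot12 (fst z * pi) ** conj_transpose P) ** snd z"])
       (auto intro!: continuous_intros SU3_mult SU3_conj_transpose P rot12_SU3)
  then show ?thesis by (rule homotopic_with_symD)
qed

lemma half_turn_SU3: "c \<noteq> 2 \<Longrightarrow> half_turn c \<in> SU3"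
proof -
  assume "c \<noteq> 2"
  then have "(\<lambda>B. half_turn c ** B) \<in> SU3 \<rightarrow> SU3"
    using homotopic_with_imp_continuous_maps [OF half_turn_homotopic_id] by auto
  then have "half_turn c ** mat 1 \<in> SU3"
    using SU3_mat_1 by (rule funcset_mem)
  then show "half_turn c \<in> SU3" by simp
qed

text \<open>The half turn reverses \<open>B$c$c\<close>, so this variant normalises column
  \<open>c\<close> on the region opposite to that of \<open>push\<close>; the two regions overlap
  and cover the group.\<close>

definition push' :: "3 \<Rightarrow> complex^3^3 \<Rightarrow> complex^3^3" where
  "push' c B = push c (half_turn c ** B)"

lemma push'_homotopic_id:
  assumes "c \<noteq> 2"
  shows "homotopic_with (\<lambda>h. True) SU3_top SU3_top (push' c) id"
proof -
  note h = half_turn_homotopic_id [OF assms]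
  have "homotopic_with (\<lambda>h. True) SU3_top SU3_top (push c \<circ> (\<lambda>B. half_turn c ** B)) (id \<circ> (\<lambda>B. half_turn c ** B))"
    using homotopic_with_imp_continuous_maps [OF h]
    by (intro homotopic_with_compose_continuous_map_right [OF push_homotopic_id]) auto
  from homotopic_with_trans [OF this [unfolded id_comp] h] show ?thesis
    by (simp add: o_def push'_def [abs_def])
qed

lemma push'_SU3: "c \<noteq> 2 \<Longrightarrow> B \<in> SU3 \<Longrightarrow> push' c B \<in> SU3"
  by (simp add: push'_def push_SU3 SU3_mult half_turn_SU3)

lemma continuous_on_push': "c \<noteq> 2 \<Longrightarrow> continuous_on SU3 (push' c)"
  using homotopic_with_imp_continuous_maps [OF push'_homotopic_id [of c]] by auto

lemma half_turn_mult_nth: "(half_turn c ** B) $ i $ j = (if i = c \<or> i = 2 then - B $ i $ j else B $ i $ j)"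
  using exhaust_3 [of i] by (auto simp: matrix_mult_nth half_turn_def sum_3)

lemma column_push':
  assumes "B \<in> SU3" "Re (B$c$c) \<le> 1/2" "c \<noteq> 2"
  shows "column c (push' c B) = axis c 1"
  unfolding push'_def using assms
  by (intro column_push) (auto simp: half_turn_mult_nth half_turn_SU3)

lemma SU3_fixing_axes:
  assumes "B \<in> SU3" "column 1 B = axis 1 1" "column 3 B = axis 3 1"
  shows "B = mat 1"
proof -
  have "B$1$1 = 1" "B$2$1 = 0"
    using assms(2) by (auto simp: vec_eq_iff forall_3 column_def axis_def)
  then show ?thesis
    using SU3_fixing_axis_3 [OF assms(1,3)]
    by (simp add: expand3 SU2_embed_def)
qed

text \<open>For \<open>B\<close> in the stabilizer of the last basis vector the first column has
  third entry 0. Both reflections that carry it to the first basis vector then fix the last one, so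
  the result fixes two basis vectors and must be the identity.\<close>

lemma push_1_eq_1:
  assumes B: "B \<in> SU3" "column 3 B = axis 3 1" and Re: "Re (B$1$1) \<ge> -1/2"
  shows "push 1 B = mat 1"
proof (rule SU3_fixing_axes)
  show "push 1 B \<in> SU3" by (rule push_SU3 [OF B(1)])
  show "column 1 (push 1 B) = axis 1 1" by (rule column_push [OF B(1) Re]) simp
  have r: "ramp (Re (B$1$1)) = 1" using Re by (simp add: ramp)
  have "B$1$3 = 0" "B$2$3 = 0"
    using B(2) by (auto simp: vec_eq_iff forall_3 column_def axis_def)
  then have B31: "B$3$1 = 0"
    using SU3_cofactors(7) [OF B(1)] by simp
  have cr: "creflection k y *v axis 3 1 = axis 3 1" if "y$3 = 0" for k and y :: "complex^3"
    using that by (simp add: creflection_vector herm_def sum_3 axis_def vec_eq_iff)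
  have "carry (column 1 B) (axis 1 1) *v axis 3 1 = axis 3 1"
    unfolding carry_def matrix_vector_mul_assoc [symmetric]
    by (subst cr, simp add: column_def axis_def B31, rule cr, simp add: axis_def)
  then show "column 3 (push 1 B) = axis 3 1"
    unfolding push_def r transport_def segment_point_1 [OF norm_axis_complex]
    by (subst column_mult_scale2, simp, subst column_mult) (simp add: B(2))
qed

lemma push'_1_eq_1:
  assumes B: "B \<in> SU3" "column 3 B = axis 3 1" and Re: "Re (B$1$1) \<le> 1/2"
  shows "push' 1 B = mat 1"
  unfolding push'_def
proof (rule push_1_eq_1)
  show "column 3 (half_turn 1 ** B) = axis 3 1"
    using B(2) by (simp add: vec_eq_iff forall_3 column_def half_turn_mult_nth axis_def)
qed (use assms in \<open>auto simp: half_turn_mult_nth half_turn_SU3\<close>)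

section \<open>Additivity of words in the base and in the fibre\<close>

lemma openin_Collect_less:
  fixes f g :: "'a::topological_space \<Rightarrow> real"
  assumes "continuous_on S f" "continuous_on S g"
  shows "openin (top_of_set S) {x \<in> S. f x < g x}"
proof -
  have "openin (top_of_set S) (S \<inter> (\<lambda>x. g x - f x) -` {0<..})"
    by (rule continuous_openin_preimage_gen) (intro continuous_intros assms, simp)
  moreover have "S \<inter> (\<lambda>x. g x - f x) -` {0<..} = {x \<in> S. f x < g x}" by auto
  ultimately show ?thesis by simp
qed

text \<open>Only the values over the last basis vector are prescribed: composing with
  \<open>push 3\<close> or \<open>push' 3\<close> turns this into triviality over a whole half of
  the group.\<close>

definition stabilizer_trivial :: "(complex^3^3 \<Rightarrow> complex^3^3) \<Rightarrow> bool" where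
  "stabilizer_trivial M \<longleftrightarrow> continuous_on SU3 M \<and> (\<forall>B\<in>SU3. M B \<in> SU3) \<and>
     (\<forall>B\<in>SU3. column 3 B = axis 3 1 \<longrightarrow> M B = mat 1)"

lemma homotopic_compose_id:
  assumes "homotopic_with (\<lambda>h. True) SU3_top SU3_top p id" "continuous_on SU3 M" "\<And>B. B \<in> SU3 \<Longrightarrow> M B \<in> SU3"
  shows "homotopic_with (\<lambda>h. True) SU3_top SU3_top (\<lambda>B. M (p B)) M"
  using homotopic_with_compose_continuous_map_left [OF assms(1), of SU3_top M "\<lambda>h. True"] assms(2,3)
  by (simp add: o_def Pi_iff)

lemma homotopic_to_chain_map:
  assumes "homotopic_with (\<lambda>h. True) SU3_top SU3_top f g" "singular_relcycle p SU3_top {} c"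
  shows "singular_relboundary p SU3_top {} (chain_map p f c - chain_map p g c)"
  using chain_map_cong_boundary [OF assms] by (simp add: homologous_rel_def)

lemma word_continuous_map:
  assumes "continuous_word \<Phi>" "homotopic_with (\<lambda>h. True) SU3_top SU3_top f f"
    "homotopic_with (\<lambda>h. True) SU3_top SU3_top g g" "homotopic_with (\<lambda>h. True) SU3_top SU3_top h h"
  shows "continuous_map SU3_top SU3_top (\<lambda>B. \<Phi> (f B) (g B) (h B))"
  using homotopic_with_imp_continuous_maps [OF homotopic_word [OF assms]] by simp

text \<open>Deform the two factors so that they become trivial over the two halves of the five-sphere of last columns.\<close>

lemma word_base_additive:
  assumes \<Phi>: "continuous_word \<Phi>" and M: "stabilizer_trivial M" and M': "stabilizer_trivial M'"
    and c: "singular_relcycle p SU3_top {} c"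
  shows "homologous_rel p SU3_top {}
    (chain_map p (\<lambda>B. \<Phi> (M B) (M' B) B) c + chain_map p (\<lambda>B. \<Phi> (mat 1) (mat 1) B) c)
    (chain_map p (\<lambda>B. \<Phi> (M B) (mat 1) B) c + chain_map p (\<lambda>B. \<Phi> (mat 1) (M' B) B) c)"
proof -
  let ?hom = "homotopic_with (\<lambda>h. True) SU3_top SU3_top"
  let ?M = "\<lambda>B. M (push 3 B)" and ?M' = "\<lambda>B. M' (push' 3 B)"
  have hM: "?hom ?M M" and hM': "?hom ?M' M'"
    using M M' unfolding stabilizer_trivial_def
    by (auto intro!: homotopic_compose_id push_homotopic_id push'_homotopic_id)
  have h1: "?hom (\<lambda>B. mat 1) (\<lambda>B. mat 1)" and hid: "?hom (\<lambda>B. B) (\<lambda>B. B)"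
    by (auto intro!: homotopic_refl_SU3)
  have refl: "?hom ?M ?M" "?hom ?M' ?M'"
    using hM hM' homotopic_with_imp_continuous_maps homotopic_with_refl by (metis (no_types, lifting))+
  have "homologous_rel p SU3_top {}
    (chain_map p (\<lambda>B. \<Phi> (?M B) (?M' B) B) c + chain_map p (\<lambda>B. \<Phi> (mat 1) (mat 1) B) c)
    (chain_map p (\<lambda>B. \<Phi> (?M B) (mat 1) B) c + chain_map p (\<lambda>B. \<Phi> (mat 1) (?M' B) B) c)"
  proof (rule cut_and_paste4 [OF _ _ _ _ _ _ _ _ _ c])
    \<comment> \<open>\<open>push 3\<close> works on the first region and \<open>push' 3\<close> on
      the second; the thresholds overlap, so these open sets cover the group.\<close>
    let ?A = "{B\<in>SU3. - 1/2 < Re (B$3$3)}" and ?B = "{B\<in>SU3. Re (B$3$3) < 1/2}"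
    show "openin SU3_top ?A" "openin SU3_top ?B"
      by (rule openin_Collect_less; intro continuous_intros)+
    show "topspace SU3_top \<subseteq> ?A \<union> ?B" by auto
    show "\<Phi> (?M B) (?M' B) B = \<Phi> (mat 1) (?M' B) B \<and> \<Phi> (?M B) (mat 1) B = \<Phi> (mat 1) (mat 1) B"
      if "B \<in> ?A" for B
    proof -
      have "?M B = mat 1"
        using that M column_push [of B 3] push_SU3 by (auto simp: stabilizer_trivial_def)
      then show ?thesis by simp
    qed
    show "\<Phi> (?M B) (?M' B) B = \<Phi> (?M B) (mat 1) B \<and> \<Phi> (mat 1) (?M' B) B = \<Phi> (mat 1) (mat 1) B"
      if "B \<in> ?B" for B
    proof -
      have "?M' B = mat 1"
        using that M' column_push' [of B 3] push'_SU3 [of 3] by (auto simp: stabilizer_trivial_def)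
      then show ?thesis by simp
    qed
  qed (rule word_continuous_map [OF \<Phi>]; (rule refl h1 hid))+
  then have 0: "singular_relboundary p SU3_top {}
    (chain_map p (\<lambda>B. \<Phi> (?M B) (?M' B) B) c + chain_map p (\<lambda>B. \<Phi> (mat 1) (mat 1) B) c -
    (chain_map p (\<lambda>B. \<Phi> (?M B) (mat 1) B) c + chain_map p (\<lambda>B. \<Phi> (mat 1) (?M' B) B) c))"
    by (simp add: homologous_rel_def)
  \<comment> \<open>It remains to undo the deformations in the three terms that contain
    \<open>M\<close> or \<open>M'\<close>.\<close>
  note 1 = homotopic_to_chain_map [OF homotopic_word [OF \<Phi> hM hM' hid] c]
  note 2 = homotopic_to_chain_map [OF homotopic_word [OF \<Phi> hM h1 hid] c]
  note 3 = homotopic_to_chain_map [OF homotopic_word [OF \<Phi> h1 hM' hid] c]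
  show ?thesis
    unfolding homologous_rel_def
    using singular_relboundary_add [OF singular_relboundary_diff [OF 0 1] singular_relboundary_add [OF 2 3]]
    by (simp add: algebra_simps)
qed

text \<open>Over one half of the five-sphere of last columns deform the second and third letters into
  the stabilizer of the last basis vector, and then make them trivial over the two halves of this
  three-sphere.\<close>

lemma word_fibre_additive:
  assumes \<Phi>: "continuous_word \<Phi>" and M: "stabilizer_trivial M"
    and c: "singular_relcycle p SU3_top {} c"
  shows "homologous_rel p SU3_top {}
    (chain_map p (\<lambda>B. \<Phi> (M B) B B) c + chain_map p (\<lambda>B. \<Phi> (M B) (mat 1) (mat 1)) c +
     chain_map p (\<lambda>B. \<Phi> (mat 1) (mat 1) B) c + chain_map p (\<lambda>B. \<Phi> (mat 1) B (mat 1)) c)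
    (chain_map p (\<lambda>B. \<Phi> (M B) (mat 1) B) c + chain_map p (\<lambda>B. \<Phi> (M B) B (mat 1)) c +
     chain_map p (\<lambda>B. \<Phi> (mat 1) B B) c + chain_map p (\<lambda>B. \<Phi> (mat 1) (mat 1) (mat 1)) c)"
proof -
  let ?hom = "homotopic_with (\<lambda>h. True) SU3_top SU3_top"
  \<comment> \<open>For the second and third letters \<open>push' 3\<close> first brings the last
    column to the basis vector where \<open>Re (B$3$3) < 1/2\<close>; then \<open>push 1\<close> and
    \<open>push' 1\<close> act within the stabilizer, each making it trivial on one region of the
    three-sphere.\<close>
  let ?M = "\<lambda>B. M (push 3 B)" and ?a = "\<lambda>B. push 1 (push' 3 B)" and ?b = "\<lambda>B. push' 1 (push' 3 B)"
  let ?I = "\<lambda>B::complex^3^3. mat 1 :: complex^3^3" and ?id = "\<lambda>B::complex^3^3. B"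
  have n2: "(3::3) \<noteq> 2" "(1::3) \<noteq> 2" by simp_all
  have hM: "?hom ?M M"
    using M unfolding stabilizer_trivial_def by (auto intro!: homotopic_compose_id push_homotopic_id)
  have ha: "?hom ?a ?id" and hb: "?hom ?b ?id"
    using homotopic_with_trans [OF homotopic_compose_id [OF push'_homotopic_id [OF n2(1)] continuous_on_push] push_homotopic_id]
      homotopic_with_trans [OF homotopic_compose_id [OF push'_homotopic_id [OF n2(1)] continuous_on_push' [OF n2(2)]]
         push'_homotopic_id [OF n2(2)]] push_SU3 push'_SU3 [OF n2(2)]
    unfolding id_def by blast+
  have h1: "?hom ?I ?I"
    by (auto intro!: homotopic_refl_SU3)
  have refl: "?hom ?M ?M" "?hom ?a ?a" "?hom ?b ?b"
    using hM ha hb homotopic_with_imp_continuous_maps homotopic_with_refl by (metis (no_types, lifting))+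
  have sel: "?hom (\<lambda>B. if P then f B else mat 1) (\<lambda>B. if P then f B else mat 1)" if "?hom f f" for P f
    using that h1 by (cases P) simp_all
  \<comment> \<open>In binary, digit 4 of \<open>i\<close> replaces \<open>M\<close> by the
    identity, digit 1 the second letter and digit 2 the third, matching the cube in
    \<open>cut_and_paste8\<close>.\<close>
  define W where "W i = (\<lambda>B. \<Phi> (if i < 4 then ?M B else mat 1) (if even i then ?a B else mat 1)
     (if i = 0 \<or> i = 1 \<or> i = 4 \<or> i = 5 then ?b B else mat 1))" for i :: nat
  have W: "W 0 = (\<lambda>B. \<Phi> (?M B) (?a B) (?b B))" "W 1 = (\<lambda>B. \<Phi> (?M B) (mat 1) (?b B))"
    "W 2 = (\<lambda>B. \<Phi> (?M B) (?a B) (mat 1))" "W 3 = (\<lambda>B. \<Phi> (?M B) (mat 1) (mat 1))"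
    "W 4 = (\<lambda>B. \<Phi> (mat 1) (?a B) (?b B))" "W 5 = (\<lambda>B. \<Phi> (mat 1) (mat 1) (?b B))"
    "W 6 = (\<lambda>B. \<Phi> (mat 1) (?a B) (mat 1))" "W 7 = (\<lambda>B. \<Phi> (mat 1) (mat 1) (mat 1))"
    by (simp_all add: W_def)
  have p3: "push' 3 B \<in> SU3" "Re (B$3$3) < 1/2 \<Longrightarrow> column 3 (push' 3 B) = axis 3 1" if "B \<in> SU3" for B
    using that push'_SU3 [OF n2(1)] column_push' [of B 3] by auto
  \<comment> \<open>\<open>M\<close> is trivial on the first set. The other two share the remaining
    part of the base and split it by the first diagonal entry after \<open>push' 3\<close>; on them
    the second and the third letter, respectively, are trivial.\<close>
  let ?A = "{B\<in>SU3. - 1/2 < Re (B$3$3)}"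
  let ?B = "{B\<in>SU3. Re (B$3$3) < 1/2} \<inter> {B\<in>SU3. - 1/2 < Re (push' 3 B$1$1)}"
  let ?C = "{B\<in>SU3. Re (B$3$3) < 1/2} \<inter> {B\<in>SU3. Re (push' 3 B$1$1) < 1/2}"
  have "homologous_rel p SU3_top {}
     (chain_map p (W 0) c + chain_map p (W 3) c + chain_map p (W 5) c + chain_map p (W 6) c)
     (chain_map p (W 1) c + chain_map p (W 2) c + chain_map p (W 4) c + chain_map p (W 7) c)"
  proof (rule cut_and_paste8 [OF _ _ _ _ _ _ _ _ c])
    show "continuous_map SU3_top SU3_top (W i)" if "i < 8" for i
    proof -
      have "?hom (\<lambda>B. if i < 4 then ?M B else mat 1) (\<lambda>B. if i < 4 then ?M B else mat 1)"
        "?hom (\<lambda>B. if even i then ?a B else mat 1) (\<lambda>B. if even i then ?a B else mat 1)"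
        "?hom (\<lambda>B. if i = 0 \<or> i = 1 \<or> i = 4 \<or> i = 5 then ?b B else mat 1) (\<lambda>B. if i = 0 \<or> i = 1 \<or> i = 4 \<or> i = 5 then ?b B else mat 1)"
        by (rule sel refl)+
      then show ?thesis unfolding W_def by (rule word_continuous_map [OF \<Phi>])
    qed
    show "openin SU3_top ?A" "openin SU3_top ?B" "openin SU3_top ?C"
      by ((intro openin_Int)?; rule openin_Collect_less; intro continuous_intros continuous_on_push' n2)+
    show "topspace SU3_top \<subseteq> ?A \<union> ?B \<union> ?C" by auto
  next
    fix B assume "B \<in> ?A"
    then have "?M B = mat 1"
      using M column_push [of B 3] push_SU3 by (auto simp: stabilizer_trivial_def)
    then show "W 0 B = W 4 B \<and> W 1 B = W 5 B \<and> W 2 B = W 6 B \<and> W 3 B = W 7 B"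
      unfolding W by simp
  next
    fix B assume "B \<in> ?B"
    then have "?a B = mat 1" by (intro push_1_eq_1 p3) auto
    then show "W 0 B = W 1 B \<and> W 2 B = W 3 B \<and> W 4 B = W 5 B \<and> W 6 B = W 7 B"
      unfolding W by simp
  next
    fix B assume "B \<in> ?C"
    then have "?b B = mat 1" by (intro push'_1_eq_1 p3) auto
    then show "W 0 B = W 2 B \<and> W 1 B = W 3 B \<and> W 4 B = W 6 B \<and> W 5 B = W 7 B"
      unfolding W by simp
  qed
  then have 0: "singular_relboundary p SU3_top {}
     (chain_map p (W 0) c + chain_map p (W 3) c + chain_map p (W 5) c + chain_map p (W 6) c -
     (chain_map p (W 1) c + chain_map p (W 2) c + chain_map p (W 4) c + chain_map p (W 7) c))"
    by (simp add: homologous_rel_def)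
  note e = homotopic_to_chain_map [OF homotopic_word [OF \<Phi>] c]
  note 1 = singular_relboundary_add [OF singular_relboundary_add [OF e [OF hM ha hb] e [OF hM h1 h1]]
      singular_relboundary_add [OF e [OF h1 h1 hb] e [OF h1 ha h1]]]
  note 2 = singular_relboundary_add [OF singular_relboundary_add [OF e [OF hM h1 hb] e [OF hM ha h1]] e [OF h1 ha hb]]
  show ?thesis
    unfolding homologous_rel_def
    using singular_relboundary_add [OF singular_relboundary_diff [OF 0 [unfolded W] 1] 2]
    by (simp add: algebra_simps)
qed

section \<open>Degrees of the twisted powers and of the squaring map\<close>

abbreviation quarter_turn :: "complex^3^3" where "quarter_turn \<equiv> rot12 (pi/2)"

lemma conj_transpose_rot12: "conj_transpose (rot12 t) = transpose (rot12 t)"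
  by (simp add: vec_eq_iff rot12_def transpose_def)

definition twist :: "complex^3^3 \<Rightarrow> complex^3^3" where
  "twist B = B ** quarter_turn ** transpose B ** transpose quarter_turn"

abbreviation twist_inv :: "complex^3^3 \<Rightarrow> complex^3^3" where
  "twist_inv B \<equiv> conj_transpose (twist B)"

definition twist_of_column :: "complex^3 \<Rightarrow> complex^3^3" where
  "twist_of_column v = (\<chi> i j. v $ i * v $ j + skew_matrix (\<chi> i. cnj (v $ i)) $ i $ j) ** transpose quarter_turn"

text \<open>Write \<open>b1\<close>, \<open>b2\<close>, \<open>b3\<close> for the columns. Then
  \<open>B J B^t\<close> is \<open>b3 b3^t + b2 b1^t - b1 b2^t\<close>. The skew part is the cross
  product matrix of \<open>b1 \<times> b2\<close>, which by the cofactor formulas is the conjugate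
  of \<open>b3\<close>.\<close>

lemma twist_eq_twist_of_column:
  assumes "B \<in> SU3"
  shows "twist B = twist_of_column (column 3 B)"
proof -
  have "B ** quarter_turn ** transpose B =
    (\<chi> i j. column 3 B $ i * column 3 B $ j + skew_matrix (\<chi> i. cnj (column 3 B $ i)) $ i $ j)"
    unfolding expand3 skew_matrix_def column_def transpose_def rot12_def vec_lambda_beta SU3_cofactors [OF assms]
    by (simp add: algebra_simps)
  then show ?thesis by (simp add: twist_def twist_of_column_def)
qed

lemma twist_SU3 [intro]: "B \<in> SU3 \<Longrightarrow> twist B \<in> SU3"
  unfolding twist_def by (intro SU3_mult SU3_transpose rot12_SU3)

lemma continuous_on_twist [continuous_intros]:
  assumes "continuous_on S f"
  shows "continuous_on S (\<lambda>x. twist (f x))"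
  unfolding twist_def by (intro continuous_intros assms)

lemma transpose_mat_1: "transpose (mat 1 :: complex^3^3) = mat 1"
  by (simp add: expand3 transpose_def)

lemma twist_mat_1: "twist (mat 1) = mat 1"
  using SU3_D(1) [OF rot12_SU3 [of "pi/2"]] by (simp add: twist_def transpose_mat_1 conj_transpose_rot12)

lemma stabilizer_trivial_twist: "stabilizer_trivial twist"
proof -
  have "twist B = mat 1" if "B \<in> SU3" "column 3 B = axis 3 1" for B
  proof -
    have "column 3 (mat 1 :: complex^3^3) = axis 3 1"
      by (simp add: vec_eq_iff column_def axis_def mat_1_nth)
    then show ?thesis
      using twist_eq_twist_of_column [OF that(1)] twist_eq_twist_of_column [OF SU3_mat_1] twist_mat_1 that(2) by simp
  qed
  then show ?thesis
    by (auto simp: stabilizer_trivial_def intro!: continuous_intros)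
qed

lemma stabilizer_trivial_twist_inv: "stabilizer_trivial twist_inv"
  using stabilizer_trivial_twist
  by (auto simp: stabilizer_trivial_def intro!: continuous_intros)

lemma continuous_on_of_coords: "continuous_on S of_coords"
proof -
  have eq: "of_coords = (\<lambda>f. \<chi> i. if i = 1 then of_real (f 5) + \<i> * of_real (f 2)
      else if i = 2 then of_real (f 4) + \<i> * of_real (f 1) else of_real (f 3) + \<i> * of_real (f 0))"
    by (simp add: fun_eq_iff of_coords_def vec_eq_iff complex_eq_iff)
  have co: "continuous_on S (\<lambda>x::nat\<Rightarrow>real. x i)" for i
    by (rule continuous_on_subset [OF continuous_on_product_coordinates subset_UNIV])
  show ?thesis
    unfolding eq by (intro continuous_on_vec_lambda continuous_on_if_const continuous_intros co)
qed

text \<open>The twist factors through the five-sphere of last columns, which has no eighth homology.\<close>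

lemma twist_factor_boundary:
  assumes K: "continuous_map SU3_top SU3_top K" and c: "singular_relcycle 8 SU3_top {} c"
  shows "singular_relboundary 8 SU3_top {} (chain_map 8 (\<lambda>B. K (twist B)) c)"
proof -
  define f where "f B = (\<lambda>k. if k < 6 then real_coord k (column 3 B) else 0)" for B :: "complex^3^3"
  define g where "g x = K (twist_of_column (of_coords x))" for x
  have "continuous_on SU3 f"
  proof (rule continuous_on_coordinatewise_then_product)
    show "continuous_on SU3 (\<lambda>x. f x i)" for i
      unfolding f_def by (intro continuous_on_if_const continuous_intros)
  qed
  moreover have "(\<Sum>i\<le>5. (f B i)\<^sup>2) = 1 \<and> (\<forall>i>5. f B i = 0)" if "B \<in> SU3" for B
  proof -
    have "(\<Sum>i\<le>5. (f B i)\<^sup>2) = (\<Sum>i\<le>5. (real_coord i (column 3 B))\<^sup>2)"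
      by (intro sum.cong) (auto simp: f_def)
    then show ?thesis
      using that by (simp add: SU3_norm_column f_def flip: norm_real_coord)
  qed
  ultimately have f: "continuous_map SU3_top (nsphere 5) f"
    by (auto simp: nsphere_eq_top_of_set)
  have mem: "twist_of_column (of_coords x) \<in> SU3" if "(\<Sum>i\<le>5. (x i)\<^sup>2) = 1" for x
  proof -
    have "(norm (of_coords x))\<^sup>2 = (\<Sum>i\<le>5. (x i)\<^sup>2)"
      unfolding norm_real_coord by (intro sum.cong) (auto simp: real_coord_of_coords)
    then have "norm (of_coords x) = 1"
      using that by (metis norm_ge_zero one_power2 power2_eq_imp_eq zero_le_one)
    \<comment> \<open>Every unit vector is the last column of some group element, and the formula
      for the twist then takes its value in the group.\<close>
    then obtain M where "M \<in> SU3" "column 3 M = of_coords x"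
      by (rule SU3_transitive)
    then show ?thesis
      using twist_eq_twist_of_column [of M] twist_SU3 [of M] by simp
  qed
  have "continuous_on S (\<lambda>x. twist_of_column (of_coords x))" for S
    unfolding twist_of_column_def by (intro continuous_intros continuous_on_of_coords)
  then have "continuous_map (nsphere 5) SU3_top (\<lambda>x. twist_of_column (of_coords x))"
    using mem by (auto simp: nsphere_eq_top_of_set)
  from continuous_map_compose [OF this K] have g: "continuous_map (nsphere 5) SU3_top g"
    by (simp add: g_def [abs_def] o_def)
  have "acyclic_in 8 (nsphere 5)" by (intro acyclic_in_nsphere) auto
  from factor_through_acyclic [OF this f g c]
  have "singular_relboundary 8 SU3_top {} (chain_map 8 (g \<circ> f) c)" .
  moreover have "chain_map 8 (g \<circ> f) c = chain_map 8 (\<lambda>B. K (twist B)) c"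
  proof (rule chain_map_eq)
    show "singular_chain 8 SU3_top c" using c by (simp add: singular_cycle)
    fix B assume "B \<in> topspace SU3_top"
    then have B: "B \<in> SU3" by simp
    have "of_coords (f B) = column 3 B"
      by (rule real_coord_eqI) (simp add: real_coord_of_coords f_def)
    then show "(g \<circ> f) B = K (twist B)"
      using B by (simp add: g_def twist_eq_twist_of_column)
  qed
  ultimately show ?thesis by simp
qed

definition twisted_cnj :: "complex^3^3 \<Rightarrow> complex^3^3" where
  "twisted_cnj B = quarter_turn ** cnj_matrix B ** transpose quarter_turn"

text \<open>The inverse of the twist is \<open>J cnj(B) J^t\<close> times the inverse of
  \<open>B\<close>, and the last factor cancels. A product with a twist is thereby identified with a
  group automorphism.\<close>

lemma twist_inv_mult:
  assumes "B \<in> SU3"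
  shows "twist_inv B ** B = twisted_cnj B"
proof -
  have "conj_transpose (transpose quarter_turn) = quarter_turn"
    by (metis conj_transpose_conj_transpose conj_transpose_rot12)
  moreover have "conj_transpose (transpose B) = cnj_matrix B"
    by (simp add: vec_eq_iff transpose_def)
  ultimately have "twist_inv B = quarter_turn ** (cnj_matrix B ** (transpose quarter_turn ** conj_transpose B))"
    unfolding twist_def conj_transpose_mult by (simp add: conj_transpose_rot12)
  then show ?thesis
    using SU3_D(2) [OF assms]
    by (simp add: twisted_cnj_def flip: matrix_mul_assoc)
qed

lemma twisted_cnj_mult:
  assumes "A \<in> SU3"
  shows "twisted_cnj (A ** B) = twisted_cnj A ** twisted_cnj B"
proof -
  have "transpose quarter_turn ** (quarter_turn ** X) = X" for X :: "complex^3^3"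
    using SU3_cancel(1) [OF rot12_SU3, of "pi/2" X] by (simp add: conj_transpose_rot12)
  then show ?thesis
    by (simp add: twisted_cnj_def cnj_matrix_mult flip: matrix_mul_assoc)
qed

text \<open>Letting the angle of the rotation shrink to 0 deforms the map to plain complex
  conjugation.\<close>

lemma twisted_cnj_chain:
  assumes c: "singular_relcycle 8 SU3_top {} c"
  shows "singular_relboundary 8 SU3_top {} (chain_map 8 twisted_cnj c + c)"
proof -
  have "homotopic_with (\<lambda>h. True) SU3_top SU3_top cnj_matrix twisted_cnj"
  proof (rule homotopic_with_top_of_setI)
    let ?h = "\<lambda>z. rot12 (fst z * (pi/2)) ** cnj_matrix (snd z) ** transpose (rot12 (fst z * (pi/2)))"
    show "continuous_on ({0..1} \<times> SU3) ?h" by (intro continuous_intros)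
    show "?h (t, B) \<in> SU3" if "B \<in> SU3" for t B
      unfolding fst_conv snd_conv by (intro SU3_mult SU3_transpose rot12_SU3 SU3_cnj_matrix that)
    show "?h (0, B) = cnj_matrix B" for B by (simp add: transpose_mat_1)
    show "?h (1, B) = twisted_cnj B" for B by (simp add: twisted_cnj_def)
  qed
  from homotopic_to_chain_map [OF this c] cnj_matrix_chain_SU3 [OF c]
  have "singular_relboundary 8 SU3_top {} ((chain_map 8 cnj_matrix c - - c) - (chain_map 8 cnj_matrix c - chain_map 8 twisted_cnj c))"
    unfolding homologous_rel_def by (metis singular_relboundary_diff)
  then show ?thesis by (simp add: algebra_simps)
qed

lemma chain_map_cong_SU3:
  assumes "singular_relcycle p SU3_top {} c" "\<And>B. B \<in> SU3 \<Longrightarrow> f B = g B"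
  shows "chain_map p f c = chain_map p g c"
  by (rule chain_map_eq [of p SU3_top]) (use assms in \<open>auto simp: singular_cycle\<close>)

lemma twist_inv_chain:
  assumes c: "singular_relcycle 8 SU3_top {} c"
  shows "singular_relboundary 8 SU3_top {} (chain_map 8 (\<lambda>B. twist_inv B ** B) c + c)"
  using twisted_cnj_chain [OF c] chain_map_cong_SU3 [OF c, of "\<lambda>B. twist_inv B ** B" twisted_cnj]
  by (simp add: twist_inv_mult)

lemma chain_map_identity:
  assumes "singular_relcycle p SU3_top {} c"
  shows "chain_map p (\<lambda>B. B) c = c"
  by (rule chain_map_id_gen [of p SU3_top]) (use assms in \<open>auto simp: singular_cycle\<close>)

lemma chain_map_chain_map: "chain_map p g (chain_map p f c) = chain_map p (\<lambda>x. g (f x)) c"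
  using fun_cong [OF chain_map_compose [of p g f], of c] by (simp add: o_def)

lemma continuous_wordI:
  assumes "continuous_on (SU3 \<times> SU3 \<times> SU3) (\<lambda>z. \<Phi> (fst z) (fst (snd z)) (snd (snd z)))"
    "\<And>a b c. a \<in> SU3 \<Longrightarrow> b \<in> SU3 \<Longrightarrow> c \<in> SU3 \<Longrightarrow> \<Phi> a b c \<in> SU3"
  shows "continuous_word \<Phi>"
  using assms by (auto simp: continuous_word_def case_prod_beta)

text \<open>A constant map trivially factors through the twist.\<close>

lemma boundary_const:
  assumes "A \<in> SU3" "singular_relcycle 8 SU3_top {} c"
  shows "singular_relboundary 8 SU3_top {} (chain_map 8 (\<lambda>B. A) c)"
  using twist_factor_boundary [of "\<lambda>B. A", OF _ assms(2)] assms(1) by simp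

abbreviation bounds :: "(complex^3^3) chain \<Rightarrow> bool" where
  "bounds \<equiv> singular_relboundary 8 SU3_top {}"

section \<open>Powers of the twist\<close>

primrec matrix_pow :: "complex^'n^'n \<Rightarrow> nat \<Rightarrow> complex^'n^'n" where
  "matrix_pow A 0 = mat 1"
| "matrix_pow A (Suc n) = A ** matrix_pow A n"

lemma matrix_pow_SU3: "A \<in> SU3 \<Longrightarrow> matrix_pow A n \<in> SU3"
  by (induction n) auto

lemma matrix_pow_mat_1 [simp]: "matrix_pow (mat 1) n = mat 1"
  by (induction n) auto

lemma continuous_on_matrix_pow [continuous_intros]:
  fixes f :: "'a::topological_space \<Rightarrow> complex^'n^'n"
  assumes "continuous_on S f"
  shows "continuous_on S (\<lambda>x. matrix_pow (f x) n)"
  by (induction n) (auto intro!: continuous_intros assms)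

lemma stabilizer_trivial_matrix_pow:
  "stabilizer_trivial M \<Longrightarrow> stabilizer_trivial (\<lambda>B. matrix_pow (M B) n)"
  by (auto simp: stabilizer_trivial_def intro!: continuous_intros matrix_pow_SU3)

lemma left_factors_additive:
  assumes M: "stabilizer_trivial M" "stabilizer_trivial M'" and c: "singular_relcycle 8 SU3_top {} c"
  shows "bounds (chain_map 8 (\<lambda>B. M B ** M' B ** B) c + c
    - (chain_map 8 (\<lambda>B. M B ** B) c + chain_map 8 (\<lambda>B. M' B ** B) c))"
proof -
  have "continuous_word (\<lambda>a b c. a ** b ** c)"
    by (intro continuous_wordI continuous_intros) auto
  from word_base_additive [OF this M c] show ?thesis
    by (simp add: homologous_rel_def chain_map_identity [OF c])
qed

text \<open>If the degree of \<open>B \<mapsto> M(B) B\<close> is written as \<open>1 + d\<close>,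
  additivity of left factors says that the increments \<open>d\<close> add up.\<close>

lemma matrix_pow_left_chain:
  assumes M: "stabilizer_trivial M" and c: "singular_relcycle 8 SU3_top {} c"
    and d: "bounds (chain_map 8 (\<lambda>B. M B ** B) c - frag_cmul (1 + d) c)"
  shows "bounds (chain_map 8 (\<lambda>B. matrix_pow (M B) n ** B) c - frag_cmul (1 + int n * d) c)"
proof (induction n)
  case 0
  then show ?case by (simp add: chain_map_identity [OF c])
next
  case (Suc n)
  note 1 = left_factors_additive [OF M stabilizer_trivial_matrix_pow [OF M, of n] c]
  from singular_relboundary_add [OF 1 singular_relboundary_add [OF d Suc]]
  show ?case
    by (simp add: algebra_simps frag_cmul_distrib)
qed

lemma twist_inv_pow_chain:
  assumes c: "singular_relcycle 8 SU3_top {} c"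
  shows "bounds (chain_map 8 (\<lambda>B. matrix_pow (twist_inv B) n ** B) c - frag_cmul (1 - 2 * int n) c)"
  using matrix_pow_left_chain [OF stabilizer_trivial_twist_inv c, of "-2" n] twist_inv_chain [OF c]
  by (simp add: algebra_simps)

text \<open>The twist and its inverse cancel, so additivity says that the degrees with left factor
  the twist and its inverse have sum \<open>1 + 1\<close>; the latter degree is
  \<open>-1\<close>.\<close>

lemma twist_chain:
  assumes c: "singular_relcycle 8 SU3_top {} c"
  shows "bounds (chain_map 8 (\<lambda>B. twist B ** B) c - frag_cmul 3 c)"
proof -
  have "chain_map 8 (\<lambda>B. twist B ** twist_inv B ** B) c = chain_map 8 (\<lambda>B. B) c"
    by (rule chain_map_cong_SU3 [OF c]) (simp add: SU3_D twist_SU3)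
  then have e: "chain_map 8 (\<lambda>B. twist B ** twist_inv B ** B) c = c"
    by (simp add: chain_map_identity [OF c])
  have 3: "frag_cmul 3 c = c + c + c"
    using frag_cmul_distrib [of 1 2 c] frag_cmul_distrib [of 1 1 c] by (simp add: add.assoc)
  from left_factors_additive [OF stabilizer_trivial_twist stabilizer_trivial_twist_inv c, unfolded e]
  have "bounds (- (c + c - (chain_map 8 (\<lambda>B. twist B ** B) c + chain_map 8 (\<lambda>B. twist_inv B ** B) c)))"
    by (simp only: singular_relboundary_minus)
  from singular_relboundary_diff [OF this twist_inv_chain [OF c]]
  show ?thesis unfolding 3 by (simp add: algebra_simps)
qed

lemma twist_pow_chain:
  assumes c: "singular_relcycle 8 SU3_top {} c"
  shows "bounds (chain_map 8 (\<lambda>B. matrix_pow (twist B) n ** B) c - frag_cmul (1 + 2 * int n) c)"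
  using matrix_pow_left_chain [OF stabilizer_trivial_twist c, of "2" n] twist_chain [OF c]
  by (simp add: algebra_simps)

text \<open>Let \<open>S\<close> denote the degree of squaring. With
  \<open>deg (M B) = deg (B M) = -1\<close>, fibre additivity gives \<open>S - 4\<close> for both
  \<open>M B B\<close> and \<open>B M B\<close>. Base additivity then gives
  \<open>2 (S - 4) - S = S - 8\<close> for \<open>M B M B\<close>, whose degree is also
  \<open>- S\<close>.\<close>

lemma square_chain:
  assumes c: "singular_relcycle 8 SU3_top {} c"
  shows "bounds (chain_map 8 (\<lambda>B. B ** B) c - frag_cmul 4 c)"
proof -
  define M where "M = (\<lambda>B. twist_inv B)"
  have M: "stabilizer_trivial M" unfolding M_def by (rule stabilizer_trivial_twist_inv)
  have MSU: "M B \<in> SU3" if "B \<in> SU3" for B using that by (auto simp: M_def)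
  have contM: "continuous_on S (\<lambda>x. M (f x))" if "continuous_on S f" for S and f :: "'z::topological_space \<Rightarrow> _"
    unfolding M_def by (intro continuous_intros that)
  have M1: "M (mat 1) = mat 1" by (simp add: M_def twist_mat_1)
  \<comment> \<open>The commutator. It is trivial as soon as one of its letters is, which collapses
    most terms of the additivity relations.\<close>
  define K where "K = (\<lambda>a b :: complex^3^3. a ** b ** conj_transpose a ** conj_transpose b)"
  have K1: "K (mat 1) b = mat 1" "K b (mat 1) = mat 1" if "b \<in> SU3" for b
    using that by (simp_all add: K_def SU3_D)
  have KSU: "K a b \<in> SU3" if "a \<in> SU3" "b \<in> SU3" for a b
    unfolding K_def by (intro SU3_mult SU3_conj_transpose that)
  have contK: "continuous_on S (\<lambda>x. K (f x) (g x))" if "continuous_on S f" "continuous_on S g"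
    for S and f g :: "'z::topological_space \<Rightarrow> _"
    unfolding K_def by (intro continuous_intros that)
  let ?cm = "chain_map 8"
  note id = chain_map_identity [OF c]
  note cong = chain_map_cong_SU3 [OF c]
  define C where "C = (\<lambda>B. K (M B) B)"
  have contC: "continuous_map SU3_top SU3_top C"
  proof -
    have "continuous_on SU3 C" unfolding C_def by (intro contK contM continuous_intros)
    moreover have "C B \<in> SU3" if "B \<in> SU3" for B unfolding C_def by (intro KSU MSU that)
    ultimately show ?thesis by auto
  qed
  define one where "one = ?cm (\<lambda>B. mat 1 :: complex^3^3) c"
  have one: "bounds one" unfolding one_def by (intro boundary_const c SU3_mat_1)
  have Mb: "bounds (?cm M c)"
  proof -
    have "continuous_map SU3_top SU3_top conj_transpose" by (auto intro!: continuous_intros)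
    then show ?thesis unfolding M_def by (rule twist_factor_boundary [OF _ c])
  qed
  have MB: "bounds (?cm (\<lambda>B. M B ** B) c + c)"
    unfolding M_def by (rule twist_inv_chain [OF c])
  have cC: "singular_relcycle 8 SU3_top {} (?cm C c)"
    using singular_relcycle_chain_map [OF c contC] by simp
  have C0: "bounds (?cm C c)"
    \<comment> \<open>The conjugate of \<open>C\<close> is \<open>M(C) C\<close> up to conjugation. By additivity it has the degree of \<open>C\<close>, since
      \<open>M \<circ> C\<close> factors through the five-sphere; but it also has minus that degree.\<close>
  proof -
    have W: "continuous_word (\<lambda>a b c. M (K a c) ** K b c)"
      by (intro continuous_wordI contM contK continuous_intros SU3_mult KSU MSU)
    have "homologous_rel 8 SU3_top {}
       (?cm (\<lambda>B. M (C B) ** C B) c + one) (?cm (\<lambda>B. M (C B)) c + ?cm C c)"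
    proof -
      have "?cm (\<lambda>B. M (K (mat 1) B) ** K (mat 1) B) c = one"
        unfolding one_def by (rule cong) (simp add: K1 M1)
      moreover have "?cm (\<lambda>B. M (K (M B) B) ** K (mat 1) B) c = ?cm (\<lambda>B. M (C B)) c"
        by (rule cong) (simp add: K1 C_def)
      moreover have "?cm (\<lambda>B. M (K (mat 1) B) ** K (M B) B) c = ?cm C c"
        by (rule cong) (simp add: K1 M1 C_def)
      ultimately show ?thesis
        using word_base_additive [OF W M M c] by (simp add: C_def)
    qed
    then have 1: "bounds (?cm (\<lambda>B. M (C B) ** C B) c + one - (?cm (\<lambda>B. M (C B)) c + ?cm C c))"
      by (simp add: homologous_rel_def)
    have 2: "bounds (?cm (\<lambda>B. M (C B)) c)"
    proof -
      have "continuous_map SU3_top SU3_top conj_transpose" by (auto intro!: continuous_intros)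
      from twist_factor_boundary [OF this cC] show ?thesis
        by (simp add: chain_map_chain_map M_def)
    qed
    have 3: "bounds (?cm (\<lambda>B. M (C B) ** C B) c + ?cm C c)"
      using twist_inv_chain [OF cC]
      by (simp add: chain_map_chain_map M_def)
    have "bounds (?cm C c + ?cm C c)"
      using singular_relboundary_diff [OF singular_relboundary_diff [OF singular_relboundary_add [OF 3 one] 1] 2]
      by (simp add: algebra_simps)
    then show ?thesis
      using no_2_torsion_SU3 cC unfolding no_2_torsion_in_def by blast
  qed
  \<comment> \<open>Fibre additivity for the word \<open>K a b ** c\<close>: the mixed terms reduce
    to \<open>B\<close>, \<open>C\<close> and constants, so the degree of \<open>C B\<close> exceeds
    that of \<open>C\<close>, which is 0, by 1.\<close>
  have CB: "bounds (?cm (\<lambda>B. C B ** B) c - c)"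
  proof -
    have W: "continuous_word (\<lambda>a b c. K a b ** c)"
      by (intro continuous_wordI contM contK continuous_intros SU3_mult KSU MSU)
    have "?cm (\<lambda>B. K (M B) (mat 1) ** mat 1) c = one" "?cm (\<lambda>B. K (mat 1) B ** mat 1) c = one"
       "?cm (\<lambda>B. K (mat 1) (mat 1) ** mat 1) c = one"
       "?cm (\<lambda>B. K (mat 1) (mat 1) ** B) c = ?cm (\<lambda>B. B) c" "?cm (\<lambda>B. K (M B) (mat 1) ** B) c = ?cm (\<lambda>B. B) c"
       "?cm (\<lambda>B. K (mat 1) B ** B) c = ?cm (\<lambda>B. B) c" "?cm (\<lambda>B. K (M B) B ** mat 1) c = ?cm C c"
      unfolding one_def by (rule cong; simp add: K1 MSU C_def)+
    then have "bounds (?cm (\<lambda>B. C B ** B) c + one + c + one - (c + ?cm C c + c + one))"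
      using word_fibre_additive [OF W M c] by (simp add: homologous_rel_def C_def id)
    from singular_relboundary_diff [OF singular_relboundary_add [OF this C0] one] show ?thesis
      by (simp add: algebra_simps)
  qed
  \<comment> \<open>The commutator \<open>C(B)\<close> turns \<open>B M(B)\<close> into
    \<open>M(B) B\<close>. Base additivity compares this word with \<open>C(B) B\<close> and
    \<open>B M(B)\<close>.\<close>
  have BM: "bounds (?cm (\<lambda>B. B ** M B) c + c)"
  proof -
    have W: "continuous_word (\<lambda>a b c. K a c ** c ** b)"
      by (intro continuous_wordI contM contK continuous_intros SU3_mult KSU MSU)
    have "?cm (\<lambda>B. K (M B) B ** B ** M B) c = ?cm (\<lambda>B. M B ** B) c"
    proof (rule cong)
      fix B assume "B \<in> SU3"
      then show "K (M B) B ** B ** M B = M B ** B"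
        using SU3_D [OF \<open>B \<in> SU3\<close>] SU3_D [OF MSU [OF \<open>B \<in> SU3\<close>]]
        by (simp add: K_def flip: matrix_mul_assoc)
    qed
    moreover have "?cm (\<lambda>B. K (mat 1) B ** B ** mat 1) c = ?cm (\<lambda>B. B) c"
      "?cm (\<lambda>B. K (M B) B ** B ** mat 1) c = ?cm (\<lambda>B. C B ** B) c"
      "?cm (\<lambda>B. K (mat 1) B ** B ** M B) c = ?cm (\<lambda>B. B ** M B) c"
      by (rule cong; simp add: K1 C_def)+
    ultimately have "bounds (?cm (\<lambda>B. M B ** B) c + c - (?cm (\<lambda>B. C B ** B) c + ?cm (\<lambda>B. B ** M B) c))"
      using word_base_additive [OF W M M c] by (simp add: homologous_rel_def id)
    from singular_relboundary_diff [OF MB singular_relboundary_add [OF this CB]] show ?thesis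
      by (simp add: algebra_simps)
  qed
  define S where "S = ?cm (\<lambda>B. B ** B) c"
  \<comment> \<open>The four copies of \<open>c\<close> arise as follows: two from the terms
    \<open>M B\<close> of degree \<open>-1\<close> on one side of the relation, two from the terms
    \<open>B\<close> on the other.\<close>
  have MBB: "bounds (?cm (\<lambda>B. M B ** B ** B) c - S + (c + c + c + c))"
  proof -
    have W: "continuous_word (\<lambda>a b c. a ** b ** c)"
      by (intro continuous_wordI continuous_intros SU3_mult)
    have "bounds (?cm (\<lambda>B. M B ** B ** B) c + ?cm M c + c + c
       - (?cm (\<lambda>B. M B ** B) c + ?cm (\<lambda>B. M B ** B) c + S + one))"
      using word_fibre_additive [OF W M c] by (simp add: homologous_rel_def S_def one_def id)
    from singular_relboundary_diff [OF singular_relboundary_add [OF singular_relboundary_add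
      [OF singular_relboundary_add [OF this MB] MB] one] Mb] show ?thesis
      by (simp add: algebra_simps)
  qed
  \<comment> \<open>The same count; the term with third letter 1 is now \<open>B M\<close>, which
    makes its degree necessary.\<close>
  have BMB: "bounds (?cm (\<lambda>B. B ** M B ** B) c - S + (c + c + c + c))"
  proof -
    have W: "continuous_word (\<lambda>a b c. b ** a ** c)"
      by (intro continuous_wordI continuous_intros SU3_mult)
    have "bounds (?cm (\<lambda>B. B ** M B ** B) c + ?cm M c + c + c
       - (?cm (\<lambda>B. M B ** B) c + ?cm (\<lambda>B. B ** M B) c + S + one))"
      using word_fibre_additive [OF W M c] by (simp add: homologous_rel_def S_def one_def id)
    from singular_relboundary_diff [OF singular_relboundary_add [OF singular_relboundary_add
      [OF singular_relboundary_add [OF this MB] BM] one] Mb] show ?thesis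
      by (simp add: algebra_simps)
  qed
  have cS: "singular_relcycle 8 SU3_top {} S"
  proof -
    have "continuous_map SU3_top SU3_top (\<lambda>B. B ** B)" by (auto intro!: continuous_intros)
    then show ?thesis using singular_relcycle_chain_map [OF c, of SU3_top "\<lambda>B. B ** B" "{}"] by (simp add: S_def)
  qed
  \<comment> \<open>The word is the square of \<open>M B\<close>, the image of \<open>B\<close>
    under the automorphism \<open>twisted_cnj\<close>, hence the image of
    \<open>B B\<close>.\<close>
  have MBMB: "bounds (?cm (\<lambda>B. M B ** B ** M B ** B) c + S)"
  proof -
    have "?cm (\<lambda>B. M B ** B ** M B ** B) c = ?cm (twisted_cnj \<circ> (\<lambda>B. B ** B)) c"
    proof (rule cong)
      fix B assume B: "B \<in> SU3"
      have "M B ** B ** M B ** B = (M B ** B) ** (M B ** B)" by (simp add: matrix_mul_assoc)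
      also have "\<dots> = (twisted_cnj \<circ> (\<lambda>B. B ** B)) B"
        using B by (simp add: M_def twist_inv_mult twisted_cnj_mult)
      finally show "M B ** B ** M B ** B = (twisted_cnj \<circ> (\<lambda>B. B ** B)) B" .
    qed
    then show ?thesis
      using twisted_cnj_chain [OF cS] by (simp add: chain_map_compose S_def)
  qed
  \<comment> \<open>The two occurrences of \<open>M\<close> are treated as independent letters, with
    the same \<open>B\<close> kept twice.\<close>
  have sum: "bounds (?cm (\<lambda>B. M B ** B ** M B ** B) c + S
      - (?cm (\<lambda>B. M B ** B ** B) c + ?cm (\<lambda>B. B ** M B ** B) c))"
  proof -
    have W: "continuous_word (\<lambda>a b c. a ** c ** b ** c)"
      by (intro continuous_wordI continuous_intros SU3_mult)
    show ?thesis
      using word_base_additive [OF W M M c] by (simp add: homologous_rel_def S_def)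
  qed
  from singular_relboundary_diff [OF MBMB singular_relboundary_add [OF sum singular_relboundary_add [OF MBB BMB]]]
  have "bounds ((S - (c + c + c + c)) + (S - (c + c + c + c)))"
    by (simp add: algebra_simps)
  moreover have "singular_relcycle 8 SU3_top {} (S - (c + c + c + c))"
    by (intro singular_relcycle_diff singular_relcycle_add cS c)
  ultimately have "bounds (S - (c + c + c + c))"
    using no_2_torsion_SU3 unfolding no_2_torsion_in_def by blast
  moreover have "frag_cmul 4 c = c + c + c + c"
    using frag_cmul_distrib [of 1 3 c] frag_cmul_distrib [of 1 2 c] frag_cmul_distrib [of 1 1 c] by (simp add: add.assoc)
  ultimately show ?thesis by (simp add: S_def)
qed

section \<open>Polynomial selfmaps\<close>

definition monomial3 :: "(3 \<Rightarrow> 3 \<Rightarrow> nat) \<Rightarrow> complex^3^3 \<Rightarrow> complex" where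
  "monomial3 e B = (\<Prod>i\<in>UNIV. \<Prod>j\<in>UNIV. (B $ i $ j) ^ e i j)"

lemma real_coeff_polynomial_iff:
  "real_coeff_polynomial p \<longleftrightarrow>
     (\<exists>E c. finite E \<and> (\<forall>B. p B = (\<Sum>e\<in>E. complex_of_real (c e) * monomial3 e B)))"
  unfolding real_coeff_polynomial_def monomial3_def ..

lemma real_coeff_polynomial_const: "real_coeff_polynomial (\<lambda>B. of_real r)"
  unfolding real_coeff_polynomial_iff
  by (rule exI [of _ "{\<lambda>i j. 0}"], rule exI [of _ "\<lambda>e. r"]) (simp add: monomial3_def)

lemma real_coeff_polynomial_entry: "real_coeff_polynomial (\<lambda>B. B $ i $ j)"
proof -
  have "monomial3 (\<lambda>a b. if a = i \<and> b = j then 1 else 0) B = B $ i $ j" for B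
  proof -
    have "(\<Prod>b\<in>UNIV. (B $ a $ b) ^ (if a = i \<and> b = j then 1 else 0)) = (if a = i then B $ i $ j else 1)" for a
    proof (cases "a = i")
      case True
      have "(\<Prod>b\<in>UNIV. (B $ a $ b) ^ (if a = i \<and> b = j then 1 else 0)) = (\<Prod>b\<in>UNIV. if b = j then B $ i $ b else 1)"
        using True by (intro prod.cong) auto
      then show ?thesis using True by (simp add: prod.delta)
    qed simp
    then show ?thesis
      unfolding monomial3_def by (simp add: prod.delta)
  qed
  then show ?thesis
    unfolding real_coeff_polynomial_iff
    by (intro exI [of _ "{\<lambda>a b. if a = i \<and> b = j then 1 else 0}"] exI [of _ "\<lambda>e. 1"]) simp
qed

lemma real_coeff_polynomial_add:
  assumes "real_coeff_polynomial p" "real_coeff_polynomial q"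
  shows "real_coeff_polynomial (\<lambda>B. p B + q B)"
proof -
  obtain E c where E: "finite E" and p: "\<And>B. p B = (\<Sum>e\<in>E. complex_of_real (c e) * monomial3 e B)"
    using assms(1) unfolding real_coeff_polynomial_iff by blast
  obtain F d where F: "finite F" and q: "\<And>B. q B = (\<Sum>e\<in>F. complex_of_real (d e) * monomial3 e B)"
    using assms(2) unfolding real_coeff_polynomial_iff by blast
  \<comment> \<open>The coefficient functions are arbitrary outside their supports and must be set
    to 0 there before both sums are taken over the union.\<close>
  define c' where "c' e = (if e \<in> E then c e else 0)" for e
  define d' where "d' e = (if e \<in> F then d e else 0)" for e
  have "p B = (\<Sum>e\<in>E \<union> F. complex_of_real (c' e) * monomial3 e B)" for B
    unfolding p by (rule sum.mono_neutral_cong_left) (use E F in \<open>auto simp: c'_def\<close>)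
  moreover have "q B = (\<Sum>e\<in>E \<union> F. complex_of_real (d' e) * monomial3 e B)" for B
    unfolding q by (rule sum.mono_neutral_cong_left) (use E F in \<open>auto simp: d'_def\<close>)
  ultimately have "p B + q B = (\<Sum>e\<in>E \<union> F. complex_of_real (c' e + d' e) * monomial3 e B)" for B
    by (simp add: sum.distrib distrib_right)
  then show ?thesis
    unfolding real_coeff_polynomial_iff
    by (intro exI [of _ "E \<union> F"] exI [of _ "\<lambda>e. c' e + d' e"]) (simp add: E F)
qed

lemma real_coeff_polynomial_mult:
  assumes "real_coeff_polynomial p" "real_coeff_polynomial q"
  shows "real_coeff_polynomial (\<lambda>B. p B * q B)"
proof -
  obtain E c where E: "finite E" and p: "\<And>B. p B = (\<Sum>e\<in>E. complex_of_real (c e) * monomial3 e B)"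
    using assms(1) unfolding real_coeff_polynomial_iff by blast
  obtain F d where F: "finite F" and q: "\<And>B. q B = (\<Sum>e\<in>F. complex_of_real (d e) * monomial3 e B)"
    using assms(2) unfolding real_coeff_polynomial_iff by blast
  define h where "h x = (\<lambda>i j. fst x i j + snd x i j)" for x :: "(3 \<Rightarrow> 3 \<Rightarrow> nat) \<times> (3 \<Rightarrow> 3 \<Rightarrow> nat)"
  \<comment> \<open>Different pairs of exponents may have the same sum, so the coefficients of all
    pairs over one monomial are collected.\<close>
  define k where "k g = (\<Sum>x\<in>{x. x \<in> E \<times> F \<and> h x = g}. c (fst x) * d (snd x))" for g
  have mono: "monomial3 (h x) B = monomial3 (fst x) B * monomial3 (snd x) B" for x B
    by (simp add: monomial3_def h_def power_add prod.distrib)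
  have "p B * q B = (\<Sum>g\<in>h ` (E \<times> F). complex_of_real (k g) * monomial3 g B)" for B
  proof -
    have "p B * q B = (\<Sum>x\<in>E \<times> F. complex_of_real (c (fst x) * d (snd x)) * monomial3 (h x) B)"
      unfolding p q sum_product sum.cartesian_product
      by (intro sum.cong) (auto simp: mono mult_ac)
    also have "\<dots> = (\<Sum>g\<in>h ` (E \<times> F). \<Sum>x\<in>{x. x \<in> E \<times> F \<and> h x = g}. complex_of_real (c (fst x) * d (snd x)) * monomial3 (h x) B)"
      by (rule sum.image_gen) (simp add: E F)
    also have "\<dots> = (\<Sum>g\<in>h ` (E \<times> F). complex_of_real (k g) * monomial3 g B)"
      by (intro sum.cong refl) (simp add: k_def sum_distrib_right)
    finally show ?thesis .
  qed
  then show ?thesis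
    unfolding real_coeff_polynomial_iff
    by (intro exI [of _ "h ` (E \<times> F)"] exI [of _ k]) (simp add: E F)
qed

text \<open>Agreement is required on the group alone, since the cofactor formulas for conjugates
  hold there and not for all matrices.\<close>

definition polynomial_on_SU3 :: "(complex^3^3 \<Rightarrow> complex) \<Rightarrow> bool" where
  "polynomial_on_SU3 f \<longleftrightarrow> (\<exists>p. real_coeff_polynomial p \<and> (\<forall>B\<in>SU3. f B = p B))"

lemma polynomial_on_SU3_const: "polynomial_on_SU3 (\<lambda>B. of_real r)"
  unfolding polynomial_on_SU3_def using real_coeff_polynomial_const by blast

lemma polynomial_on_SU3_entry: "polynomial_on_SU3 (\<lambda>B. B $ i $ j)"
  unfolding polynomial_on_SU3_def using real_coeff_polynomial_entry by blast

lemma polynomial_on_SU3_add: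
  "polynomial_on_SU3 f \<Longrightarrow> polynomial_on_SU3 g \<Longrightarrow> polynomial_on_SU3 (\<lambda>B. f B + g B)"
  unfolding polynomial_on_SU3_def using real_coeff_polynomial_add by (metis (no_types, lifting))

lemma polynomial_on_SU3_mult:
  "polynomial_on_SU3 f \<Longrightarrow> polynomial_on_SU3 g \<Longrightarrow> polynomial_on_SU3 (\<lambda>B. f B * g B)"
  unfolding polynomial_on_SU3_def using real_coeff_polynomial_mult by (metis (no_types, lifting))

lemma polynomial_on_SU3_diff:
  assumes "polynomial_on_SU3 f" "polynomial_on_SU3 g"
  shows "polynomial_on_SU3 (\<lambda>B. f B - g B)"
  using polynomial_on_SU3_add [OF assms(1) polynomial_on_SU3_mult [OF polynomial_on_SU3_const [of "-1"] assms(2)]]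
  by simp

lemma polynomial_on_SU3_cong:
  "polynomial_on_SU3 f \<Longrightarrow> (\<And>B. B \<in> SU3 \<Longrightarrow> g B = f B) \<Longrightarrow> polynomial_on_SU3 g"
  unfolding polynomial_on_SU3_def by force

lemma polynomial_selfmap_iff:
  "polynomial_selfmap_SU3 \<phi> \<longleftrightarrow> (\<forall>B\<in>SU3. \<phi> B \<in> SU3) \<and> (\<forall>i j. polynomial_on_SU3 (\<lambda>B. \<phi> B $ i $ j))"
  unfolding polynomial_selfmap_SU3_def polynomial_on_SU3_def by auto

lemma polynomial_selfmap_mult:
  assumes "polynomial_selfmap_SU3 \<phi>" "polynomial_selfmap_SU3 \<psi>"
  shows "polynomial_selfmap_SU3 (\<lambda>B. \<phi> B ** \<psi> B)"
  using assms unfolding polynomial_selfmap_iff matrix_mult_nth sum_3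
  by (intro conjI allI ballI polynomial_on_SU3_add polynomial_on_SU3_mult SU3_mult) auto

lemma polynomial_selfmap_id: "polynomial_selfmap_SU3 (\<lambda>B. B)"
  unfolding polynomial_selfmap_iff by (simp add: polynomial_on_SU3_entry)

lemma polynomial_selfmap_const:
  assumes "A \<in> SU3" "\<And>i j. A $ i $ j \<in> \<real>"
  shows "polynomial_selfmap_SU3 (\<lambda>B. A)"
  unfolding polynomial_selfmap_iff
  using assms polynomial_on_SU3_const by (metis Reals_cases)

lemma polynomial_selfmap_transpose:
  assumes "polynomial_selfmap_SU3 \<phi>"
  shows "polynomial_selfmap_SU3 (\<lambda>B. transpose (\<phi> B))"
proof -
  have "transpose A $ i $ j = A $ j $ i" for A :: "complex^3^3" and i j
    by (simp add: transpose_def)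
  then show ?thesis using assms unfolding polynomial_selfmap_iff by auto
qed

text \<open>By the cofactor formulas the conjugated entries are 2 by 2 minors, thus polynomials in
  the entries themselves.\<close>

lemma polynomial_selfmap_conj_transpose:
  assumes "polynomial_selfmap_SU3 \<phi>"
  shows "polynomial_selfmap_SU3 (\<lambda>B. conj_transpose (\<phi> B))"
proof -
  have SU: "\<phi> B \<in> SU3" if "B \<in> SU3" for B
    using assms that by (simp add: polynomial_selfmap_iff)
  have p: "polynomial_on_SU3 (\<lambda>B. \<phi> B $ i $ j)" for i j
    using assms by (simp add: polynomial_selfmap_iff)
  have "\<forall>j i. polynomial_on_SU3 (\<lambda>B. cnj (\<phi> B $ j $ i))"
    unfolding forall_3
    by (intro conjI; rule polynomial_on_SU3_cong [OF _ SU3_cofactors(1) [OF SU]] polynomial_on_SU3_cong [OF _ SU3_cofactors(2) [OF SU]]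
       polynomial_on_SU3_cong [OF _ SU3_cofactors(3) [OF SU]] polynomial_on_SU3_cong [OF _ SU3_cofactors(4) [OF SU]]
       polynomial_on_SU3_cong [OF _ SU3_cofactors(5) [OF SU]] polynomial_on_SU3_cong [OF _ SU3_cofactors(6) [OF SU]]
       polynomial_on_SU3_cong [OF _ SU3_cofactors(7) [OF SU]] polynomial_on_SU3_cong [OF _ SU3_cofactors(8) [OF SU]]
       polynomial_on_SU3_cong [OF _ SU3_cofactors(9) [OF SU]];
       (intro polynomial_on_SU3_diff polynomial_on_SU3_mult p)?)
  then show ?thesis
    using SU by (auto simp: polynomial_selfmap_iff)
qed

text \<open>The quarter turn is a real matrix, as real coefficients require.\<close>

lemma polynomial_selfmap_twist: "polynomial_selfmap_SU3 twist"
proof -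
  have q: "polynomial_selfmap_SU3 (\<lambda>B. quarter_turn)"
    by (rule polynomial_selfmap_const [OF rot12_SU3]) (simp add: rot12_def)
  show ?thesis
    unfolding twist_def [abs_def]
    by (intro polynomial_selfmap_mult polynomial_selfmap_transpose polynomial_selfmap_id q)
qed

lemma polynomial_selfmap_matrix_pow:
  assumes "polynomial_selfmap_SU3 \<phi>"
  shows "polynomial_selfmap_SU3 (\<lambda>B. matrix_pow (\<phi> B) n)"
proof (induction n)
  case 0
  show ?case
    unfolding matrix_pow.simps by (rule polynomial_selfmap_const) (simp_all add: mat_1_nth)
next
  case (Suc n)
  then show ?case using assms by (simp add: polynomial_selfmap_mult)
qed

lemma has_degree_SU3I:
  assumes "continuous_on SU3 \<phi>" "\<And>B. B \<in> SU3 \<Longrightarrow> \<phi> B \<in> SU3"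
    "\<And>c. singular_relcycle 8 SU3_top {} c \<Longrightarrow> bounds (chain_map 8 \<phi> c - frag_cmul d c)"
  shows "has_degree_SU3 \<phi> d"
  unfolding has_degree_SU3_def
  by (rule has_mapping_degree_chain) (use assms in \<open>auto simp: homologous_rel_def\<close>)

lemma odd_degree_map:
  obtains \<phi> where "polynomial_selfmap_SU3 \<phi>" "continuous_on SU3 \<phi>"
    "\<And>c. singular_relcycle 8 SU3_top {} c \<Longrightarrow> bounds (chain_map 8 \<phi> c - frag_cmul (2 * l + 1) c)"
proof (cases "l \<ge> 0")
  case True
  show thesis
  proof
    show "polynomial_selfmap_SU3 (\<lambda>B. matrix_pow (twist B) (nat l) ** B)"
      by (intro polynomial_selfmap_mult polynomial_selfmap_matrix_pow polynomial_selfmap_twist polynomial_selfmap_id)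
    show "continuous_on SU3 (\<lambda>B. matrix_pow (twist B) (nat l) ** B)"
      by (intro continuous_intros)
    show "bounds (chain_map 8 (\<lambda>B. matrix_pow (twist B) (nat l) ** B) c - frag_cmul (2 * l + 1) c)"
      if "singular_relcycle 8 SU3_top {} c" for c
      using twist_pow_chain [OF that, of "nat l"] True by (simp add: add.commute)
  qed
next
  case False
  show thesis
  proof
    show "polynomial_selfmap_SU3 (\<lambda>B. matrix_pow (twist_inv B) (nat (- l)) ** B)"
      by (intro polynomial_selfmap_mult polynomial_selfmap_matrix_pow polynomial_selfmap_conj_transpose
          polynomial_selfmap_twist polynomial_selfmap_id)
    show "continuous_on SU3 (\<lambda>B. matrix_pow (twist_inv B) (nat (- l)) ** B)"
      by (intro continuous_intros)
    show "bounds (chain_map 8 (\<lambda>B. matrix_pow (twist_inv B) (nat (- l)) ** B) c - frag_cmul (2 * l + 1) c)"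
      if "singular_relcycle 8 SU3_top {} c" for c
      using twist_inv_pow_chain [OF that, of "nat (- l)"] False by (simp add: add.commute)
  qed
qed

theorem corollary4p3:
  fixes m :: nat and l :: int
  shows "\<exists>\<phi>. polynomial_selfmap_SU3 \<phi> \<and> has_degree_SU3 \<phi> (4 ^ m * (2 * l + 1))"
proof -
  \<comment> \<open>The induction carries the chain identity for all cycles, so that the result on
    squaring can be applied to the image of a cycle under \<phi>.\<close>
  have "\<exists>\<phi>. polynomial_selfmap_SU3 \<phi> \<and> continuous_on SU3 \<phi> \<and>
     (\<forall>c. singular_relcycle 8 SU3_top {} c \<longrightarrow> bounds (chain_map 8 \<phi> c - frag_cmul (4 ^ m * (2 * l + 1)) c))"
  proof (induction m)
    case 0
    show ?case using odd_degree_map [of l] by (metis mult_1 power_0)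
  next
    case (Suc m)
    define d :: int where "d = 4 ^ m * (2 * l + 1)"
    obtain \<phi> where p: "polynomial_selfmap_SU3 \<phi>" and cont: "continuous_on SU3 \<phi>"
      and deg: "\<And>c. singular_relcycle 8 SU3_top {} c \<Longrightarrow> bounds (chain_map 8 \<phi> c - frag_cmul d c)"
      using Suc unfolding d_def by blast
    have "continuous_map SU3_top SU3_top \<phi>"
      using p cont by (auto simp: polynomial_selfmap_iff)
    then have cyc: "singular_relcycle 8 SU3_top {} (chain_map 8 \<phi> c)" if "singular_relcycle 8 SU3_top {} c" for c
      using singular_relcycle_chain_map [OF that, of SU3_top \<phi> "{}"] by simp
    \<comment> \<open>The next map squares the values of \<phi>: it is squaring after \<phi>, so the
      degree is multiplied by 4, and as a product of polynomial maps it is again polynomial.\<close>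
    have "bounds (chain_map 8 (\<lambda>B. \<phi> B ** \<phi> B) c - frag_cmul (4 ^ Suc m * (2 * l + 1)) c)"
      if c: "singular_relcycle 8 SU3_top {} c" for c
    proof -
      have "chain_map 8 (\<lambda>B. \<phi> B ** \<phi> B) c = chain_map 8 (\<lambda>B. B ** B) (chain_map 8 \<phi> c)"
        by (simp add: chain_map_chain_map)
      moreover have "frag_cmul (4 ^ Suc m * (2 * l + 1)) c = frag_cmul 4 (frag_cmul d c)"
        by (simp add: d_def mult.assoc)
      ultimately show ?thesis
        using singular_relboundary_add [OF square_chain [OF cyc [OF c]] singular_relboundary_cmul [OF deg [OF c], of 4]]
        by (simp only: frag_cmul_diff_right) (simp add: algebra_simps)
    qed
    then show ?case
      using polynomial_selfmap_mult [OF p p] cont continuous_on_matrix_mult [OF cont cont] by blast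
  qed
  then show ?thesis
    using has_degree_SU3I by (metis polynomial_selfmap_iff)
qed

end
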